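(* Let $m\ge1$ be an integer, assume that the parameterizations of the curves $\Gamma\in\{\Gamma_b,\Gamma_i\}$ are of class $C^3$, and let $\{\mathcal T_h\}_{h\le h_0}$ be a quasi-uniform family of interface-fitted curved meshes as described in the context, with $h_0$ sufficiently small. Then there exists a constant $C$, independent of $K$ and $h$, such that $$|v_h|_{j,K}\le C\,h_K^{\ell-j}\,|v_h|_{\ell,K},\qquad 0\le\ell\le j\le2,\quad v_h\in S_h^m(K),\quad K\in\mathcal T_h.$$ The constant may depend on the fixed polynomial degree $m$ and on the mesh and geometric regularity constants.
   Context: Geometry. $\Omega\subset\mathbb R^2$ is a bounded domain with smooth boundary $\Gamma_b$; $\Gamma_i\subset\Omega$ is a smooth curve separating $\Omega$ into disjoint open subdomains $\Omega^\pm$, $\Omega=\Omega^-\cup\Gamma_i\cup\Omega^+$. Each $\Gamma\in\{\Gamma_b,\Gamma_i\}$ has a regular parameterization $\mathbf g:[\xi_s,\xi_e]\to\mathbb R^2$ (depending on $\Gamma$) of class at least $C^2$. Put $\boldsymbol\tau=\mathbf g'/\|\mathbf g'\|$, $\mathbf n=Q\boldsymbol\tau$ with $Q=\begin{bmatrix}0&1\\-1&0\end{bmatrix}$, $\kappa=(\mathbf g')^TQ\mathbf g''/\|\mathbf g'\|^3$. The Frenet transformation is $P_\Gamma(\eta,\xi)=\mathbf g(\xi)+\eta\,\mathbf n(\xi)$, and $N_\Gamma(\epsilon)=P_\Gamma([-\epsilon,\epsilon]\times[\xi_s,\xi_e])$. Let $\epsilon_0>0$ be such that for $0<\epsilon\le\epsilon_0$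 and both curves: $P_\Gamma$ is a bijection onto $N_\Gamma(\epsilon)$ with inverse $R_\Gamma(x,y)=(\eta(x,y),\xi(x,y))$ (for a closed curve, modulo identification of $\xi_s$ and $\xi_e$, $\xi$ being taken as a continuous branch on each element); $\tfrac12\le1+\eta\kappa(\xi)\le2$; $|\det DP_\Gamma|,|\det DR_\Gamma|$ lie between positive constants and $\|DP_\Gamma\|,\|DR_\Gamma\|$ are bounded; and $N_{\Gamma_b}(\epsilon)\cap N_{\Gamma_i}(\epsilon)=\emptyset$. Meshes. Start from shape-regular straight-sided triangulations $\overline{\mathcal T}_h$ associated with $\Omega$. An edge fits a curve if both its endpoints lie on the curve. The mesh is interface-fitted: no element is cut by $\Gamma_i$ without having an edge fitted to $\Gamma_i$. Elements with a designated edge fitted to $\Gamma_b$ or $\Gamma_i$ are replaced by curved triangles $K$ in which that straight edge is replaced by the corresponding arc of the curve; these curved triangles form $\mathcal T_h^c$. The remaining straight triangles form $\mathcal T_h^r$, and $\mathcal T_h=\mathcal T_h^c\cup\mathcal T_h^r$. With $h_K=\operatorname{diam}K$, $h=\max_Kh_K$, and $\rho_K$ the supremum of radii of balls contained in $K$, we assume $h_K/\rho_K\le C_{\mathrm{sh}}$ uniformly. Quasi-uniform means $h\le C h_K$ for all $K\in\mathcal T_h$ uniformly. The curve $\Gamma$ associated with $K\in\mathcal T_h^c$ is the one to which its curved edge belongs; for some fixed $\epsilon\in(0,\epsilon_0]$ and all $h\le h_0$, each $K\in\mathcal T_h^c$ lies in $N_\Gamma(\epsilon)$ of its associated curve. Local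 spaces. $\mathbb P_m$ denotes polynomials of total degree at most $m$. For $K\in\mathcal T_h^c$ with associated curve $\Gamma$, $S_h^m(K):=\{(\widehat v\circ R_\Gamma)|_K:\widehat v\in\mathbb P_m\text{ in the variables }(\eta,\xi)\}$. For $K\in\mathcal T_h^r$, $S_h^m(K):=\mathbb P_m(K)$. $|\cdot|_{k,K}$ is the $H^k(K)$ seminorm, $|\cdot|_{0,K}=\|\cdot\|_{0,K}$ the $L^2(K)$ norm. *)

theory Defs
  imports "HOL-Analysis.Analysis"
begin

type_synonym plane = "real^2"

text \<open>
  A curve with parameterization \<open>par\<close> on the interval from \<open>ps\<close> to \<open>pe\<close>.  If the curve is
  closed, \<open>par\<close> is read as the periodic function on the whole line with period \<open>pe - ps\<close> (see
  \<open>regular_curve\<close>), and \<open>pdom\<close>, the set of admissible parameters, is the whole line.  This is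
  what makes a continuous branch of the tangential coordinate possible on an element that
  contains the base point of the curve, and it makes the regularity of a closed parameterization
  include the matching of the derivatives at the two ends.
\<close>

record curve =
  par :: "real \<Rightarrow> plane"
  ps :: real
  pe :: real

definition closed_curve :: "curve \<Rightarrow> bool" where
  "closed_curve c \<longleftrightarrow> par c (ps c) = par c (pe c)"

definition pdom :: "curve \<Rightarrow> real set" where
  "pdom c = (if closed_curve c then UNIV else {ps c..pe c})"

definition curve_image :: "curve \<Rightarrow> plane set" where
  "curve_image c = par c ` {ps c..pe c}"

definition Ck_on :: "nat \<Rightarrow> real set \<Rightarrow> (real \<Rightarrow> plane) \<Rightarrow> bool" where
  "Ck_on k J f \<longleftrightarrow>
     (\<exists>D. D 0 = f \<and>
        (\<forall>i<k. \<forall>t\<in>J. (D i has_vector_derivative D (Suc i) t) (at t within J)) \<and>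
        continuous_on J (D k))"

definition dpar :: "curve \<Rightarrow> real \<Rightarrow> plane" where
  "dpar c t = vector_derivative (par c) (at t within pdom c)"

definition ddpar :: "curve \<Rightarrow> real \<Rightarrow> plane" where
  "ddpar c t = vector_derivative (dpar c) (at t within pdom c)"

definition regular_curve :: "nat \<Rightarrow> curve \<Rightarrow> bool" where
  "regular_curve k c \<longleftrightarrow>
     ps c < pe c \<and>
     (closed_curve c \<longrightarrow> (\<forall>t. par c (t + (pe c - ps c)) = par c t)) \<and>
     Ck_on k (pdom c) (par c) \<and>
     (\<forall>t\<in>pdom c. dpar c t \<noteq> 0)"

definition Q :: "real^2^2" where
  "Q = vector [vector [0, 1], vector [-1, 0]]"

definition tangent :: "curve \<Rightarrow> real \<Rightarrow> plane" where
  "tangent c t = dpar c t /\<^sub>R norm (dpar c t)"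

definition normal :: "curve \<Rightarrow> real \<Rightarrow> plane" where
  "normal c t = Q *v tangent c t"

definition curvature :: "curve \<Rightarrow> real \<Rightarrow> real" where
  "curvature c t = (dpar c t \<bullet> (Q *v ddpar c t)) / norm (dpar c t) ^ 3"

text \<open>The Frenet coordinates \<open>(\<eta>, \<xi>)\<close> are the components \<open>p $ 1\<close>, \<open>p $ 2\<close> of a vector \<open>p\<close>.\<close>

definition frenet :: "curve \<Rightarrow> plane \<Rightarrow> plane" where
  "frenet c p = par c (p $ 2) + (p $ 1) *\<^sub>R normal c (p $ 2)"

definition strip :: "curve \<Rightarrow> real \<Rightarrow> plane set" where
  "strip c \<epsilon> = {p. p $ 1 \<in> {-\<epsilon>..\<epsilon>} \<and> p $ 2 \<in> pdom c}"

definition tube :: "curve \<Rightarrow> real \<Rightarrow> plane set" where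
  "tube c \<epsilon> = frenet c ` {p. p $ 1 \<in> {-\<epsilon>..\<epsilon>} \<and> p $ 2 \<in> {ps c..pe c}}"

definition frenet_jac :: "curve \<Rightarrow> real \<Rightarrow> plane \<Rightarrow> real^2^2" where
  "frenet_jac c \<epsilon> p = matrix (frechet_derivative (frenet c) (at p within strip c \<epsilon>))"

text \<open>
  The Jacobian of the inverse Frenet transformation at the point \<open>frenet c p\<close> is the inverse
  of the matrix \<open>frenet_jac c \<epsilon> p\<close>.
\<close>

definition tubular :: "curve \<Rightarrow> real \<Rightarrow> bool" where
  "tubular c \<epsilon> \<longleftrightarrow>
     inj_on (frenet c)
       {p. p $ 1 \<in> {-\<epsilon>..\<epsilon>} \<and>
           p $ 2 \<in> (if closed_curve c then {ps c..<pe c} else {ps c..pe c})} \<and>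
     (\<forall>p\<in>strip c \<epsilon>. 1/2 \<le> 1 + p $ 1 * curvature c (p $ 2) \<and>
                    1 + p $ 1 * curvature c (p $ 2) \<le> 2) \<and>
     (\<exists>M>0. \<forall>p\<in>strip c \<epsilon>.
        frenet c differentiable (at p within strip c \<epsilon>) \<and>
        \<bar>det (frenet_jac c \<epsilon> p)\<bar> \<in> {1/M..M} \<and>
        \<bar>det (matrix_inv (frenet_jac c \<epsilon> p))\<bar> \<in> {1/M..M} \<and>
        onorm ((*v) (frenet_jac c \<epsilon> p)) \<le> M \<and>
        onorm ((*v) (matrix_inv (frenet_jac c \<epsilon> p))) \<le> M)"

definition interface_geometry ::
  "plane set \<Rightarrow> plane set \<Rightarrow> plane set \<Rightarrow> curve \<Rightarrow> curve \<Rightarrow> real \<Rightarrow> bool" where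
  "interface_geometry \<Omega> \<Omega>m \<Omega>p \<Gamma>b \<Gamma>i \<epsilon>\<^sub>0 \<longleftrightarrow>
     open \<Omega> \<and> connected \<Omega> \<and> bounded \<Omega> \<and> \<Omega> \<noteq> {} \<and>
     frontier \<Omega> = curve_image \<Gamma>b \<and>
     curve_image \<Gamma>i \<subseteq> \<Omega> \<and>
     open \<Omega>m \<and> connected \<Omega>m \<and> \<Omega>m \<noteq> {} \<and>
     open \<Omega>p \<and> connected \<Omega>p \<and> \<Omega>p \<noteq> {} \<and>
     \<Omega> = \<Omega>m \<union> curve_image \<Gamma>i \<union> \<Omega>p \<and>
     \<Omega>m \<inter> \<Omega>p = {} \<and> \<Omega>m \<inter> curve_image \<Gamma>i = {} \<and> \<Omega>p \<inter> curve_image \<Gamma>i = {} \<and>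
     regular_curve 2 \<Gamma>b \<and> regular_curve 2 \<Gamma>i \<and>
     0 < \<epsilon>\<^sub>0 \<and>
     (\<forall>\<epsilon>. 0 < \<epsilon> \<and> \<epsilon> \<le> \<epsilon>\<^sub>0 \<longrightarrow>
        tubular \<Gamma>b \<epsilon> \<and> tubular \<Gamma>i \<epsilon> \<and> tube \<Gamma>b \<epsilon> \<inter> tube \<Gamma>i \<epsilon> = {})"

text \<open>
  \<open>Straight V\<close> is the triangle with vertex set \<open>V\<close>.  \<open>Curved c s t z\<close> is obtained from the
  straight triangle with vertices \<open>par c s\<close>, \<open>par c t\<close>, \<open>z\<close> by replacing the designated edge
  between the first two vertices by the arc of \<open>c\<close> between the parameters \<open>s\<close> and \<open>t\<close>.
\<close>

datatype element =
    Straight "plane set"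
  | Curved curve real real plane

fun verts :: "element \<Rightarrow> plane set" where
  "verts (Straight V) = V"
| "verts (Curved c s t z) = {par c s, par c t, z}"

fun region :: "element \<Rightarrow> plane set" where
  "region (Straight V) = convex hull V"
| "region (Curved c s t z) =
     (let B = par c ` {s..t} \<union> closed_segment (par c t) z \<union> closed_segment z (par c s)
      in B \<union> inside B)"

text \<open>The conditions on \<open>Curved c s t z\<close> say that its boundary is a simple closed curve.\<close>

fun admissible :: "curve set \<Rightarrow> real \<Rightarrow> element \<Rightarrow> bool" where
  "admissible \<G> \<epsilon> (Straight V) \<longleftrightarrow> True"
| "admissible \<G> \<epsilon> (Curved c s t z) \<longleftrightarrow>
     c \<in> \<G> \<and> s < t \<and> s \<in> pdom c \<and> t \<in> pdom c \<and> inj_on (par c) {s..t} \<and>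
     par c ` {s..t} \<inter> (closed_segment (par c t) z \<union> closed_segment z (par c s))
       = {par c s, par c t} \<and>
     region (Curved c s t z) \<subseteq> tube c \<epsilon>"

definition inradius :: "plane set \<Rightarrow> real" where
  "inradius K = Sup {r. 0 \<le> r \<and> (\<exists>x. ball x r \<subseteq> K)}"

definition shape_regular :: "real \<Rightarrow> plane set \<Rightarrow> bool" where
  "shape_regular \<sigma> K \<longleftrightarrow> diameter K \<le> \<sigma> * inradius K"

text \<open>
  A straight triangulation is given by the set of the vertex sets of its triangles.  The last
  conjunct: an edge that belongs to only one triangle fits the boundary curve.
\<close>

definition straight_mesh :: "plane set \<Rightarrow> curve \<Rightarrow> real \<Rightarrow> plane set set \<Rightarrow> bool" where
  "straight_mesh \<Omega> \<Gamma>b \<sigma> \<V> \<longleftrightarrow>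
     (\<forall>V\<in>\<V>. card V = 3 \<and> \<not> affine_dependent V \<and> V \<subseteq> closure \<Omega> \<and>
        shape_regular \<sigma> (convex hull V)) \<and>
     triangulation ((hull) convex ` \<V>) \<and>
     (\<forall>V\<in>\<V>. \<forall>e\<subseteq>V. card e = 2 \<and> (\<forall>W\<in>\<V>. e \<subseteq> W \<longrightarrow> W = V) \<longrightarrow> e \<subseteq> curve_image \<Gamma>b)"

definition interface_fitted :: "curve \<Rightarrow> plane set set \<Rightarrow> bool" where
  "interface_fitted \<Gamma>i \<V> \<longleftrightarrow>
     (\<forall>V\<in>\<V>. interior (convex hull V) \<inter> curve_image \<Gamma>i \<noteq> {} \<longrightarrow>
        (\<exists>e\<subseteq>V. card e = 2 \<and> e \<subseteq> curve_image \<Gamma>i))"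

definition curved_mesh ::
  "plane set \<Rightarrow> curve \<Rightarrow> curve \<Rightarrow> real \<Rightarrow> real \<Rightarrow> element set \<Rightarrow> bool" where
  "curved_mesh \<Omega> \<Gamma>b \<Gamma>i \<epsilon> \<sigma> \<T> \<longleftrightarrow>
     finite \<T> \<and> \<T> \<noteq> {} \<and> inj_on verts \<T> \<and>
     straight_mesh \<Omega> \<Gamma>b \<sigma> (verts ` \<T>) \<and>
     interface_fitted \<Gamma>i (verts ` \<T>) \<and>
     (\<forall>K\<in>\<T>. admissible {\<Gamma>b, \<Gamma>i} \<epsilon> K \<and> shape_regular \<sigma> (region K))"

definition mesh_size :: "element set \<Rightarrow> real" where
  "mesh_size \<T> = Max ((\<lambda>K. diameter (region K)) ` \<T>)"

text \<open>A family of meshes is indexed by a set \<open>H\<close> of mesh sizes.\<close>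

definition quasi_uniform_family ::
  "plane set \<Rightarrow> curve \<Rightarrow> curve \<Rightarrow> real \<Rightarrow> real \<Rightarrow> real \<Rightarrow> real set \<Rightarrow> (real \<Rightarrow> element set) \<Rightarrow> bool"
  where
  "quasi_uniform_family \<Omega> \<Gamma>b \<Gamma>i \<epsilon> \<sigma> \<mu> H \<T> \<longleftrightarrow>
     (\<forall>h\<in>H. curved_mesh \<Omega> \<Gamma>b \<Gamma>i \<epsilon> \<sigma> (\<T> h) \<and> mesh_size (\<T> h) = h \<and>
        (\<forall>K\<in>\<T> h. h \<le> \<mu> * diameter (region K)))"

definition poly2 :: "nat \<Rightarrow> (plane \<Rightarrow> real) set" where
  "poly2 m = {q. \<exists>a. \<forall>p. q p = (\<Sum>i\<le>m. \<Sum>j\<le>m - i. a i j * (p $ 1) ^ i * (p $ 2) ^ j)}"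

text \<open>
  \<open>R\<close> is a continuous branch on \<open>K\<close> of the inverse Frenet transformation.  On a connected set
  two branches differ by a shift of \<open>\<xi>\<close> by a multiple of the period, which leaves the space
  \<open>poly2 m\<close> invariant.
\<close>

definition frenet_branch :: "curve \<Rightarrow> real \<Rightarrow> plane set \<Rightarrow> (plane \<Rightarrow> plane) \<Rightarrow> bool" where
  "frenet_branch c \<epsilon> K R \<longleftrightarrow>
     continuous_on K R \<and> (\<forall>x\<in>K. R x \<in> strip c \<epsilon> \<and> frenet c (R x) = x)"

fun local_space :: "nat \<Rightarrow> real \<Rightarrow> element \<Rightarrow> (plane \<Rightarrow> real) set" where
  "local_space m \<epsilon> (Straight V) =
     {v. \<exists>q\<in>poly2 m. \<forall>x\<in>region (Straight V). v x = q x}"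
| "local_space m \<epsilon> (Curved c s t z) =
     {v. \<exists>q\<in>poly2 m. \<exists>R. frenet_branch c \<epsilon> (region (Curved c s t z)) R \<and>
           (\<forall>x\<in>region (Curved c s t z). v x = q (R x))}"

definition pd :: "2 \<Rightarrow> (plane \<Rightarrow> real) \<Rightarrow> plane \<Rightarrow> real" where
  "pd i f x = frechet_derivative f (at x) (axis i 1)"

text \<open>All iterated partial derivatives exist as differentiable functions.\<close>

definition smooth :: "(plane \<Rightarrow> real) \<Rightarrow> bool" where
  "smooth f \<longleftrightarrow> (\<forall>is. foldr pd is f differentiable_on UNIV)"

definition test_functions :: "plane set \<Rightarrow> (plane \<Rightarrow> real) set" where
  "test_functions U =
     {\<phi>. smooth \<phi> \<and> compact (closure {x. \<phi> x \<noteq> 0}) \<and> closure {x. \<phi> x \<noteq> 0} \<subseteq> U}"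

definition loc_integrable :: "plane set \<Rightarrow> (plane \<Rightarrow> real) \<Rightarrow> bool" where
  "loc_integrable U w \<longleftrightarrow> (\<forall>C. compact C \<and> C \<subseteq> U \<longrightarrow> w absolutely_integrable_on C)"

text \<open>\<open>w\<close> is a weak derivative of \<open>v\<close> on \<open>U\<close> of order \<open>a\<close> in \<open>x\<close> and \<open>b\<close> in \<open>y\<close>.\<close>

definition is_weak_deriv ::
  "plane set \<Rightarrow> nat \<Rightarrow> nat \<Rightarrow> (plane \<Rightarrow> real) \<Rightarrow> (plane \<Rightarrow> real) \<Rightarrow> bool" where
  "is_weak_deriv U a b v w \<longleftrightarrow>
     loc_integrable U v \<and> loc_integrable U w \<and>
     (\<forall>\<phi>\<in>test_functions U.
        (LINT x:U|lebesgue. v x * ((pd 1 ^^ a) ((pd 2 ^^ b) \<phi>)) x) =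
        (-1) ^ (a + b) * (LINT x:U|lebesgue. w x * \<phi> x))"

definition weak_deriv ::
  "plane set \<Rightarrow> nat \<Rightarrow> nat \<Rightarrow> (plane \<Rightarrow> real) \<Rightarrow> plane \<Rightarrow> real" where
  "weak_deriv U a b v = (SOME w. is_weak_deriv U a b v w)"

definition sobolev :: "nat \<Rightarrow> plane set \<Rightarrow> (plane \<Rightarrow> real) set" where
  "sobolev k U =
     {v. \<forall>a b. a + b \<le> k \<longrightarrow>
        (\<exists>w. is_weak_deriv U a b v w \<and> (\<lambda>x. (w x)\<^sup>2) absolutely_integrable_on U)}"

text \<open>
  Meaningful for \<open>v \<in> sobolev k U\<close>, where the weak derivatives exist, are unique up to null
  sets and are square integrable.
\<close>

definition seminorm :: "nat \<Rightarrow> plane set \<Rightarrow> (plane \<Rightarrow> real) \<Rightarrow> real" where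
  "seminorm k U v =
     sqrt (\<Sum>a\<le>k. LINT x:U|lebesgue. (weak_deriv U a (k - a) v x)\<^sup>2)"

end

theory Submission
  imports Defs
begin

text \<open>
  On an element \<open>K\<close> of diameter \<open>h\<close> every function of the local space is \<open>v = q \<circ> R\<close> with a
  polynomial \<open>q\<close> and a chart \<open>R\<close>, which is the identity or a branch of the inverse Frenet
  transformation.  By the regularity of the curve the first derivatives of \<open>v\<close> are comparable to the
  first derivatives of \<open>q\<close>, and the second derivatives are bounded by the first and second
  derivatives of \<open>q\<close>.  This reduces the claim to bounding the L2 norm of \<open>\<partial>q \<circ> R\<close> by \<open>1 / h\<close> times that
  of \<open>q \<circ> R\<close>.  For the latter no change of variables is needed.  Since \<open>R\<close> maps \<open>K\<close> into a ball of
  radius comparable to \<open>h\<close>, and onto a concentric ball of comparable radius, Lagrange interpolation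
  bounds \<open>\<bar>q\<bar>\<close> and \<open>h \<bar>\<partial>q\<bar>\<close> on the large ball by the maximum \<open>S\<close> of \<open>\<bar>q\<bar>\<close> on the small one; then
  \<open>\<bar>q \<circ> R\<bar> \<ge> S / 2\<close> on a ball in \<open>K\<close> of radius comparable to \<open>h\<close> around the point where \<open>S\<close> is
  attained, so that \<open>S h\<close> is bounded by the L2 norm of \<open>q \<circ> R\<close>.
\<close>

section \<open>Weak derivatives\<close>

text \<open>The seminorms are defined through an arbitrarily chosen weak derivative. Before any
  estimate, the classical derivatives of \<open>q \<circ> R\<close> must be shown to be weak ones,
  and weak derivatives to be unique almost everywhere; this is why test functions are constructed.
  All geometry is packed into the locale \<open>chart\<close>, whose single constant
  \<open>N\<close> bounds the ratios of sizes and the coefficients; the analytic constant depends on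
  \<open>m\<close> and \<open>N\<close> alone, and three kinds of charts (two curves and the
  identity) give one constant for all meshes. Differentiating \<open>q \<circ> R\<close> twice
  differentiates the Jacobian of \<open>R\<close> once, hence the curvature once, which is where
  three derivatives of the parameterization enter. It also leaves a first order term beside the
  second order one, absorbed by means of \<open>r \<le> 1\<close>. The branch \<open>R\<close> is
  only assumed continuous, so its Lipschitz bound, differentiability and covering property have to
  be derived from the Frenet map; the Lipschitz bound is what asks for small elements.\<close>

lemma lborel_integral_translation:
  fixes f :: "'a::euclidean_space \<Rightarrow> real"
  assumes [measurable]: "f \<in> borel_measurable borel"
  shows "(LINT x|lborel. f (x + c)) = (LINT x|lborel. f x)"
proof -
  have "(LINT x|lborel. f x) = (LINT x|distr lborel borel ((+) c). f x)"
    by (simp add: lborel_distr_plus)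
  also have "\<dots> = (LINT x|lborel. f (c + x))"
    by (subst integral_distr) auto
  finally show ?thesis by (simp add: add.commute)
qed

lemma continuous_compact_support_integrable:
  fixes f :: "'a::euclidean_space \<Rightarrow> real"
  assumes "continuous_on UNIV f" "compact S" "\<And>x. x \<notin> S \<Longrightarrow> f x = 0"
  shows "integrable lborel f"
proof -
  have "integrable lborel (\<lambda>x. indicator S x *\<^sub>R f x)"
    by (rule borel_integrable_compact[OF assms(2)]) (use assms(1) continuous_on_subset in blast)
  moreover have "(\<lambda>x. indicator S x *\<^sub>R f x) = f"
    using assms(3) by (auto simp: fun_eq_iff indicator_def)
  ultimately show ?thesis by simp
qed

text \<open>Difference quotients have integral zero by translation invariance.\<close>

lemma integral_directional_derivative:
  fixes f :: "'a::euclidean_space \<Rightarrow> real"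
  assumes der: "\<And>x. (f has_derivative f' x) (at x)"
    and cont: "continuous_on UNIV (\<lambda>x. f' x e)"
    and S: "compact S" and zero: "\<And>x. x \<notin> S \<Longrightarrow> f x = 0"
  shows "(LINT x|lebesgue. f' x e) = 0"
proof -
  have contf: "continuous_on UNIV f"
    using der by (meson continuous_on_eq_continuous_within has_derivative_continuous continuous_at_imp_continuous_at_within)
  have zero': "f' x e = 0" if "x \<notin> S" for x
  proof -
    have "(f has_derivative (\<lambda>h. 0)) (at x)"
    proof (rule has_derivative_transform_within_open[where f = "\<lambda>_. 0"])
      show "open (- S)" using S compact_imp_closed by blast
    qed (use that zero in auto)
    then show ?thesis using has_derivative_unique[OF der] by metis
  qed
  obtain B where B: "\<And>x. \<bar>f' x e\<bar> \<le> B"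
  proof -
    have "bounded ((\<lambda>x. f' x e) ` S)"
      using S cont by (meson compact_continuous_image compact_imp_bounded continuous_on_subset subset_UNIV)
    then obtain B where "B > 0" "\<And>x. x \<in> S \<Longrightarrow> \<bar>f' x e\<bar> \<le> B"
      by (auto simp: bounded_pos)
    then show ?thesis using zero' that[of B] by (metis abs_zero less_imp_le)
  qed
  obtain N where N: "N > 0" "S \<subseteq> cball 0 N"
    using S compact_imp_bounded[of S] by (auto simp: bounded_pos subset_iff)
  define s where "s = (\<lambda>n x. (f (x + (1 / real (Suc n)) *\<^sub>R e) - f x) * real (Suc n))"
  have fm: "f \<in> borel_measurable borel"
    using contf by (rule borel_measurable_continuous_onI)
  have fint: "integrable lborel f"
    by (rule continuous_compact_support_integrable[OF contf S zero])
  have fint': "integrable lborel (\<lambda>x. f (x + c))" for c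
  proof (rule continuous_compact_support_integrable)
    show "continuous_on UNIV (\<lambda>x. f (x + c))"
      by (rule continuous_on_compose2[OF contf]) (auto intro!: continuous_intros)
    show "compact ((+) (-c) ` S)" using S by (rule compact_translation)
    show "f (x + c) = 0" if "x \<notin> (+) (-c) ` S" for x
      using that zero[of "x + c"] by (metis add.commute add_uminus_conv_diff diff_add_cancel image_eqI)
  qed
  have sint: "(LINT x|lborel. s n x) = 0" for n
    using lborel_integral_translation[OF fm] fint fint'
    by (simp add: s_def)
  \<comment> \<open>The quotients vanish outside the ball enlarged by \<open>norm e\<close>, because
    each shift has length at most \<open>norm e\<close>; inside it the mean value theorem turns a
    quotient into a value of the derivative in direction \<open>e\<close>, bounded by
    \<open>B\<close>.\<close>
  have "(\<lambda>n. LINT x|lborel. s n x) \<longlonglongrightarrow> (LINT x|lborel. f' x e)"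
  proof (rule integral_dominated_convergence[where w = "\<lambda>x. indicator (cball 0 (N + norm e)) x *\<^sub>R B"])
    show "(\<lambda>x. f' x e) \<in> borel_measurable lborel"
      using cont borel_measurable_continuous_onI by simp
    show "s n \<in> borel_measurable lborel" for n
      unfolding s_def using fm by simp
    show "integrable lborel (\<lambda>x. indicator (cball 0 (N + norm e)) x *\<^sub>R B)"
      by (rule borel_integrable_compact) auto
    have "(\<lambda>n. s n x) \<longlonglongrightarrow> f' x e" for x
    proof -
      have "((\<lambda>t. f (x + t *\<^sub>R e)) has_derivative (\<lambda>t. f' (x + 0 *\<^sub>R e) (t *\<^sub>R e))) (at 0)"
        by (rule has_derivative_compose[where f = "\<lambda>t. x + t *\<^sub>R e", OF _ der]) (auto intro!: derivative_eq_intros)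
      moreover have "f' x (t *\<^sub>R e) = t * f' x e" for t
        using linear_cmul[OF has_derivative_linear[OF der]] by simp
      ultimately have "((\<lambda>t. f (x + t *\<^sub>R e)) has_field_derivative f' x e) (at 0)"
        by (simp add: has_field_derivative_def mult_commute_abs)
      then have lim: "((\<lambda>t. (f (x + t *\<^sub>R e) - f x) / t) \<longlongrightarrow> f' x e) (at 0)"
        by (simp add: DERIV_def)
      have "filterlim (\<lambda>n. 1 / real (Suc n)) (at 0) sequentially"
        using LIMSEQ_inverse_real_of_nat by (intro filterlim_atI) (auto simp: inverse_eq_divide)
      from filterlim_compose[OF lim this] show ?thesis
        by (simp add: s_def)
    qed
    then show "AE x in lborel. (\<lambda>n. s n x) \<longlonglongrightarrow> f' x e" by simp
    have "\<bar>s n x\<bar> \<le> indicator (cball 0 (N + norm e)) x *\<^sub>R B" for n x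
    proof (cases "x \<in> cball 0 (N + norm e)")
      case True
      let ?y = "x + (1 / real (Suc n)) *\<^sub>R e"
      define k where "k = (1 / real (Suc n)) *\<^sub>R e"
      have d: "((\<lambda>t. f (x + t *\<^sub>R k)) has_derivative (\<lambda>s. f' (x + t *\<^sub>R k) (s *\<^sub>R k))) (at t within {0..1})" for t
        by (rule has_derivative_at_withinI, rule has_derivative_compose[where f = "\<lambda>t. x + t *\<^sub>R k", OF _ der])
          (auto intro!: derivative_eq_intros)
      obtain t where "f (x + 1 *\<^sub>R k) - f (x + 0 *\<^sub>R k) = f' (x + t *\<^sub>R k) ((1 - 0) *\<^sub>R k)"
        using mvt_simple[OF zero_less_one d] by blast
      then obtain z where "f ?y - f x = f' z ((1 / real (Suc n)) *\<^sub>R e)"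
        by (auto simp: k_def)
      also have "\<dots> = (1 / real (Suc n)) * f' z e"
        using linear_cmul[OF has_derivative_linear[OF der]] by simp
      finally have "s n x = f' z e" by (simp add: s_def)
      then show ?thesis using B True by simp
    next
      case False
      then have n: "norm x > N + norm e" by simp
      have "norm ((1 / real (Suc n)) *\<^sub>R e) \<le> norm e"
        by (simp add: divide_le_eq mult_le_cancel_left1)
      then have "norm (x + (1 / real (Suc n)) *\<^sub>R e) > N"
        using n norm_diff_ineq[of x "(1 / real (Suc n)) *\<^sub>R e"] by linarith
      then have "x + (1 / real (Suc n)) *\<^sub>R e \<notin> S" using N(2) by auto
      moreover have "x \<notin> S" using n N(2) norm_ge_zero[of e] unfolding subset_iff mem_cball_0 by (metis add_increasing2 leD order_trans order_refl)
      ultimately show ?thesis using zero False by (simp add: s_def)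
    qed
    then show "AE x in lborel. norm (s n x) \<le> indicator (cball 0 (N + norm e)) x *\<^sub>R B" for n by simp
  qed
  then have "(LINT x|lborel. f' x e) = 0" using sint by (simp add: LIMSEQ_const_iff)
  moreover have "(LINT x|lebesgue. f' x e) = (LINT x|lborel. f' x e)"
    using cont borel_measurable_continuous_onI by (intro integral_completion) simp
  ultimately show ?thesis by simp
qed

lemma pd_eq: "(f has_derivative f') (at x) \<Longrightarrow> pd i f x = f' (axis i 1)"
  unfolding pd_def using frechet_derivative_at by metis

lemma smooth_pd: "smooth f \<Longrightarrow> smooth (pd i f)"
  unfolding smooth_def
proof
  fix "is" assume "\<forall>is. foldr pd is f differentiable_on UNIV"
  then have "foldr pd (is @ [i]) f differentiable_on UNIV" by blast
  then show "foldr pd is (pd i f) differentiable_on UNIV" by simp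
qed

lemma smooth_has_derivative: "smooth f \<Longrightarrow> (f has_derivative frechet_derivative f (at x)) (at x)"
  unfolding smooth_def
  by (metis UNIV_I differentiable_on_eq_differentiable_at foldr_Nil frechet_derivative_works id_apply open_UNIV)

lemma smooth_continuous: "smooth f \<Longrightarrow> continuous_on S f"
  by (meson smooth_has_derivative continuous_at_imp_continuous_on has_derivative_continuous)

lemma test_functions_pd:
  assumes "\<phi> \<in> test_functions U"
  shows "pd i \<phi> \<in> test_functions U"
proof -
  let ?S = "closure {x. \<phi> x \<noteq> 0}"
  have "pd i \<phi> x = 0" if "x \<notin> ?S" for x
  proof -
    have "(\<phi> has_derivative (\<lambda>h. 0)) (at x)"
    proof (rule has_derivative_transform_within_open[where f = "\<lambda>_. 0"])
      show "open (- ?S)" by blast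
      show "0 = \<phi> y" if "y \<in> - ?S" for y using that closure_subset[of "{x. \<phi> x \<noteq> 0}"] by auto
    qed (use that in auto)
    then show ?thesis by (simp add: pd_eq)
  qed
  then have sub: "closure {x. pd i \<phi> x \<noteq> 0} \<subseteq> ?S" by (intro closure_minimal) auto
  then have "compact (closure {x. pd i \<phi> x \<noteq> 0})"
    using assms compact_closure bounded_subset unfolding test_functions_def
    by (metis (mono_tags, lifting) closed_closure closed_Int_compact inf.absorb1 mem_Collect_eq)
  then show ?thesis using assms sub smooth_pd unfolding test_functions_def by blast
qed

text \<open>The open sets \<open>U\<close> and \<open>- S\<close> cover the space, and the extended
  function is continuous on each of them.\<close>

lemma continuous_extend_zero:
  fixes g :: "'a::topological_space \<Rightarrow> 'b::{topological_space, zero}"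
  assumes "open U" "closed S" "S \<subseteq> U" "continuous_on U g" "\<And>x. x \<in> U \<Longrightarrow> x \<notin> S \<Longrightarrow> g x = 0"
  shows "continuous_on UNIV (\<lambda>x. if x \<in> U then g x else 0)"
proof -
  have "continuous_on (U \<union> - S) (\<lambda>x. if x \<in> U then g x else 0)"
  proof (rule continuous_on_open_Un)
    show "continuous_on U (\<lambda>x. if x \<in> U then g x else 0)"
      using assms(4) by (simp cong: continuous_on_cong)
    have "continuous_on (- S) (\<lambda>x. 0::'b)" by simp
    then show "continuous_on (- S) (\<lambda>x. if x \<in> U then g x else 0)"
      using assms(5) by (elim continuous_on_eq) auto
  qed (use assms in auto)
  moreover have "U \<union> - S = UNIV" using assms(3) by auto
  ultimately show ?thesis by simp
qed

lemma continuous_compact_support_integrable_lebesgue: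
  fixes f :: "'a::euclidean_space \<Rightarrow> real"
  assumes "continuous_on UNIV f" "compact S" "\<And>x. x \<notin> S \<Longrightarrow> f x = 0"
  shows "integrable lebesgue f"
  using continuous_compact_support_integrable[OF assms] borel_measurable_continuous_onI[OF assms(1)]
  by (simp add: integrable_completion)

lemma set_lebesgue_integral_eq_if:
  fixes g :: "'a \<Rightarrow> real"
  shows "(LINT x:U|M. g x) = (LINT x|M. (if x \<in> U then g x else 0))"
  unfolding set_lebesgue_integral_def by (rule Bochner_Integration.integral_cong) auto

text \<open>\<open>v\<close> is controlled only on the open set \<open>U\<close>, but its product
  with \<open>\<phi>\<close> extends by zero to a differentiable function with compact support on
  the whole plane. The directional derivative of such a function integrates to zero, and the product
  rule splits this integral into the two sides.\<close>

lemma integral_by_parts: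
  fixes v :: "plane \<Rightarrow> real"
  assumes U: "open U" and \<phi>: "\<phi> \<in> test_functions U"
    and der: "\<And>x. x \<in> U \<Longrightarrow> (v has_derivative v' x) (at x)"
    and cont: "continuous_on U (\<lambda>x. v' x (axis i 1))"
  shows "(LINT x:U|lebesgue. v x * pd i \<phi> x) = - (LINT x:U|lebesgue. v' x (axis i 1) * \<phi> x)"
proof -
  define S where "S = closure {x. \<phi> x \<noteq> 0}"
  have S: "compact S" "closed S" "S \<subseteq> U" and sm: "smooth \<phi>"
    using \<phi> by (auto simp: test_functions_def S_def)
  have z: "\<phi> x = 0" if "x \<notin> S" for x
    using that closure_subset[of "{x. \<phi> x \<noteq> 0}"] by (auto simp: S_def)
  have z': "pd i \<phi> x = 0" if "x \<notin> S" for x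
  proof -
    have "(\<phi> has_derivative (\<lambda>h. 0)) (at x)"
      by (rule has_derivative_transform_within_open[where f = "\<lambda>_. 0" and s = "- S"])
        (use that z S in auto)
    then show ?thesis by (simp add: pd_eq)
  qed
  let ?D = "\<lambda>x. frechet_derivative \<phi> (at x)"
  have D: "(\<phi> has_derivative ?D x) (at x)" for x using sm by (rule smooth_has_derivative)
  define F where "F = (\<lambda>x. if x \<in> U then v x * \<phi> x else 0)"
  \<comment> \<open>The case split is on the compact set \<open>S\<close> and not on
    \<open>U\<close>: the extended product vanishes on the open complement of \<open>S\<close>, so
    this formula is its derivative everywhere, whatever \<open>v'\<close> is outside
    \<open>U\<close>.\<close>
  define F' where "F' = (\<lambda>x h. if x \<in> S then v x * ?D x h + v' x h * \<phi> x else 0)"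
  have contv: "continuous_on U v"
    by (meson der continuous_at_imp_continuous_on has_derivative_continuous)
  have cont1: "continuous_on UNIV (\<lambda>x. if x \<in> U then v x * pd i \<phi> x else 0)"
    by (rule continuous_extend_zero[OF U S(2,3)])
      (use z' in \<open>auto intro!: continuous_on_mult contv smooth_continuous[OF smooth_pd[OF sm]]\<close>)
  have cont2: "continuous_on UNIV (\<lambda>x. if x \<in> U then v' x (axis i 1) * \<phi> x else 0)"
    by (rule continuous_extend_zero[OF U S(2,3)])
      (use z in \<open>auto intro!: continuous_on_mult cont smooth_continuous[OF sm]\<close>)
  have int1: "integrable lebesgue (\<lambda>x. if x \<in> U then v x * pd i \<phi> x else 0)"
    by (rule continuous_compact_support_integrable_lebesgue[OF cont1 S(1)]) (simp add: z')
  have int2: "integrable lebesgue (\<lambda>x. if x \<in> U then v' x (axis i 1) * \<phi> x else 0)"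
    by (rule continuous_compact_support_integrable_lebesgue[OF cont2 S(1)]) (simp add: z)
  have F'eq: "F' x (axis i 1) = (if x \<in> U then v x * pd i \<phi> x else 0) + (if x \<in> U then v' x (axis i 1) * \<phi> x else 0)" for x
    using S(3) z z' by (auto simp: F'_def pd_def)
  have "(LINT x|lebesgue. F' x (axis i 1)) = 0"
  proof (rule integral_directional_derivative[OF _ _ S(1)])
    show "F x = 0" if "x \<notin> S" for x using z[OF that] by (simp add: F_def)
    show "continuous_on UNIV (\<lambda>x. F' x (axis i 1))"
      unfolding F'eq by (intro continuous_intros cont1 cont2)
    show "(F has_derivative F' x) (at x)" for x
    proof (cases "x \<in> S")
      case True
      then have x: "x \<in> U" using S by auto
      have "((\<lambda>x. v x * \<phi> x) has_derivative F' x) (at x)"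
        using has_derivative_mult[OF der[OF x] D[of x]] True by (simp add: F'_def)
      then show ?thesis
        by (rule has_derivative_transform_within_open[OF _ U x]) (simp add: F_def)
    next
      case False
      have "((\<lambda>x. 0) has_derivative F' x) (at x)" using False by (simp add: F'_def)
      then show ?thesis
        by (rule has_derivative_transform_within_open[where s = "- S"]) (use False S z in \<open>auto simp: F_def\<close>)
    qed
  qed
  then have "(LINT x|lebesgue. (if x \<in> U then v x * pd i \<phi> x else 0)) + (LINT x|lebesgue. (if x \<in> U then v' x (axis i 1) * \<phi> x else 0)) = 0"
    unfolding F'eq using int1 int2 by simp
  then show ?thesis
    by (simp add: set_lebesgue_integral_eq_if)
qed

section \<open>Smooth bump functions\<close>

definition exp_recip :: "real poly \<Rightarrow> real \<Rightarrow> real" where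
  "exp_recip P t = (if t > 0 then poly P (1/t) * exp (- (1/t)) else 0)"

lemma poly_exp_tendsto_0: "((\<lambda>x. poly P x * exp (- x)) \<longlongrightarrow> 0) (at_top :: real filter)"
proof -
  have "((\<lambda>x. \<Sum>i\<le>degree P. coeff P i * (x ^ i / exp x)) \<longlongrightarrow> (\<Sum>i\<le>degree P. coeff P i * 0)) (at_top :: real filter)"
    by (intro tendsto_intros tendsto_power_div_exp_0)
  then show ?thesis
    by (simp add: poly_altdef sum_distrib_right exp_minus divide_inverse mult.assoc)
qed

text \<open>With \<open>s = 1 / t\<close> one has \<open>ds/dt = - s^2\<close>, so the derivative of
  \<open>P(s) exp (- s)\<close> in \<open>t\<close> is \<open>s^2 (P - P')(s) exp (- s)\<close>:
  these flat functions form a family closed under differentiation. At zero the right difference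
  quotient is \<open>s P(s) exp (- s)\<close>, which decays as \<open>s\<close> grows.\<close>

lemma exp_recip_deriv:
  "(exp_recip P has_real_derivative exp_recip (monom 1 2 * (P - pderiv P)) t) (at t)"
proof -
  consider "t > 0" | "t < 0" | "t = 0" by linarith
  then show ?thesis
  proof cases
    case 1
    have "((\<lambda>t. poly P (1/t) * exp (- (1/t))) has_real_derivative exp_recip (monom 1 2 * (P - pderiv P)) t) (at t)"
      using 1 by (auto intro!: derivative_eq_intros simp: exp_recip_def poly_monom field_simps power2_eq_square)
    then show ?thesis
      by (rule has_field_derivative_transform_within_open[where S = "{0<..}"]) (use 1 in \<open>auto simp: exp_recip_def\<close>)
  next
    case 2
    have "((\<lambda>t. 0) has_real_derivative exp_recip (monom 1 2 * (P - pderiv P)) t) (at t)"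
      using 2 by (simp add: exp_recip_def)
    then show ?thesis
      by (rule has_field_derivative_transform_within_open[where S = "{..<0}"]) (use 2 in \<open>auto simp: exp_recip_def\<close>)
  next
    case 3
    have "((\<lambda>h. exp_recip P h / h) \<longlongrightarrow> 0) (at_right 0)"
    proof -
      have "((\<lambda>h. poly (monom 1 1 * P) (inverse h) * exp (- inverse h)) \<longlongrightarrow> 0) (at_right (0::real))"
        by (rule filterlim_compose[OF poly_exp_tendsto_0 filterlim_inverse_at_top_right])
      then show ?thesis
        by (rule Lim_transform_eventually)
          (auto simp: eventually_at_right_field exp_recip_def poly_monom field_simps intro!: exI[of _ 1])
    qed
    moreover have "((\<lambda>h. exp_recip P h / h) \<longlongrightarrow> 0) (at_left 0)"
      by (rule Lim_transform_eventually[OF tendsto_const])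
        (auto simp: eventually_at_left_field exp_recip_def intro!: exI[of _ "-1"])
    ultimately have "((\<lambda>h. exp_recip P h / h) \<longlongrightarrow> 0) (at 0)"
      by (simp add: filterlim_split_at)
    then show ?thesis using 3 by (simp add: DERIV_def exp_recip_def)
  qed
qed

text \<open>Partial derivatives stay in this set: sums come from the product rule, while the inner
  derivative of an atom, \<open>a\<close> or \<open>0\<close> according to the coordinate, is
  absorbed into the polynomial \<open>P\<close>. Existence of all iterated partial derivatives then
  follows by induction over the list of directions.\<close>

inductive_set bump_algebra :: "(plane \<Rightarrow> real) set" where
  atom: "(\<lambda>x. exp_recip P (a * x $ k + b)) \<in> bump_algebra"
| add: "f \<in> bump_algebra \<Longrightarrow> g \<in> bump_algebra \<Longrightarrow> (\<lambda>x. f x + g x) \<in> bump_algebra"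
| mult: "f \<in> bump_algebra \<Longrightarrow> g \<in> bump_algebra \<Longrightarrow> (\<lambda>x. f x * g x) \<in> bump_algebra"

lemma bump_algebra_pd:
  "f \<in> bump_algebra \<Longrightarrow> (\<forall>x. f differentiable at x) \<and> pd i f \<in> bump_algebra"
proof (induction rule: bump_algebra.induct)
  case (atom P a k b)
  let ?Q = "monom 1 2 * (P - pderiv P)"
  have d: "((\<lambda>x. exp_recip P (a * x $ k + b)) has_derivative (\<lambda>h. exp_recip ?Q (a * x $ k + b) * (a * h $ k))) (at x)" for x :: plane
  proof -
    have "((\<lambda>x. exp_recip P (a * x $ k + b)) has_derivative (\<lambda>h. (*) (exp_recip ?Q (a * x $ k + b)) (a * h $ k))) (at x)"
      by (rule has_derivative_compose[where f = "\<lambda>x. a * x $ k + b" and g = "exp_recip P"])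
        (auto simp: exp_recip_deriv[unfolded has_field_derivative_def]
          intro!: derivative_eq_intros bounded_linear.has_derivative[OF bounded_linear_vec_nth])
    then show ?thesis by simp
  qed
  have "pd i (\<lambda>x. exp_recip P (a * x $ k + b)) = (\<lambda>x. exp_recip (smult (if i = k then a else 0) ?Q) (a * x $ k + b))"
    unfolding fun_eq_iff pd_eq[OF d] by (simp add: exp_recip_def axis_def)
  moreover have "(\<lambda>x. exp_recip P (a * x $ k + b)) differentiable at x" for x
    using d unfolding differentiable_def by blast
  ultimately show ?case using bump_algebra.atom by simp
next
  case (add f g)
  have d: "((\<lambda>x. f x + g x) has_derivative (\<lambda>h. frechet_derivative f (at x) h + frechet_derivative g (at x) h)) (at x)" for x
    using add.IH by (intro has_derivative_add) (auto simp: frechet_derivative_works)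
  have "pd i (\<lambda>x. f x + g x) = (\<lambda>x. pd i f x + pd i g x)"
    by (simp add: pd_eq[OF d] fun_eq_iff) (simp add: pd_def)
  moreover have "(\<lambda>x. f x + g x) differentiable at x" for x
    using d unfolding differentiable_def by blast
  ultimately show ?case using add.IH bump_algebra.add by simp
next
  case (mult f g)
  have d: "((\<lambda>x. f x * g x) has_derivative (\<lambda>h. f x * frechet_derivative g (at x) h + frechet_derivative f (at x) h * g x)) (at x)" for x
    using mult.IH by (intro has_derivative_mult) (auto simp: frechet_derivative_works)
  have "pd i (\<lambda>x. f x * g x) = (\<lambda>x. f x * pd i g x + pd i f x * g x)"
    by (simp add: pd_eq[OF d] fun_eq_iff) (simp add: pd_def)
  moreover have "(\<lambda>x. f x * pd i g x + pd i f x * g x) \<in> bump_algebra"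
    using mult by (intro bump_algebra.intros) auto
  moreover have "(\<lambda>x. f x * g x) differentiable at x" for x
    using d unfolding differentiable_def by blast
  ultimately show ?case by simp
qed

lemma bump_algebra_smooth:
  assumes "f \<in> bump_algebra"
  shows "smooth f"
proof -
  have "foldr pd is f \<in> bump_algebra" for "is"
    by (induction "is") (use assms bump_algebra_pd in auto)
  then show ?thesis
    unfolding smooth_def using bump_algebra_pd by (simp add: differentiable_on_eq_differentiable_at)
qed

lemma loc_integrable_continuous:
  assumes "continuous_on U w"
  shows "loc_integrable U w"
  unfolding loc_integrable_def
proof (intro allI impI)
  fix C assume C: "compact C \<and> C \<subseteq> U"
  have "integrable lborel (\<lambda>x. indicator C x *\<^sub>R w x)"
    by (rule borel_integrable_compact) (use C assms continuous_on_subset in auto)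
  then show "w absolutely_integrable_on C"
    unfolding set_integrable_def using integrable_completion borel_measurable_integrable by blast
qed

text \<open>Four one-sided flat factors, one for each side of the box, lie between 0 and 1 and make
  the product vanish outside the box. The factor \<open>n\<close> in their arguments makes each tend
  to 1 at every interior point, since \<open>exp (- 1 / (n d))\<close> tends to 1 for
  \<open>d > 0\<close>. The functions do not depend on \<open>U\<close>, which only has to contain
  the closed box.\<close>

lemma bump_tendsto_indicator:
  fixes a b :: plane
  obtains \<phi> where "\<And>n U. cbox a b \<subseteq> U \<Longrightarrow> \<phi> n \<in> test_functions U"
    "\<And>x. (\<lambda>n. \<phi> n x) \<longlonglongrightarrow> indicator (box a b) x"
    "\<And>n x. \<bar>\<phi> n x\<bar> \<le> indicator (cbox a b) x"
proof
  define p where "p = (\<lambda>t. exp_recip 1 t)"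
  define \<phi> where "\<phi> = (\<lambda>(n::nat) (x::plane). (p (real n * x $ 1 + - (real n * a $ 1)) * p (- real n * x $ 1 + real n * b $ 1)) *
    (p (real n * x $ 2 + - (real n * a $ 2)) * p (- real n * x $ 2 + real n * b $ 2)))"
  have p0: "p t = 0" if "t \<le> 0" for t using that by (simp add: p_def exp_recip_def)
  have p1: "0 \<le> p t" "p t \<le> 1" for t by (auto simp: p_def exp_recip_def)
  have zero: "\<phi> n x = 0" if "x \<notin> box a b" for n x
  proof -
    consider i where "x $ i \<le> a $ i" | i where "x $ i \<ge> b $ i"
      using \<open>x \<notin> box a b\<close> by (auto simp: mem_box_cart not_less)
    then show ?thesis
    proof cases
      case 1
      then have "p (real n * x $ i + - (real n * a $ i)) = 0"
        by (intro p0) (simp add: mult_left_mono)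
      then show ?thesis using exhaust_2[of i] by (auto simp: \<phi>_def)
    next
      case 2
      then have "p (- real n * x $ i + real n * b $ i) = 0"
        by (intro p0) (simp add: mult_left_mono)
      then show ?thesis using exhaust_2[of i] by (auto simp: \<phi>_def)
    qed
  qed
  show "\<phi> n \<in> test_functions U" if "cbox a b \<subseteq> U" for n U
  proof -
    have "\<phi> n \<in> bump_algebra" unfolding \<phi>_def p_def by (intro bump_algebra.intros)
    moreover have sub: "closure {x. \<phi> n x \<noteq> 0} \<subseteq> cbox a b"
      using zero box_subset_cbox[of a b] by (intro closure_minimal) blast+
    moreover have "compact (closure {x. \<phi> n x \<noteq> 0})"
      using sub by (metis closed_closure closed_Int_compact inf.absorb1 compact_cbox)
    ultimately show ?thesis using that bump_algebra_smooth by (auto simp: test_functions_def)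
  qed
  show "\<bar>\<phi> n x\<bar> \<le> indicator (cbox a b) x" for n x
  proof (cases "x \<in> box a b")
    case True
    have "\<bar>\<phi> n x\<bar> \<le> 1"
      unfolding \<phi>_def abs_mult using p1 by (intro mult_le_one) auto
    then show ?thesis using True box_subset_cbox by (auto simp: indicator_def)
  qed (simp add: zero)
  show "(\<lambda>n. \<phi> n x) \<longlonglongrightarrow> indicator (box a b) x" for x
  proof (cases "x \<in> box a b")
    case True
    have lim: "(\<lambda>n. p (real n * d)) \<longlonglongrightarrow> 1" if "d > 0" for d
    proof -
      have "(\<lambda>n. exp (- (inverse (real n) * inverse d))) \<longlonglongrightarrow> exp (- (0 * inverse d))"
        by (intro tendsto_intros lim_inverse_n)
      then have "(\<lambda>n. exp (- (1 / (real n * d)))) \<longlonglongrightarrow> 1"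
        by (simp add: field_simps)
      then show ?thesis
        by (rule Lim_transform_eventually)
          (use that in \<open>auto simp: eventually_sequentially p_def exp_recip_def intro!: exI[of _ 1]\<close>)
    qed
    have "(\<lambda>n. (p (real n * (x $ 1 - a $ 1)) * p (real n * (b $ 1 - x $ 1))) *
       (p (real n * (x $ 2 - a $ 2)) * p (real n * (b $ 2 - x $ 2)))) \<longlonglongrightarrow> (1 * 1) * (1 * 1)"
      by (intro tendsto_mult lim) (use True in \<open>auto simp: mem_box_cart\<close>)
    then show ?thesis using True by (simp add: \<phi>_def algebra_simps)
  qed (simp add: zero)
qed

section \<open>The fundamental lemma of the calculus of variations\<close>

lemma integral_box_eq_0:
  assumes w: "loc_integrable U w"
    and orth: "\<And>\<phi>. \<phi> \<in> test_functions U \<Longrightarrow> (LINT x:U|lebesgue. w x * \<phi> x) = 0"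
    and sub: "cbox a b \<subseteq> U"
  shows "(LINT x:box a b|lebesgue. w x) = 0"
proof -
  obtain \<phi> where \<phi>: "\<And>n U. cbox a b \<subseteq> U \<Longrightarrow> \<phi> n \<in> test_functions U"
    "\<And>x. (\<lambda>n. \<phi> n x) \<longlonglongrightarrow> indicator (box a b) x"
    "\<And>n x. \<bar>\<phi> n x\<bar> \<le> indicator (cbox a b) x"
    using bump_tendsto_indicator[of a b] by blast
  let ?w = "\<lambda>x. indicator (cbox a b) x * w x"
  have wint: "integrable lebesgue ?w"
    using w sub compact_cbox unfolding loc_integrable_def set_integrable_def by auto
  then have wm: "?w \<in> borel_measurable lebesgue" by (rule borel_measurable_integrable)
  have z: "\<phi> n x = 0" if "x \<notin> cbox a b" for n x using \<phi>(3)[of n x] that by simp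
  \<comment> \<open>Off the closed box the bump functions vanish, so \<open>w\<close> may be cut off
    there; the cut-off function is integrable over the whole plane, and its absolute value is the
    majorant for the limit.\<close>
  have eq: "indicator U x *\<^sub>R (w x * \<phi> n x) = ?w x * \<phi> n x" for n x
    using z[of x n] sub by (auto simp: indicator_def)
  have "(\<lambda>n. LINT x|lebesgue. ?w x * \<phi> n x) \<longlonglongrightarrow> (LINT x|lebesgue. ?w x * indicator (box a b) x)"
  proof (rule integral_dominated_convergence[where w = "\<lambda>x. \<bar>?w x\<bar>"])
    have "\<phi> n \<in> borel_measurable lborel" for n
      using \<phi>(1)[OF sub, of n] by (auto simp: test_functions_def intro!: borel_measurable_continuous_onI smooth_continuous)
    then have \<phi>m: "\<phi> n \<in> borel_measurable lebesgue" for n by (rule measurable_completion)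
    show "(\<lambda>x. ?w x * \<phi> n x) \<in> borel_measurable lebesgue" for n
      by (rule borel_measurable_times[OF wm \<phi>m])
    show "(\<lambda>x. ?w x * indicator (box a b) x) \<in> borel_measurable lebesgue"
      by (rule borel_measurable_times[OF wm], rule borel_measurable_indicator) simp
    show "integrable lebesgue (\<lambda>x. \<bar>?w x\<bar>)" using wint by (rule integrable_abs)
    show "AE x in lebesgue. (\<lambda>n. ?w x * \<phi> n x) \<longlonglongrightarrow> ?w x * indicator (box a b) x"
      using \<phi>(2) by (intro AE_I2 tendsto_intros)
    have "\<bar>\<phi> n x\<bar> \<le> 1" for n x using \<phi>(3)[of n x] by (cases "x \<in> cbox a b") auto
    then show "AE x in lebesgue. norm (?w x * \<phi> n x) \<le> \<bar>?w x\<bar>" for n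
      by (auto simp: abs_mult mult_left_le)
  qed
  moreover have "(LINT x|lebesgue. ?w x * \<phi> n x) = 0" for n
    using orth[OF \<phi>(1)[OF sub], of n] unfolding set_lebesgue_integral_def eq .
  moreover have "?w x * indicator (box a b) x = indicator (box a b) x *\<^sub>R w x" for x
    using box_subset_cbox[of a b] by (auto simp: indicator_def)
  ultimately show ?thesis by (simp add: LIMSEQ_const_iff set_lebesgue_integral_def)
qed

lemma sigma_finite_lebesgue: "sigma_finite_measure (lebesgue :: 'a::euclidean_space measure)"
proof
  obtain A :: "'a set set" where A: "countable A" "A \<subseteq> sets lborel" "\<Union>A = space lborel" "\<forall>a\<in>A. emeasure lborel a \<noteq> \<infinity>"
    using lborel.sigma_finite_countable by blast
  then show "\<exists>A :: 'a set set. countable A \<and> A \<subseteq> sets lebesgue \<and> \<Union>A = space lebesgue \<and> (\<forall>a\<in>A. emeasure lebesgue a \<noteq> \<infinity>)"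
    by (intro exI[of _ A]) (auto simp: subset_iff)
qed

text \<open>Open boxes form an intersection-stable generator of the Borel sets, and the sets over
  which \<open>f\<close> integrates to zero are closed under complements and countable disjoint
  unions, so the integral vanishes over every Borel set. Lebesgue sets differ from Borel sets by
  null sets, and a density all of whose integrals vanish is zero almost everywhere.\<close>

lemma AE_0_if_integral_boxes_0:
  fixes f :: "'a::euclidean_space \<Rightarrow> real"
  assumes int: "integrable lebesgue f" and boxes: "\<And>a b. (LINT x:box a b|lebesgue. f x) = 0"
  shows "AE x in lebesgue. f x = 0"
proof (rule sigma_finite_measure.density_zero[OF sigma_finite_lebesgue int])
  have si: "set_integrable lebesgue A f" if "A \<in> sets lebesgue" for A
    using int that integrable_mult_indicator unfolding set_integrable_def by blast
  \<comment> \<open>The complement step of the induction needs the integral over the whole space,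
    which is exhausted by boxes.\<close>
  have tot: "(LINT x:UNIV|lebesgue. f x) = 0"
  proof -
    let ?B = "\<lambda>n::nat. box (- (real n *\<^sub>R One)) (real n *\<^sub>R One) :: 'a set"
    have inc: "incseq ?B"
      by (auto simp: incseq_def mem_box) (smt (verit) of_nat_mono)+
    have "(\<lambda>n. LINT x:?B n|lebesgue. f x) \<longlonglongrightarrow> (LINT x:(\<Union>n. ?B n)|lebesgue. f x)"
      by (rule set_integral_cont_up) (use inc si in auto)
    moreover have "(\<Union>n. ?B n) = UNIV"
      using UN_box_eq_UNIV by auto
    ultimately show ?thesis by (simp add: boxes LIMSEQ_const_iff)
  qed
  have bor: "(LINT x:A|lebesgue. f x) = 0" if "A \<in> sets borel" for A :: "'a set"
  proof -
    have leb: "A \<in> sets lebesgue" if "A \<in> sigma_sets UNIV (range (\<lambda>(a, b). box a b :: 'a set))" for A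
    proof -
      have "A \<in> sets borel" using that by (simp add: borel_eq_box)
      then show ?thesis by simp
    qed
    have "Int_stable (range (\<lambda>(a, b). box a b :: 'a set))"
      by (auto simp: Int_stable_def box_Int_box)
    moreover have "range (\<lambda>(a, b). box a b :: 'a set) \<subseteq> Pow UNIV" by simp
    moreover have "A \<in> sigma_sets UNIV (range (\<lambda>(a, b). box a b :: 'a set))"
      using that by (simp add: borel_eq_box)
    ultimately show ?thesis
    proof (induction rule: sigma_sets_induct_disjoint)
      case (basic A) then show ?case using boxes by auto
    next
      case empty show ?case by (simp add: set_lebesgue_integral_def)
    next
      case (compl A)
      then have A: "A \<in> sets lebesgue" by (intro leb)
      have "(LINT x:A \<union> (UNIV - A)|lebesgue. f x) = (LINT x:A|lebesgue. f x) + (LINT x:UNIV - A|lebesgue. f x)"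
        using A sets.compl_sets[OF A] by (intro set_integral_Un si) auto
      then show ?case using compl tot by simp
    next
      case (union A)
      then have A: "A i \<in> sets lebesgue" for i by (intro leb) auto
      have "(LINT x:(\<Union>i. A i)|lebesgue. f x) = (\<Sum>i. LINT x:A i|lebesgue. f x)"
        by (rule lebesgue_integral_countable_add)
          (use A si union in \<open>auto simp: disjoint_family_on_def\<close>)
      then show ?case using union by simp
    qed
  qed
  have meas: "set_borel_measurable lebesgue A f" if "A \<in> sets lebesgue" for A
    using si[OF that] unfolding set_borel_measurable_def set_integrable_def by (rule borel_measurable_integrable)
  fix A :: "'a set" assume A: "A \<in> sets lebesgue"
  then obtain S N N' where S: "A = S \<union> N" "N \<subseteq> N'" "N' \<in> null_sets lborel" "S \<in> sets lborel"
    by (rule sets_completionE)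
  have "(LINT x:A|lebesgue. f x) = (LINT x:S|lebesgue. f x)"
  proof (rule set_integral_cong_set)
    have "N' \<in> null_sets lebesgue" using S by (simp add: null_sets_completionI)
    then have "AE x in lebesgue. x \<notin> N'" by (rule AE_not_in)
    then show "AE x in lebesgue. (x \<in> S) = (x \<in> A)" by eventually_elim (use S in auto)
  qed (use meas A S in simp_all)
  then show "(LINT x:A|lebesgue. f x) = 0" using bor S by simp
qed

text \<open>On a closed box inside \<open>U\<close> the cut-off function is globally integrable, and
  its integral over any open box reduces to an integral of \<open>w\<close> over an intersection of
  two boxes, again a box. Countably many closed boxes cover \<open>U\<close>, so the exceptional
  null sets can be united.\<close>

lemma fundamental_lemma:
  assumes U: "open U" and w: "loc_integrable U w"
    and orth: "\<And>\<phi>. \<phi> \<in> test_functions U \<Longrightarrow> (LINT x:U|lebesgue. w x * \<phi> x) = 0"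
  shows "AE x in lebesgue. x \<in> U \<longrightarrow> w x = 0"
proof -
  have box: "AE x in lebesgue. x \<in> cbox a b \<longrightarrow> w x = 0" if "cbox a b \<subseteq> U" for a b
  proof -
    let ?f = "\<lambda>x. indicator (cbox a b) x * w x"
    have int: "integrable lebesgue ?f"
      using w that compact_cbox unfolding loc_integrable_def set_integrable_def by auto
    have bnull: "AE x in lebesgue. x \<in> cbox a b \<longrightarrow> x \<in> box a b"
    proof -
      have "cbox a b - box a b \<in> null_sets lebesgue"
        using negligible_frontier_interval[of a b] negligible_iff_null_sets by blast
      then have "AE x in lebesgue. x \<notin> cbox a b - box a b" by (rule AE_not_in)
      then show ?thesis by eventually_elim auto
    qed
    have "AE x in lebesgue. ?f x = 0"
    proof (rule AE_0_if_integral_boxes_0[OF int])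
      fix c d :: plane
      obtain p q where pq: "box c d \<inter> box a b = box p q" by (simp add: box_Int_box)
      have b: "box p q \<subseteq> cbox a b" using pq box_subset_cbox by blast
      have "(LINT x:box c d|lebesgue. ?f x) = (LINT x:box p q|lebesgue. w x)"
        unfolding set_lebesgue_integral_def
      proof (rule integral_cong_AE)
        show "(\<lambda>x. indicat_real (box c d) x *\<^sub>R ?f x) \<in> borel_measurable lebesgue"
          using int by (intro borel_measurable_scaleR borel_measurable_indicator borel_measurable_integrable) auto
        have "(\<lambda>x. indicat_real (box p q) x *\<^sub>R ?f x) \<in> borel_measurable lebesgue"
          using int by (intro borel_measurable_scaleR borel_measurable_indicator borel_measurable_integrable) auto
        moreover have "(\<lambda>x. indicat_real (box p q) x *\<^sub>R ?f x) = (\<lambda>x. indicat_real (box p q) x *\<^sub>R w x)"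
          using b by (auto simp: indicator_def fun_eq_iff subset_iff)
        ultimately show "(\<lambda>x. indicat_real (box p q) x *\<^sub>R w x) \<in> borel_measurable lebesgue" by simp
        show "AE x in lebesgue. indicat_real (box c d) x *\<^sub>R ?f x = indicat_real (box p q) x *\<^sub>R w x"
          using bnull by eventually_elim (use pq box_subset_cbox in \<open>auto simp: indicator_def\<close>)
      qed
      also have "\<dots> = 0"
      proof (cases "box p q = {}")
        case False
        \<comment> \<open>A nonempty open box has the closed box as its closure; a degenerate closed
          box may be nonempty while its open box is empty, hence the case distinction.\<close>
        then have "cbox p q \<subseteq> cbox a b" using b by (metis closed_cbox closure_box closure_minimal)
        then show ?thesis using integral_box_eq_0[OF w orth] that by blast
      qed (simp add: set_lebesgue_integral_def)
      finally show "(LINT x:box c d|lebesgue. ?f x) = 0" .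
    qed
    then show ?thesis by eventually_elim (auto simp: indicator_def)
  qed
  obtain D where D: "countable D" "D \<subseteq> Pow U" "\<And>X. X \<in> D \<Longrightarrow> \<exists>a b. X = cbox a b" "\<Union>D = U"
    using open_countable_Union_open_cbox[OF U] by metis
  have "AE x in lebesgue. \<forall>X\<in>D. x \<in> X \<longrightarrow> w x = 0"
    using box D by (subst AE_ball_countable[OF D(1)]) blast
  then show ?thesis by eventually_elim (use D(4) in auto)
qed

section \<open>Uniqueness of weak derivatives and values of the seminorms\<close>

lemma is_weak_deriv_unique:
  assumes U: "open U" and w: "is_weak_deriv U a b v w" and w': "is_weak_deriv U a b v w'"
  shows "AE x in lebesgue. x \<in> U \<longrightarrow> w x = w' x"
proof -
  have loc: "loc_integrable U w" "loc_integrable U w'"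
    using w w' by (auto simp: is_weak_deriv_def)
  then have "loc_integrable U (\<lambda>x. w x - w' x)" by (auto simp: loc_integrable_def)
  moreover have "(LINT x:U|lebesgue. (w x - w' x) * \<phi> x) = 0" if \<phi>: "\<phi> \<in> test_functions U" for \<phi>
  proof -
    let ?S = "closure {x. \<phi> x \<noteq> 0}"
    have S: "compact ?S" "?S \<subseteq> U" "smooth \<phi>" using \<phi> by (auto simp: test_functions_def)
    \<comment> \<open>Splitting the integral of the difference needs each product to be integrable:
      on its compact support \<open>\<phi>\<close> is bounded and \<open>u\<close> integrable, and
      elsewhere the product is zero.\<close>
    have int: "set_integrable lebesgue U (\<lambda>x. u x * \<phi> x)" if u: "loc_integrable U u" for u
    proof -
      have "(\<lambda>x. \<phi> x * u x) absolutely_integrable_on ?S"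
      proof (rule absolutely_integrable_bounded_measurable_product[OF bilinear_times])
        show "\<phi> \<in> borel_measurable (lebesgue_on ?S)"
          using S by (intro continuous_imp_measurable_on_sets_lebesgue smooth_continuous) auto
        show "bounded (\<phi> ` ?S)"
          using S by (intro compact_imp_bounded compact_continuous_image smooth_continuous) auto
      qed (use S u in \<open>auto simp: loc_integrable_def\<close>)
      moreover have "indicator U x *\<^sub>R (u x * \<phi> x) = indicator ?S x *\<^sub>R (\<phi> x * u x)" for x
        using S(2) closure_subset[of "{x. \<phi> x \<noteq> 0}"] by (auto simp: indicator_def)
      ultimately show ?thesis unfolding set_integrable_def by (simp only:)
    qed
    have "(LINT x:U|lebesgue. w x * \<phi> x) = (LINT x:U|lebesgue. w' x * \<phi> x)"
    proof -
      have "(-1::real) ^ (a + b) * (LINT x:U|lebesgue. w x * \<phi> x) = (-1) ^ (a + b) * (LINT x:U|lebesgue. w' x * \<phi> x)"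
        using w w' \<phi> unfolding is_weak_deriv_def by force
      then show ?thesis by simp
    qed
    then show ?thesis
      using set_integral_diff(2)[OF int[OF loc(1)] int[OF loc(2)]] by (simp add: left_diff_distrib)
  qed
  ultimately have "AE x in lebesgue. x \<in> U \<longrightarrow> w x - w' x = 0"
    by (rule fundamental_lemma[OF U])
  then show ?thesis by simp
qed

text \<open>\<open>weak_deriv\<close> is a choice, known only by its defining property: the given
  \<open>W a\<close> shows that the choice succeeds, and uniqueness identifies the two almost
  everywhere. Continuity of \<open>W a\<close> supplies measurability of its square, which passes to
  the chosen representative because Lebesgue measure is complete.\<close>

lemma seminorm_eq:
  assumes U: "open U" and W: "\<And>a. a \<le> k \<Longrightarrow> is_weak_deriv U a (k - a) v (W a)"
    and meas: "\<And>a. a \<le> k \<Longrightarrow> continuous_on U (W a)"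
  shows "seminorm k U v = sqrt (\<Sum>a\<le>k. LINT x:U|lebesgue. (W a x)\<^sup>2)"
proof -
  have "(LINT x:U|lebesgue. (weak_deriv U a (k - a) v x)\<^sup>2) = (LINT x:U|lebesgue. (W a x)\<^sup>2)" if "a \<le> k" for a
  proof -
    have "is_weak_deriv U a (k - a) v (weak_deriv U a (k - a) v)"
      unfolding weak_deriv_def by (rule someI[of "is_weak_deriv U a (k - a) v" "W a"], rule W[OF that])
    then have ae: "AE x in lebesgue. x \<in> U \<longrightarrow> weak_deriv U a (k - a) v x = W a x"
      using is_weak_deriv_unique[OF U _ W[OF that]] by blast
    have m: "(\<lambda>x. indicator U x *\<^sub>R (W a x)\<^sup>2) \<in> borel_measurable lebesgue"
      using borel_measurable_continuous_on_indicator[OF _ continuous_on_power[OF meas[OF that], of 2]] U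
      by (intro measurable_completion) auto
    have ae': "AE x in lebesgue. indicator U x *\<^sub>R (W a x)\<^sup>2 = indicator U x *\<^sub>R (weak_deriv U a (k - a) v x)\<^sup>2"
      using ae by eventually_elim (auto simp: indicator_def)
    have "(\<lambda>x. indicator U x *\<^sub>R (weak_deriv U a (k - a) v x)\<^sup>2) \<in> borel_measurable lebesgue"
      using m ae' by (rule borel_measurable_AE)
    then show ?thesis unfolding set_lebesgue_integral_def
      using m ae' by (intro integral_cong_AE) auto
  qed
  then show ?thesis by (simp add: seminorm_def)
qed

section \<open>Polynomials in two variables\<close>

text \<open>Polynomials of degree at most \<open>m\<close> in each variable separately. The space
  contains \<open>poly2 m\<close> and is mapped into itself by partial derivatives, so one inverse
  estimate serves \<open>q\<close> and its derivatives; its product form lets one-dimensional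
  interpolation act on each variable.\<close>

definition tensor_poly :: "nat \<Rightarrow> (plane \<Rightarrow> real) set" where
  "tensor_poly m = {q. \<exists>(I :: (nat \<times> nat) set) A B. finite I \<and>
     (\<forall>i\<in>I. degree (A i) \<le> m \<and> degree (B i) \<le> m) \<and>
     (\<forall>p. q p = (\<Sum>i\<in>I. poly (A i) (p $ 1) * poly (B i) (p $ 2)))}"

lemma tensor_polyI:
  fixes I :: "(nat \<times> nat) set"
  assumes "finite I" "\<And>i. i \<in> I \<Longrightarrow> degree (A i) \<le> m" "\<And>i. i \<in> I \<Longrightarrow> degree (B i) \<le> m"
  shows "(\<lambda>p. \<Sum>i\<in>I. poly (A i) (p $ 1) * poly (B i) (p $ 2)) \<in> tensor_poly m"
  using assms unfolding tensor_poly_def by blast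

lemma poly2_subset_tensor_poly: "poly2 m \<subseteq> tensor_poly m"
proof
  fix q assume "q \<in> poly2 m"
  then obtain a where a: "\<And>p. q p = (\<Sum>i\<le>m. \<Sum>j\<le>m - i. a i j * (p $ 1) ^ i * (p $ 2) ^ j)"
    by (auto simp: poly2_def)
  let ?I = "SIGMA i:{..m}. {..m - i}"
  let ?A = "\<lambda>(i,j). monom (a i j) i" and ?B = "\<lambda>(i,j). monom (1::real) j"
  have "q p = (\<Sum>i\<in>?I. poly (?A i) (p $ 1) * poly (?B i) (p $ 2))" for p
    by (simp add: a sum.Sigma poly_monom split_beta)
  moreover have "\<forall>i\<in>?I. degree (?A i) \<le> m \<and> degree (?B i) \<le> m"
    by (auto intro!: order.trans[OF degree_monom_le])
  moreover have "finite ?I" by simp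
  ultimately show "q \<in> tensor_poly m" unfolding tensor_poly_def by blast
qed

lemma sum_plane_pd:
  assumes "(f has_derivative f') (at (x :: plane))"
  shows "f' = (\<lambda>h. \<Sum>k\<in>UNIV. h $ k * pd k f x)"
proof
  fix h :: plane
  interpret linear f' using assms by (rule has_derivative_linear)
  have "h = (\<Sum>k\<in>UNIV. h $ k *\<^sub>R axis k 1)"
    by (simp add: vec_eq_iff axis_def if_distrib cong: if_cong)
  then have "f' h = (\<Sum>k\<in>UNIV. f' (h $ k *\<^sub>R axis k 1))" using sum by metis
  then show "f' h = (\<Sum>k\<in>UNIV. h $ k * pd k f x)" by (simp add: scale pd_eq[OF assms])
qed

lemma tensor_poly_derivative:
  assumes "q \<in> tensor_poly m"
  shows "(q has_derivative (\<lambda>h. \<Sum>k\<in>UNIV. h $ k * pd k q x)) (at x)" and "pd k q \<in> tensor_poly m"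
proof -
  obtain I :: "(nat \<times> nat) set" and A B where I: "finite I" "\<forall>i\<in>I. degree (A i) \<le> m \<and> degree (B i) \<le> m"
    and q: "\<And>p. q p = (\<Sum>i\<in>I. poly (A i) (p $ 1) * poly (B i) (p $ 2))"
    using assms unfolding tensor_poly_def by blast
  have d: "(q has_derivative (\<lambda>h. \<Sum>i\<in>I. poly (A i) (x $ 1) * (poly (pderiv (B i)) (x $ 2) * h $ 2)
       + (poly (pderiv (A i)) (x $ 1) * h $ 1) * poly (B i) (x $ 2))) (at x)" for x
  proof -
    have p: "((\<lambda>x :: plane. poly P (x $ k)) has_derivative (\<lambda>h. poly (pderiv P) (x $ k) * h $ k)) (at x)" for P k
    proof -
      have "((\<lambda>x :: plane. poly P (x $ k)) has_derivative (\<lambda>h. (*) (poly (pderiv P) (x $ k)) (h $ k))) (at x)"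
        by (rule has_derivative_compose[where f = "\<lambda>x. x $ k" and g = "poly P"])
          (use poly_DERIV in \<open>auto simp: has_field_derivative_def intro!: bounded_linear.has_derivative[OF bounded_linear_vec_nth]\<close>)
      then show ?thesis by simp
    qed
    show ?thesis unfolding q
      by (intro has_derivative_sum has_derivative_mult p)
  qed
  show "(q has_derivative (\<lambda>h. \<Sum>k\<in>UNIV. h $ k * pd k q x)) (at x)"
    using d[of x] sum_plane_pd[OF d] by simp
  have ax: "axis i (1::real) $ j = (if i = j then 1 else 0)" for i j :: 2 by (simp add: axis_def)
  have "pd 1 q = (\<lambda>p. \<Sum>i\<in>I. poly (pderiv (A i)) (p $ 1) * poly (B i) (p $ 2))"
    and "pd 2 q = (\<lambda>p. \<Sum>i\<in>I. poly (A i) (p $ 1) * poly (pderiv (B i)) (p $ 2))"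
    by (auto simp: fun_eq_iff pd_eq[OF d] ax)
  then have "pd 1 q \<in> tensor_poly m" "pd 2 q \<in> tensor_poly m"
    using I by (auto intro!: tensor_polyI simp: degree_pderiv)
  then show "pd k q \<in> tensor_poly m" using exhaust_2[of k] by auto
qed

text \<open>Both sides have degree at most \<open>m\<close> and agree at the \<open>m + 1\<close>
  nodes \<open>0, ..., m\<close>. The basis \<open>L\<close> is fixed before \<open>P\<close>, so
  bounds for it are uniform in the polynomial.\<close>

lemma lagrange_interpolation:
  obtains L :: "nat \<Rightarrow> real poly" where
    "\<And>P t. degree P \<le> m \<Longrightarrow> poly P t = (\<Sum>k\<le>m. poly P (real k) * poly (L k) t)"
proof
  define N where "N = (\<lambda>k. \<Prod>j\<in>{..m} - {k}. [:- real j, 1:])"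
  define L where "L = (\<lambda>k. smult (1 / poly (N k) (real k)) (N k))"
  have N: "poly (N k) t = (\<Prod>j\<in>{..m} - {k}. t - real j)" for k t
    by (simp add: N_def poly_prod)
  have L: "poly (L k) (real j) = (if j = k then 1 else 0)" if "j \<le> m" for j k
  proof -
    have "poly (N k) (real k) \<noteq> 0" by (simp add: N)
    moreover have "poly (N k) (real j) = 0" if "j \<noteq> k" using \<open>j \<le> m\<close> that by (auto simp: N)
    ultimately show ?thesis by (auto simp: L_def)
  qed
  have dL: "degree (L k) \<le> m" if "k \<le> m" for k
  proof -
    have "degree (N k) \<le> (\<Sum>j\<in>{..m} - {k}. degree [:- real j, 1:])"
      unfolding N_def using degree_prod_sum_le[of "{..m} - {k}" "\<lambda>j. [:- real j, 1:]"] by (simp add: o_def)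
    then show ?thesis using that degree_smult_le[of _ "N k"] unfolding L_def by (force intro: order.trans)
  qed
  fix P :: "real poly" and t assume P: "degree P \<le> m"
  have "P = (\<Sum>k\<le>m. smult (poly P (real k)) (L k))"
  proof (rule poly_eqI_degree[where A = "real ` {..m}"])
    fix x assume "x \<in> real ` {..m}"
    then obtain j where j: "x = real j" "j \<le> m" by auto
    then show "poly P x = poly (\<Sum>k\<le>m. smult (poly P (real k)) (L k)) x"
      by (simp add: poly_sum L if_distrib cong: if_cong)
  next
    have "degree (\<Sum>k\<le>m. smult (poly P (real k)) (L k)) \<le> m"
      by (rule degree_sum_le) (use dL degree_smult_le order.trans in blast)+
    then show "degree (\<Sum>k\<le>m. smult (poly P (real k)) (L k)) < card (real ` {..m})"
      by (simp add: card_image inj_on_def)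
    show "degree P < card (real ` {..m})" using P by (simp add: card_image inj_on_def)
  qed
  then show "poly P t = (\<Sum>k\<le>m. poly P (real k) * poly (L k) t)"
    by (metis (no_types, lifting) poly_sum poly_smult sum.cong)
qed

lemma norm_vec2_le: "norm (x :: real^2) \<le> \<bar>x $ 1\<bar> + \<bar>x $ 2\<bar>"
  using norm_le_l1_cart[of x] by (simp add: sum_2)

text \<open>After scaling by \<open>\<rho>\<close> the interpolation nodes lie in the small ball,
  the point \<open>z\<close> has coordinates in the fixed interval \<open>{-T..T}\<close>, and
  \<open>q z\<close> is a combination of nodal values with bounded coefficients. Differentiation
  brings out one factor \<open>1 / \<rho> = D / r\<close>, so the constant depends on
  \<open>m\<close> and \<open>N\<close> only.\<close>

lemma tensor_poly_markov:
  assumes N: "N > 0"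
  obtains C where "C > 0" "\<And>q y r S z k. q \<in> tensor_poly m \<Longrightarrow> r > 0 \<Longrightarrow>
      (\<And>w. w \<in> cball y (r / N) \<Longrightarrow> \<bar>q w\<bar> \<le> S) \<Longrightarrow> z \<in> cball y (N * r) \<Longrightarrow>
      \<bar>q z\<bar> \<le> C * S \<and> \<bar>pd k q z\<bar> \<le> C * S / r"
proof -
  obtain L :: "nat \<Rightarrow> real poly" where
    L: "\<And>P t. degree P \<le> m \<Longrightarrow> poly P t = (\<Sum>k\<le>m. poly P (real k) * poly (L k) t)"
    using lagrange_interpolation by blast
  \<comment> \<open>The nodes are at distance at most \<open>2 * m * \<rho>\<close> from
    \<open>y\<close>, which must not exceed \<open>r / N\<close>; the extra \<open>1\<close> keeps
    \<open>D\<close> positive when \<open>m = 0\<close>. Then \<open>T = N * D\<close> is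
    \<open>N * r / \<rho>\<close>, the scaled radius of the large ball.\<close>
  define D where "D = N * (2 * real m + 1)"
  define T where "T = N * D"
  have D: "D > 0" using N by (simp add: D_def)
  have "bounded (\<Union>k\<le>m. poly (L k) ` {-T..T} \<union> poly (pderiv (L k)) ` {-T..T})"
    by (intro bounded_UN bounded_Un[THEN iffD2] conjI ballI compact_imp_bounded compact_continuous_image)
      (auto intro!: continuous_intros)
  then obtain B where B: "B > 0" "\<And>k t. k \<le> m \<Longrightarrow> \<bar>t\<bar> \<le> T \<Longrightarrow> \<bar>poly (L k) t\<bar> \<le> B"
    "\<And>k t. k \<le> m \<Longrightarrow> \<bar>t\<bar> \<le> T \<Longrightarrow> \<bar>poly (pderiv (L k)) t\<bar> \<le> B"
    unfolding bounded_pos by (auto simp: abs_le_iff)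
  define C0 where "C0 = (real m + 1)\<^sup>2 * B\<^sup>2"
  have C0: "C0 > 0" using B by (simp add: C0_def zero_less_mult_iff)
  show ?thesis
  proof (rule that[of "C0 * (1 + D)"])
    show "C0 * (1 + D) > 0" using C0 D by simp
    fix q y r S z k
    assume q: "q \<in> tensor_poly m" and r: "r > 0"
      and S: "\<And>w. w \<in> cball y (r / N) \<Longrightarrow> \<bar>q w\<bar> \<le> S" and z: "z \<in> cball y (N * r)"
    define \<rho> where "\<rho> = r / D"
    have \<rho>: "\<rho> > 0" using r D by (simp add: \<rho>_def)
    define node where "node = (\<lambda>i j. y + vector [\<rho> * real i, \<rho> * real j] :: plane)"
    have node: "\<bar>q (node i j)\<bar> \<le> S" if "i \<le> m" "j \<le> m" for i j
    proof (rule S)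
      have "norm (vector [\<rho> * real i, \<rho> * real j] :: plane) \<le> \<rho> * (real i + real j)"
        using norm_vec2_le[of "vector [\<rho> * real i, \<rho> * real j]"] \<rho> by (simp add: abs_mult algebra_simps)
      also have "\<dots> \<le> \<rho> * (2 * real m + 1)" using that \<rho> by (intro mult_left_mono) auto
      also have "\<dots> = r / N" using N by (simp add: \<rho>_def D_def)
      finally show "node i j \<in> cball y (r / N)" by (simp add: node_def dist_norm)
    qed
    have S0: "S \<ge> 0" using node[of 0 0] by simp
    obtain I :: "(nat \<times> nat) set" and A E where I: "finite I" "\<forall>i\<in>I. degree (A i) \<le> m \<and> degree (E i) \<le> m"
      and qe: "\<And>p. q p = (\<Sum>i\<in>I. poly (A i) (p $ 1) * poly (E i) (p $ 2))"
      using q unfolding tensor_poly_def by blast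
    have sc: "poly P x = (\<Sum>k\<le>m. poly P (c + \<rho> * real k) * poly (L k) ((x - c) / \<rho>))" if "degree P \<le> m" for P x c
    proof -
      have "degree (P \<circ>\<^sub>p [:c, \<rho>:]) \<le> m" using that by (simp add: degree_pcompose)
      from L[OF this, of "(x - c) / \<rho>"] show ?thesis using \<rho> by (simp add: poly_pcompose mult.commute)
    qed
    \<comment> \<open>Interpolating both factors of each product and exchanging the sums recombines
      the factors into nodal values of \<open>q\<close> itself, so the number and size of the
      summands of the representation drop out.\<close>
    have rep: "q p = (\<Sum>i\<le>m. \<Sum>j\<le>m. q (node i j) * (poly (L i) ((p $ 1 - y $ 1) / \<rho>) * poly (L j) ((p $ 2 - y $ 2) / \<rho>)))" for p
    proof -
      have "q p = (\<Sum>n\<in>I. (\<Sum>i\<le>m. poly (A n) (y $ 1 + \<rho> * real i) * poly (L i) ((p $ 1 - y $ 1) / \<rho>))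
         * (\<Sum>j\<le>m. poly (E n) (y $ 2 + \<rho> * real j) * poly (L j) ((p $ 2 - y $ 2) / \<rho>)))"
        unfolding qe using I by (intro sum.cong refl arg_cong2[where f = "(*)"] sc) auto
      also have "\<dots> = (\<Sum>n\<in>I. \<Sum>i\<le>m. \<Sum>j\<le>m. (poly (A n) (node i j $ 1) * poly (E n) (node i j $ 2))
         * (poly (L i) ((p $ 1 - y $ 1) / \<rho>) * poly (L j) ((p $ 2 - y $ 2) / \<rho>)))"
        by (simp add: sum_product node_def algebra_simps)
      also have "\<dots> = (\<Sum>i\<le>m. \<Sum>j\<le>m. \<Sum>n\<in>I. (poly (A n) (node i j $ 1) * poly (E n) (node i j $ 2))
         * (poly (L i) ((p $ 1 - y $ 1) / \<rho>) * poly (L j) ((p $ 2 - y $ 2) / \<rho>)))"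
        by (subst sum.swap, intro sum.cong refl, rule sum.swap)
      finally show ?thesis by (simp add: qe sum_distrib_right)
    qed
    have bnd: "\<bar>\<Sum>i\<le>m. \<Sum>j\<le>m. q (node i j) * (f i * g j)\<bar> \<le> C0 * S"
      if "\<And>i. i \<le> m \<Longrightarrow> \<bar>f i\<bar> \<le> B" "\<And>i. i \<le> m \<Longrightarrow> \<bar>g i\<bar> \<le> B" for f g :: "nat \<Rightarrow> real"
    proof -
      have "\<bar>\<Sum>i\<le>m. \<Sum>j\<le>m. q (node i j) * (f i * g j)\<bar> \<le> (\<Sum>i\<le>m. \<Sum>j\<le>m. S * (B * B))"
        using node that B(1) S0 
        by (intro order.trans[OF sum_abs] sum_mono order.trans[OF sum_abs])
          (auto simp: abs_mult intro!: mult_mono)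
      then show ?thesis by (simp add: C0_def power2_eq_square algebra_simps)
    qed
    have zi: "\<bar>(z $ i - y $ i) / \<rho>\<bar> \<le> T" for i
    proof -
      have "\<bar>z $ i - y $ i\<bar> \<le> N * r"
        using z component_le_norm_cart[of "z - y" i] by (simp add: dist_norm norm_minus_commute)
      then have "\<bar>z $ i - y $ i\<bar> / \<rho> \<le> N * r / \<rho>" using \<rho> by (intro divide_right_mono) auto
      then show ?thesis using \<rho> r D by (simp add: T_def \<rho>_def abs_divide abs_mult)
    qed
    have "\<bar>q z\<bar> \<le> C0 * S" by (subst rep, rule bnd) (rule B(2)[OF _ zi], assumption)+
    then have one: "\<bar>q z\<bar> \<le> C0 * (1 + D) * S" using C0 D S0 by (simp add: algebra_simps add_increasing2)
    let ?l = "\<lambda>i k. poly (L i) ((z $ k - y $ k) / \<rho>)" and ?l' = "\<lambda>i k. poly (pderiv (L i)) ((z $ k - y $ k) / \<rho>)"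
    have dl: "((\<lambda>p :: plane. poly (L i) ((p $ k - y $ k) / \<rho>)) has_derivative (\<lambda>h. ?l' i k * (h $ k / \<rho>))) (at z)" for i k
    proof -
      have "((\<lambda>p :: plane. poly (L i) ((p $ k - y $ k) / \<rho>)) has_derivative (\<lambda>h. (*) (?l' i k) (h $ k / \<rho>))) (at z)"
        by (rule has_derivative_compose[where f = "\<lambda>p. (p $ k - y $ k) / \<rho>" and g = "poly (L i)"])
          (use poly_DERIV \<rho> in \<open>auto simp: has_field_derivative_def intro!: derivative_eq_intros bounded_linear.has_derivative[OF bounded_linear_vec_nth]\<close>)
      then show ?thesis by simp
    qed
    have "((\<lambda>p. \<Sum>i\<le>m. \<Sum>j\<le>m. q (node i j) * (poly (L i) ((p $ 1 - y $ 1) / \<rho>) * poly (L j) ((p $ 2 - y $ 2) / \<rho>)))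
      has_derivative (\<lambda>h. \<Sum>i\<le>m. \<Sum>j\<le>m. q (node i j) * (?l i 1 * (?l' j 2 * (h $ 2 / \<rho>)) + (?l' i 1 * (h $ 1 / \<rho>)) * ?l j 2))) (at z)"
      by (intro has_derivative_sum has_derivative_mult_right has_derivative_mult dl)
    then have dq: "(q has_derivative (\<lambda>h. \<Sum>i\<le>m. \<Sum>j\<le>m. q (node i j) * (?l i 1 * (?l' j 2 * (h $ 2 / \<rho>)) + (?l' i 1 * (h $ 1 / \<rho>)) * ?l j 2))) (at z)"
      by (simp only: rep[symmetric])
    have "\<bar>pd k q z\<bar> \<le> C0 * S / \<rho>"
    proof (cases "k = 1")
      case True
      then have "pd k q z = (\<Sum>i\<le>m. \<Sum>j\<le>m. q (node i j) * (?l' i 1 * ?l j 2)) / \<rho>"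
        unfolding pd_eq[OF dq] by (simp add: axis_def sum_divide_distrib)
      then show ?thesis using \<rho> bnd[of "\<lambda>i. ?l' i 1" "\<lambda>j. ?l j 2"] B zi by (simp add: abs_divide divide_right_mono)
    next
      case False
      then have "k = 2" using exhaust_2 by blast
      then have "pd k q z = (\<Sum>i\<le>m. \<Sum>j\<le>m. q (node i j) * (?l i 1 * ?l' j 2)) / \<rho>"
        unfolding pd_eq[OF dq] by (simp add: axis_def sum_divide_distrib)
      then show ?thesis using \<rho> bnd[of "\<lambda>i. ?l i 1" "\<lambda>j. ?l' j 2"] B zi by (simp add: abs_divide divide_right_mono)
    qed
    also have "C0 * S / \<rho> \<le> C0 * (1 + D) * S / r"
      using C0 D S0 r by (simp add: \<rho>_def field_simps)
    finally show "\<bar>q z\<bar> \<le> C0 * (1 + D) * S \<and> \<bar>pd k q z\<bar> \<le> C0 * (1 + D) * S / r" using one by simp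
  qed
qed

section \<open>Inverse estimates in straightening coordinates\<close>

lemma set_integrable_bounded_continuous:
  fixes f :: "'a::euclidean_space \<Rightarrow> real"
  assumes "open U" "bounded U" "continuous_on U f" "\<And>x. x \<in> U \<Longrightarrow> \<bar>f x\<bar> \<le> B"
  shows "set_integrable lebesgue U f"
  unfolding set_integrable_def
proof (rule Bochner_Integration.integrable_bound[where f = "\<lambda>x. indicator U x * B"])
  have "U \<in> lmeasurable" using assms by (simp add: lmeasurable_open)
  then have "integrable lebesgue (indicator U :: 'a \<Rightarrow> real)"
    by (intro integrable_real_indicator) (auto simp: fmeasurable_def)
  then show "integrable lebesgue (\<lambda>x. indicator U x * B)" by simp
  show "(\<lambda>x. indicator U x *\<^sub>R f x) \<in> borel_measurable lebesgue"
    using borel_measurable_continuous_on_indicator[OF _ assms(3)] assms(1)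
    by (intro measurable_completion) auto
  show "AE x in lebesgue. norm (indicator U x *\<^sub>R f x) \<le> norm (indicator U x * B)"
    using assms(4) by (intro AE_I2) (auto simp: indicator_def intro: order.trans[OF _ abs_ge_self])
qed

lemma measure_ball_plane:
  assumes "0 \<le> r"
  shows "measure lebesgue (ball (x :: plane) r) = pi * r\<^sup>2" "measure lebesgue (cball (x :: plane) r) = pi * r\<^sup>2"
  using content_ball[OF assms, of x] content_cball[OF assms, of x] by (simp_all add: unit_ball_vol_2)

lemma norm_sum_components_le:
  fixes h :: plane
  assumes "\<And>i. \<bar>c i\<bar> \<le> B"
  shows "\<bar>\<Sum>i\<in>UNIV. h $ i * c i\<bar> \<le> 2 * B * norm h"
proof -
  have "\<bar>h $ i * c i\<bar> \<le> norm h * B" for i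
    unfolding abs_mult using assms component_le_norm_cart by (intro mult_mono) auto
  from this[of 1] this[of 2] show ?thesis unfolding sum_2 by (simp add: algebra_simps)
qed

lemma sum_squares_bound_2: "((a::real) + b)\<^sup>2 \<le> 2 * (a\<^sup>2 + b\<^sup>2)"
  using zero_le_power2[of "a - b"] by (simp add: power2_eq_square algebra_simps)

text \<open>
  \<open>R\<close> straightens the element \<open>U\<close> of size \<open>r\<close>; its Jacobian is expressed through the functions
  \<open>A i k\<close> of the new coordinates, with partial derivatives \<open>DA i k l\<close>.
\<close>

locale chart =
  fixes N r :: real and U :: "plane set" and R :: "plane \<Rightarrow> plane" and x0 :: plane
    and A :: "2 \<Rightarrow> 2 \<Rightarrow> plane \<Rightarrow> real" and DA :: "2 \<Rightarrow> 2 \<Rightarrow> 2 \<Rightarrow> plane \<Rightarrow> real"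
  assumes N: "1 \<le> N" and r: "0 < r" "r \<le> 1" and U: "open U"
    and ball_sub: "ball x0 r \<subseteq> U" and U_sub: "U \<subseteq> cball x0 (N * r)"
    and RU_sub: "R ` U \<subseteq> cball (R x0) (N * r)"
    and covers: "cball (R x0) (r / N) \<subseteq> R ` cball x0 (r / 2)"
    and R_deriv: "\<And>x. x \<in> U \<Longrightarrow> (R has_derivative (\<lambda>h. \<chi> k. \<Sum>i\<in>UNIV. h $ i * A i k (R x))) (at x)"
    and A_deriv: "\<And>y i k. y \<in> R ` U \<Longrightarrow> (A i k has_derivative (\<lambda>h. \<Sum>l\<in>UNIV. h $ l * DA i k l y)) (at y)"
    and DA_cont: "\<And>i k l. continuous_on (R ` U) (DA i k l)"
    and A_le: "\<And>y i k. y \<in> R ` U \<Longrightarrow> \<bar>A i k y\<bar> \<le> N"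
    and DA_le: "\<And>y i k l. y \<in> R ` U \<Longrightarrow> \<bar>DA i k l y\<bar> \<le> N"
    and elliptic: "\<And>y z. y \<in> R ` U \<Longrightarrow> (\<Sum>k\<in>UNIV. (z k)\<^sup>2) \<le> N * (\<Sum>i\<in>UNIV. (\<Sum>k\<in>UNIV. A i k y * z k)\<^sup>2)"
begin

section \<open>Bounded continuous functions of the chart coordinates\<close>

lemma bounded_U: "bounded U"
  using U_sub bounded_cball bounded_subset by blast

lemma A_cont: "continuous_on (R ` U) (A i k)"
  using A_deriv by (meson continuous_at_imp_continuous_on has_derivative_continuous)

lemma R_cont: "continuous_on U R"
  using R_deriv by (meson continuous_at_imp_continuous_on has_derivative_continuous)

definition J :: "(plane \<Rightarrow> real) \<Rightarrow> real" where
  "J f = (LINT x:U|lebesgue. (f (R x))\<^sup>2)"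

text \<open>A class that settles all integrability questions: it contains the polynomials and the
  coefficients, is closed under sums and products, and the square of a member composed with
  \<open>R\<close> is integrable over the bounded open set \<open>U\<close>.\<close>

definition bdd_cont :: "(plane \<Rightarrow> real) \<Rightarrow> bool" where
  "bdd_cont f \<longleftrightarrow> continuous_on (R ` U) f \<and> (\<exists>B. \<forall>y\<in>R ` U. \<bar>f y\<bar> \<le> B)"

lemma bdd_cont_add: "bdd_cont f \<Longrightarrow> bdd_cont g \<Longrightarrow> bdd_cont (\<lambda>y. f y + g y)"
  unfolding bdd_cont_def
proof (elim conjE exE, intro conjI)
  fix B B' assume "\<forall>y\<in>R ` U. \<bar>f y\<bar> \<le> B" "\<forall>y\<in>R ` U. \<bar>g y\<bar> \<le> B'"
  then have "\<forall>y\<in>R ` U. \<bar>f y + g y\<bar> \<le> B + B'"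
    by (intro ballI order.trans[OF abs_triangle_ineq] add_mono) auto
  then show "\<exists>B. \<forall>y\<in>R ` U. \<bar>f y + g y\<bar> \<le> B" by blast
qed (rule continuous_on_add)

lemma bdd_cont_mult: "bdd_cont f \<Longrightarrow> bdd_cont g \<Longrightarrow> bdd_cont (\<lambda>y. f y * g y)"
  unfolding bdd_cont_def
proof (elim conjE exE, intro conjI)
  fix B B' assume *: "\<forall>y\<in>R ` U. \<bar>f y\<bar> \<le> B" "\<forall>y\<in>R ` U. \<bar>g y\<bar> \<le> B'"
  have "\<bar>f y * g y\<bar> \<le> B * B'" if "y \<in> R ` U" for y
    unfolding abs_mult using * that by (intro mult_mono) (auto intro: order.trans[OF abs_ge_zero])
  then show "\<exists>B. \<forall>y\<in>R ` U. \<bar>f y * g y\<bar> \<le> B" by blast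
qed (rule continuous_on_mult)

lemma bdd_cont_A: "bdd_cont (A i k)" and bdd_cont_DA: "bdd_cont (DA i k l)"
  unfolding bdd_cont_def using A_cont DA_cont A_le DA_le by blast+

lemma tensor_poly_continuous: "p \<in> tensor_poly m \<Longrightarrow> continuous_on S p"
  using tensor_poly_derivative(1) by (meson continuous_at_imp_continuous_on has_derivative_continuous)

lemma bdd_cont_poly:
  assumes "p \<in> tensor_poly m"
  shows "bdd_cont p"
proof -
  have "compact (p ` cball (R x0) (N * r))"
    using assms by (intro compact_continuous_image tensor_poly_continuous) auto
  then obtain B where "\<forall>y\<in>cball (R x0) (N * r). \<bar>p y\<bar> \<le> B"
    by (auto dest!: compact_imp_bounded simp: bounded_pos)
  then show ?thesis unfolding bdd_cont_def using RU_sub tensor_poly_continuous[OF assms] by blast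
qed

lemma bdd_cont_integrable:
  assumes "bdd_cont f"
  shows "set_integrable lebesgue U (\<lambda>x. (f (R x))\<^sup>2)"
proof -
  obtain B where B: "\<forall>y\<in>R ` U. \<bar>f y\<bar> \<le> B" and c: "continuous_on (R ` U) f"
    using assms by (auto simp: bdd_cont_def)
  show ?thesis
  proof (rule set_integrable_bounded_continuous[OF U bounded_U])
    show "continuous_on U (\<lambda>x. (f (R x))\<^sup>2)"
      by (intro continuous_intros continuous_on_compose2[OF c R_cont]) auto
    show "\<bar>(f (R x))\<^sup>2\<bar> \<le> B\<^sup>2" if "x \<in> U" for x
      using B that by (simp add: abs_le_square_iff[symmetric] order.trans[OF _ abs_ge_self])
  qed
qed

lemma J_nonneg: "0 \<le> J f"
  unfolding J_def set_lebesgue_integral_def by (intro Bochner_Integration.integral_nonneg) auto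

lemma J_mono:
  assumes "bdd_cont f" "finite F" "\<And>i. i \<in> F \<Longrightarrow> bdd_cont (g i)"
    and le: "\<And>y. y \<in> R ` U \<Longrightarrow> (f y)\<^sup>2 \<le> c * (\<Sum>i\<in>F. (g i y)\<^sup>2)"
  shows "J f \<le> c * (\<Sum>i\<in>F. J (g i))"
proof -
  have gi: "integrable lebesgue (\<lambda>x. indicator U x *\<^sub>R (g i (R x))\<^sup>2)" if "i \<in> F" for i
    using bdd_cont_integrable[OF assms(3)[OF that]] unfolding set_integrable_def .
  have "J f \<le> (LINT x|lebesgue. c * (\<Sum>i\<in>F. indicator U x *\<^sub>R (g i (R x))\<^sup>2))"
    unfolding J_def set_lebesgue_integral_def
  proof (rule integral_mono)
    show "integrable lebesgue (\<lambda>x. indicator U x *\<^sub>R (f (R x))\<^sup>2)"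
      using bdd_cont_integrable[OF assms(1)] unfolding set_integrable_def .
    show "integrable lebesgue (\<lambda>x. c * (\<Sum>i\<in>F. indicator U x *\<^sub>R (g i (R x))\<^sup>2))"
      using gi by (intro Bochner_Integration.integrable_mult_right Bochner_Integration.integrable_sum)
    show "indicator U x *\<^sub>R (f (R x))\<^sup>2 \<le> c * (\<Sum>i\<in>F. indicator U x *\<^sub>R (g i (R x))\<^sup>2)" for x
      using le[of "R x"] by (cases "x \<in> U") auto
  qed
  also have "\<dots> = c * (\<Sum>i\<in>F. LINT x|lebesgue. indicator U x *\<^sub>R (g i (R x))\<^sup>2)"
    using gi by (subst integral_mult_right_zero, subst Bochner_Integration.integral_sum) auto
  finally show ?thesis by (simp only: J_def set_lebesgue_integral_def)
qed

section \<open>Derivatives of a polynomial composed with the chart\<close>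

lemma compose_deriv:
  assumes x: "x \<in> U" and f: "(f has_derivative (\<lambda>h. \<Sum>l\<in>UNIV. h $ l * f' l)) (at (R x))"
  shows "((\<lambda>x. f (R x)) has_derivative (\<lambda>h. \<Sum>i\<in>UNIV. h $ i * (\<Sum>l\<in>UNIV. A i l (R x) * f' l))) (at x)"
proof -
  have "((\<lambda>x. f (R x)) has_derivative (\<lambda>h. \<Sum>l\<in>UNIV. (\<chi> k. \<Sum>i\<in>UNIV. h $ i * A i k (R x)) $ l * f' l)) (at x)"
    by (rule has_derivative_compose[OF R_deriv[OF x] f])
  then show ?thesis by (rule has_derivative_eq_rhs) (auto simp: sum_2 algebra_simps)
qed

text \<open>\<open>L1 q i (R x)\<close> is the partial derivative of \<open>q \<circ> R\<close> at
  \<open>x\<close> in direction \<open>i\<close>, and \<open>L2 q i j (R x)\<close> the derivative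
  of that in direction \<open>j\<close>. Both are kept as functions of \<open>y = R x\<close>, so
  that \<open>compose_deriv\<close> applies to \<open>L1 q i\<close> in the same way as to
  \<open>q\<close>.\<close>

definition L1 :: "(plane \<Rightarrow> real) \<Rightarrow> 2 \<Rightarrow> plane \<Rightarrow> real" where
  "L1 q i y = (\<Sum>k\<in>UNIV. A i k y * pd k q y)"

definition L2 :: "(plane \<Rightarrow> real) \<Rightarrow> 2 \<Rightarrow> 2 \<Rightarrow> plane \<Rightarrow> real" where
  "L2 q i j y = (\<Sum>l\<in>UNIV. A j l y * (\<Sum>k\<in>UNIV. A i k y * pd l (pd k q) y + DA i k l y * pd k q y))"

lemma deriv1:
  assumes "q \<in> tensor_poly m" "x \<in> U"
  shows "((\<lambda>x. q (R x)) has_derivative (\<lambda>h. \<Sum>i\<in>UNIV. h $ i * L1 q i (R x))) (at x)"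
  unfolding L1_def by (rule compose_deriv[OF assms(2) tensor_poly_derivative(1)[OF assms(1)]])

lemma deriv2:
  assumes q: "q \<in> tensor_poly m" and x: "x \<in> U"
  shows "((\<lambda>x. L1 q i (R x)) has_derivative (\<lambda>h. \<Sum>j\<in>UNIV. h $ j * L2 q i j (R x))) (at x)"
  unfolding L2_def
proof (rule compose_deriv[OF x])
  have y: "R x \<in> R ` U" using x by simp
  have "(L1 q i has_derivative (\<lambda>h. \<Sum>k\<in>UNIV. A i k (R x) * (\<Sum>l\<in>UNIV. h $ l * pd l (pd k q) (R x))
      + (\<Sum>l\<in>UNIV. h $ l * DA i k l (R x)) * pd k q (R x))) (at (R x))"
    unfolding L1_def[abs_def]
    by (intro has_derivative_sum has_derivative_mult A_deriv[OF y] tensor_poly_derivative(1)[OF tensor_poly_derivative(2)[OF q]])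
  then show "(L1 q i has_derivative (\<lambda>h. \<Sum>l\<in>UNIV. h $ l * (\<Sum>k\<in>UNIV. A i k (R x) * pd l (pd k q) (R x) + DA i k l (R x) * pd k q (R x)))) (at (R x))"
    by (rule has_derivative_eq_rhs) (auto simp: sum_2 algebra_simps)
qed

lemma bdd_cont_L1: "q \<in> tensor_poly m \<Longrightarrow> bdd_cont (L1 q i)"
  unfolding L1_def[abs_def] sum_2
  by (intro bdd_cont_add bdd_cont_mult bdd_cont_A bdd_cont_poly[OF tensor_poly_derivative(2)])

lemma bdd_cont_L2: "q \<in> tensor_poly m \<Longrightarrow> bdd_cont (L2 q i j)"
  unfolding L2_def[abs_def] sum_2
  by (intro bdd_cont_add bdd_cont_mult bdd_cont_A bdd_cont_DA bdd_cont_poly[OF tensor_poly_derivative(2)]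
     bdd_cont_poly[OF tensor_poly_derivative(2)[OF tensor_poly_derivative(2)]])

lemma bdd_cont_compose: "bdd_cont f \<Longrightarrow> continuous_on U (\<lambda>x. f (R x))"
  unfolding bdd_cont_def by (auto intro: continuous_on_compose2[OF _ R_cont])

lemma by_parts:
  assumes "\<phi> \<in> test_functions U" "bdd_cont (g i)"
    and "\<And>x. x \<in> U \<Longrightarrow> ((\<lambda>x. f (R x)) has_derivative (\<lambda>h. \<Sum>i\<in>UNIV. h $ i * g i (R x))) (at x)"
  shows "(LINT x:U|lebesgue. f (R x) * pd i \<phi> x) = - (LINT x:U|lebesgue. g i (R x) * \<phi> x)"
proof -
  have ax: "(\<Sum>j\<in>UNIV. axis i 1 $ j * g j (R x)) = g i (R x)" for x
    by (simp add: axis_def if_distrib[of "\<lambda>c. c * _"] cong: if_cong)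
  show ?thesis
    using integral_by_parts[OF U assms(1,3), where i = i] bdd_cont_compose[OF assms(2)] unfolding ax by simp
qed

lemma weak_derivs:
  assumes q: "q \<in> tensor_poly m" and v: "\<And>x. x \<in> U \<Longrightarrow> v x = q (R x)"
  shows "is_weak_deriv U 0 0 v (\<lambda>x. q (R x))"
    and "is_weak_deriv U 1 0 v (\<lambda>x. L1 q 1 (R x))"
    and "is_weak_deriv U 0 1 v (\<lambda>x. L1 q 2 (R x))"
    and "is_weak_deriv U 2 0 v (\<lambda>x. L2 q 1 1 (R x))"
    and "is_weak_deriv U 1 1 v (\<lambda>x. L2 q 1 2 (R x))"
    and "is_weak_deriv U 0 2 v (\<lambda>x. L2 q 2 2 (R x))"
proof -
  have cv: "continuous_on U v"
    using bdd_cont_compose[OF bdd_cont_poly[OF q]] v by (simp cong: continuous_on_cong)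
  have loc: "loc_integrable U v" "loc_integrable U (\<lambda>x. q (R x))" "loc_integrable U (\<lambda>x. L1 q i (R x))"
    "loc_integrable U (\<lambda>x. L2 q i j (R x))" for i j
    by (intro loc_integrable_continuous cv bdd_cont_compose bdd_cont_L1[OF q] bdd_cont_L2[OF q] bdd_cont_poly[OF q])+
  have vq: "(LINT x:U|lebesgue. v x * f x) = (LINT x:U|lebesgue. q (R x) * f x)" for f
    using v U by (intro set_lebesgue_integral_cong) auto
  have one: "(LINT x:U|lebesgue. q (R x) * pd i \<phi> x) = - (LINT x:U|lebesgue. L1 q i (R x) * \<phi> x)"
    if "\<phi> \<in> test_functions U" for i \<phi>
    by (rule by_parts[OF that bdd_cont_L1[OF q] deriv1[OF q]])
  \<comment> \<open>The signs of the two integrations by parts cancel. The outer derivative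
    \<open>pd i\<close> is moved first and the inner \<open>pd j\<close> second, which fixes the
    order of the indices of \<open>L2\<close>.\<close>
  have two: "(LINT x:U|lebesgue. q (R x) * pd i (pd j \<phi>) x) = (LINT x:U|lebesgue. L2 q i j (R x) * \<phi> x)"
    if "\<phi> \<in> test_functions U" for i j \<phi>
    using one[OF test_functions_pd[OF that]] by_parts[OF that bdd_cont_L2[OF q] deriv2[OF q]] by simp
  show "is_weak_deriv U 0 0 v (\<lambda>x. q (R x))" "is_weak_deriv U 1 0 v (\<lambda>x. L1 q 1 (R x))"
    "is_weak_deriv U 0 1 v (\<lambda>x. L1 q 2 (R x))" "is_weak_deriv U 2 0 v (\<lambda>x. L2 q 1 1 (R x))"
    "is_weak_deriv U 1 1 v (\<lambda>x. L2 q 1 2 (R x))" "is_weak_deriv U 0 2 v (\<lambda>x. L2 q 2 2 (R x))"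
    unfolding is_weak_deriv_def using loc by (auto simp: vq one two numeral_2_eq_2)
qed

lemma sobolev:
  assumes q: "q \<in> tensor_poly m" and v: "\<And>x. x \<in> U \<Longrightarrow> v x = q (R x)"
  shows "v \<in> sobolev 2 U"
proof -
  note w = weak_derivs[OF q v]
  note i = bdd_cont_integrable[OF bdd_cont_poly[OF q]] bdd_cont_integrable[OF bdd_cont_L1[OF q]]
    bdd_cont_integrable[OF bdd_cont_L2[OF q]]
  have "\<exists>w. is_weak_deriv U a b v w \<and> (\<lambda>x. (w x)\<^sup>2) absolutely_integrable_on U" if "a + b \<le> 2" for a b
  proof -
    have "(a, b) \<in> {(0,0), (1,0), (0,1), (2,0), (1,1), (0,2)}" using that by auto
    then show ?thesis using w i by auto
  qed
  then show ?thesis unfolding sobolev_def by blast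
qed

lemma seminorms:
  assumes q: "q \<in> tensor_poly m" and v: "\<And>x. x \<in> U \<Longrightarrow> v x = q (R x)"
  shows "seminorm 0 U v = sqrt (J q)" and "seminorm 1 U v = sqrt (J (L1 q 2) + J (L1 q 1))"
    and "seminorm 2 U v = sqrt (J (L2 q 2 2) + J (L2 q 1 2) + J (L2 q 1 1))"
proof -
  note w = weak_derivs[OF q v]
  note c = bdd_cont_compose[OF bdd_cont_poly[OF q]] bdd_cont_compose[OF bdd_cont_L1[OF q]]
    bdd_cont_compose[OF bdd_cont_L2[OF q]]
  show "seminorm 0 U v = sqrt (J q)"
    using seminorm_eq[OF U, of 0 v "\<lambda>a x. q (R x)"] w c by (simp add: J_def)
  \<comment> \<open>The index \<open>a\<close> counts derivatives in the first coordinate, so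
    \<open>a = 0\<close> stands for the derivative in the second.\<close>
  define W where "W = (\<lambda>a x. if a = (0::nat) then L1 q 2 (R x) else L1 q 1 (R x))"
  have "seminorm 1 U v = sqrt (\<Sum>a\<le>1. LINT x:U|lebesgue. (W a x)\<^sup>2)"
  proof (rule seminorm_eq[OF U])
    fix a :: nat assume "a \<le> 1"
    then consider "a = 0" | "a = 1" by linarith
    then show "is_weak_deriv U a (1 - a) v (W a)" by cases (use w in \<open>simp_all add: W_def\<close>)
    show "continuous_on U (W a)" unfolding W_def by (cases "a = 0") (simp_all add: c)
  qed
  then show "seminorm 1 U v = sqrt (J (L1 q 2) + J (L1 q 1))" by (simp add: W_def J_def)
  define W2 where "W2 = (\<lambda>a x. if a = (0::nat) then L2 q 2 2 (R x) else if a = 1 then L2 q 1 2 (R x) else L2 q 1 1 (R x))"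
  have "seminorm 2 U v = sqrt (\<Sum>a\<le>2. LINT x:U|lebesgue. (W2 a x)\<^sup>2)"
  proof (rule seminorm_eq[OF U])
    fix a :: nat assume "a \<le> 2"
    then consider "a = 0" | "a = 1" | "a = 2" by linarith
    then show "is_weak_deriv U a (2 - a) v (W2 a)" by cases (use w in \<open>simp_all add: W2_def\<close>)
    show "continuous_on U (W2 a)" unfolding W2_def by (cases "a = 0"; cases "a = 1") (simp_all add: c)
  qed
  then show "seminorm 2 U v = sqrt (J (L2 q 2 2) + J (L2 q 1 2) + J (L2 q 1 1))"
    by (simp add: W2_def J_def numeral_2_eq_2)
qed

section \<open>Norm estimates in a chart\<close>

lemma L1_square_le:
  assumes "y \<in> R ` U"
  shows "(L1 q i y)\<^sup>2 \<le> 2 * N\<^sup>2 * (\<Sum>k\<in>UNIV. (pd k q y)\<^sup>2)"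
proof -
  have "(A i k y * pd k q y)\<^sup>2 \<le> N\<^sup>2 * (pd k q y)\<^sup>2" for k
    unfolding power_mult_distrib using A_le[OF assms, of i k] N
    by (intro mult_right_mono) (simp_all add: abs_le_square_iff[symmetric])
  from this[of 1] this[of 2] have "2 * ((A i 1 y * pd 1 q y)\<^sup>2 + (A i 2 y * pd 2 q y)\<^sup>2) \<le> 2 * N\<^sup>2 * (\<Sum>k\<in>UNIV. (pd k q y)\<^sup>2)"
    unfolding sum_2 by (simp add: algebra_simps)
  moreover have "(L1 q i y)\<^sup>2 \<le> 2 * ((A i 1 y * pd 1 q y)\<^sup>2 + (A i 2 y * pd 2 q y)\<^sup>2)"
    unfolding L1_def sum_2 by (rule sum_squares_bound_2)
  ultimately show ?thesis by linarith
qed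

text \<open>There are eight summands, four with a second derivative and four with a first derivative
  against a derivative of the coefficients, whence the factor 8. Every product of two coefficients
  is at most \<open>N\<^sup>2\<close>, and each first derivative occurs once for each
  \<open>l\<close>, whence the inner factor 2.\<close>

lemma L2_square_le:
  assumes "y \<in> R ` U"
  shows "(L2 q i j y)\<^sup>2 \<le> 8 * N ^ 4 * ((\<Sum>k\<in>UNIV. \<Sum>l\<in>UNIV. (pd l (pd k q) y)\<^sup>2) + 2 * (\<Sum>k\<in>UNIV. (pd k q y)\<^sup>2))"
proof -
  have N2: "\<bar>a * (b * c)\<bar> \<le> N\<^sup>2 * \<bar>c\<bar>" if "\<bar>a\<bar> \<le> N" "\<bar>b\<bar> \<le> N" for a b c :: real
    using mult_mono[OF that] N by (simp add: abs_mult power2_eq_square mult.assoc[symmetric] mult_right_mono)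
  have N2': "(a * (b * c))\<^sup>2 \<le> N ^ 4 * c\<^sup>2" if "\<bar>a\<bar> \<le> N" "\<bar>b\<bar> \<le> N" for a b c :: real
    using power_mono[OF N2[OF that, of c] abs_ge_zero, of 2] by (simp add: power_mult_distrib flip: power_mult)
  define u where "u = (\<lambda>l k. A j l y * (A i k y * pd l (pd k q) y))"
  define w where "w = (\<lambda>l k. A j l y * (DA i k l y * pd k q y))"
  have u: "(u l k)\<^sup>2 \<le> N ^ 4 * (pd l (pd k q) y)\<^sup>2" and w: "(w l k)\<^sup>2 \<le> N ^ 4 * (pd k q y)\<^sup>2" for l k
    unfolding u_def w_def by (intro N2' A_le[OF assms] DA_le[OF assms])+
  have "L2 q i j y = (u 1 1 + w 1 1 + u 1 2 + w 1 2) + (u 2 1 + w 2 1 + u 2 2 + w 2 2)"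
    unfolding L2_def u_def w_def sum_2 by (simp add: algebra_simps)
  moreover have "((a + b + c + d) + (a' + b' + c' + d'))\<^sup>2 \<le> 8 * (a\<^sup>2 + b\<^sup>2 + c\<^sup>2 + d\<^sup>2 + a'\<^sup>2 + b'\<^sup>2 + c'\<^sup>2 + d'\<^sup>2)"
    for a b c d a' b' c' d' :: real
  proof -
    have "((a + b + c + d) + (a' + b' + c' + d'))\<^sup>2 \<le> 2 * ((a + b + c + d)\<^sup>2 + (a' + b' + c' + d')\<^sup>2)"
      by (rule sum_squares_bound_2)
    moreover have "(a + b + c + d)\<^sup>2 \<le> 4 * (a\<^sup>2 + b\<^sup>2 + c\<^sup>2 + d\<^sup>2)" for a b c d :: real
      using sum_squares_bound_2[of "a + b" "c + d"] sum_squares_bound_2[of a b] sum_squares_bound_2[of c d]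
      by (simp add: add.assoc)
    ultimately show ?thesis by (smt (verit))
  qed
  ultimately have "(L2 q i j y)\<^sup>2 \<le> 8 * ((u 1 1)\<^sup>2 + (w 1 1)\<^sup>2 + (u 1 2)\<^sup>2 + (w 1 2)\<^sup>2 + (u 2 1)\<^sup>2 + (w 2 1)\<^sup>2 + (u 2 2)\<^sup>2 + (w 2 2)\<^sup>2)"
    by (simp only:)
  also have "\<dots> \<le> 8 * N ^ 4 * ((\<Sum>k\<in>UNIV. \<Sum>l\<in>UNIV. (pd l (pd k q) y)\<^sup>2) + 2 * (\<Sum>k\<in>UNIV. (pd k q y)\<^sup>2))"
    using u[of 1 1] u[of 1 2] u[of 2 1] u[of 2 2] w[of 1 1] w[of 1 2] w[of 2 1] w[of 2 2]
    unfolding sum_2 by (simp add: algebra_simps)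
  finally show ?thesis .
qed

text \<open>The polynomial bound \<open>markov\<close> is a hypothesis so that its constant
  \<open>C\<close> is fixed before the chart. Both the enclosing disc and the disc of radius
  \<open>d\<close> have area comparable to \<open>r\<^sup>2\<close>; these areas cancel, and only
  the factor \<open>1 / r\<^sup>2\<close> of the squared derivative bound remains.\<close>

lemma inverse_estimate:
  assumes C: "0 < C" and markov: "\<And>q y r S z k. q \<in> tensor_poly m \<Longrightarrow> r > 0 \<Longrightarrow>
      (\<And>w. w \<in> cball y (r / N) \<Longrightarrow> \<bar>q w\<bar> \<le> S) \<Longrightarrow> z \<in> cball y (N * r) \<Longrightarrow>
      \<bar>q z\<bar> \<le> C * S \<and> \<bar>pd k q z\<bar> \<le> C * S / r"
    and p: "p \<in> tensor_poly m"
  shows "J (pd k p) \<le> 4 * C\<^sup>2 * N\<^sup>2 * (8 * N * C + 2)\<^sup>2 / r\<^sup>2 * J p"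
proof -
  let ?y = "R x0"
  have rN: "0 \<le> r / N" using N r by simp
  have "\<exists>w\<in>cball ?y (r / N). \<forall>z\<in>cball ?y (r / N). \<bar>p z\<bar> \<le> \<bar>p w\<bar>"
    using rN by (intro continuous_attains_sup continuous_on_rabs tensor_poly_continuous[OF p]) auto
  then obtain w where w: "w \<in> cball ?y (r / N)" "\<And>z. z \<in> cball ?y (r / N) \<Longrightarrow> \<bar>p z\<bar> \<le> \<bar>p w\<bar>" by blast
  define S where "S = \<bar>p w\<bar>"
  have S0: "0 \<le> S" by (simp add: S_def)
  have bnd: "\<bar>pd k p z\<bar> \<le> C * S / r" if "z \<in> R ` U" for z k
    using markov[OF p r(1), of ?y S z k] w(2) that RU_sub by (auto simp: S_def)
  obtain x1 where x1: "x1 \<in> cball x0 (r / 2)" "R x1 = w" using covers w(1) by auto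
  \<comment> \<open>The derivative of \<open>p \<circ> R\<close> has norm at most
    \<open>4 * N * C * S / r\<close>, so a displacement of \<open>r / (8 * N * C)\<close> changes
    the value by at most \<open>S / 2\<close>. The added \<open>2\<close> also gives
    \<open>d \<le> r / 2\<close>, which keeps the disc around \<open>x1\<close> inside
    \<open>ball x0 r\<close>.\<close>
  define d where "d = r / (8 * N * C + 2)"
  have K: "8 * N * C + 2 > 0" "8 * N * C > 0" using N C by (simp_all add: add_pos_pos)
  have d: "0 < d" "d \<le> r / 2" "4 * N * (C * S / r) * d \<le> S / 2"
  proof -
    show "0 < d" unfolding d_def by (rule divide_pos_pos[OF r(1) K(1)])
    show "d \<le> r / 2" unfolding d_def
    proof (rule divide_left_mono)
      show "2 \<le> 8 * N * C + 2" using K(2) by linarith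
      show "0 < (8 * N * C + 2) * 2" using K(1) by (rule mult_pos_pos) simp
    qed (use r in simp)
    have "4 * N * (C * S / r) * d = S * (4 * N * C / (8 * N * C + 2))" using r by (simp add: d_def)
    also have "\<dots> \<le> S * (1 / 2)" using K by (intro mult_left_mono S0) (simp add: field_simps)
    finally show "4 * N * (C * S / r) * d \<le> S / 2" by simp
  qed
  have sub: "ball x1 d \<subseteq> ball x0 r"
  proof
    fix x assume "x \<in> ball x1 d"
    then show "x \<in> ball x0 r" using dist_triangle[of x0 x x1] x1(1) d(2) by simp
  qed
  have big: "S / 2 \<le> \<bar>p (R x)\<bar>" if x: "x \<in> ball x1 d" for x
  proof -
    have "norm (p (R x) - p (R x1)) \<le> (4 * N * (C * S / r)) * norm (x - x1)"
    proof (rule differentiable_bound[OF convex_ball])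
      fix z assume z: "z \<in> ball x1 d"
      then have zU: "z \<in> U" using sub ball_sub by blast
      show "((\<lambda>x. p (R x)) has_derivative (\<lambda>h. \<Sum>i\<in>UNIV. h $ i * L1 p i (R z))) (at z within ball x1 d)"
        using deriv1[OF p zU] has_derivative_at_withinI by blast
      have L1: "\<bar>L1 p i (R z)\<bar> \<le> 2 * N * (C * S / r)" for i
      proof -
        have "\<bar>A i k (R z) * pd k p (R z)\<bar> \<le> N * (C * S / r)" for k
          unfolding abs_mult using A_le[of "R z" i k] bnd[of "R z" k] zU N by (intro mult_mono) auto
        from this[of 1] this[of 2] show ?thesis unfolding L1_def sum_2 by linarith
      qed
      show "onorm (\<lambda>h. \<Sum>i\<in>UNIV. h $ i * L1 p i (R z)) \<le> 4 * N * (C * S / r)"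
      proof (rule onorm_le)
        fix h :: plane
        show "norm (\<Sum>i\<in>UNIV. h $ i * L1 p i (R z)) \<le> 4 * N * (C * S / r) * norm h"
          using norm_sum_components_le[of "\<lambda>i. L1 p i (R z)", OF L1, of h] by simp
      qed
    qed (use x d(1) in auto)
    also have "\<dots> \<le> 4 * N * (C * S / r) * d"
      using x N C S0 r by (intro mult_left_mono) (auto simp: dist_norm norm_minus_commute)
    finally have "\<bar>p (R x) - p w\<bar> \<le> S / 2" using d(3) x1(2) by simp
    moreover have "\<bar>p w\<bar> - \<bar>p (R x)\<bar> \<le> \<bar>p (R x) - p w\<bar>" by (rule abs_triangle_ineq2_sym)
    ultimately show ?thesis unfolding S_def by linarith
  qed
  have lower: "(S / 2)\<^sup>2 * (pi * d\<^sup>2) \<le> J p"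
  proof -
    have "(LINT x|lebesgue. indicator (ball x1 d) x *\<^sub>R (S / 2)\<^sup>2) \<le> J p"
      unfolding J_def set_lebesgue_integral_def
    proof (rule integral_mono)
      show "integrable lebesgue (\<lambda>x. indicator U x *\<^sub>R (p (R x))\<^sup>2)"
        using bdd_cont_integrable[OF bdd_cont_poly[OF p]] unfolding set_integrable_def .
      have "integrable lebesgue (indicator (ball x1 d) :: plane \<Rightarrow> real)"
        using lmeasurable_ball[of x1 d] by (intro integrable_real_indicator) (auto simp: fmeasurable_def)
      then show "integrable lebesgue (\<lambda>x. indicator (ball x1 d) x *\<^sub>R (S / 2)\<^sup>2)" by simp
      show "indicator (ball x1 d) x *\<^sub>R (S / 2)\<^sup>2 \<le> indicator U x *\<^sub>R (p (R x))\<^sup>2" for x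
      proof (cases "x \<in> ball x1 d")
        case True
        then have "x \<in> U" using sub ball_sub by blast
        moreover have "(S / 2)\<^sup>2 \<le> (p (R x))\<^sup>2" using big[OF True] S0 by (intro abs_le_square_iff[THEN iffD1]) simp
        ultimately show ?thesis using True by simp
      qed simp
    qed
    also have "(LINT x|lebesgue. indicator (ball x1 d) x *\<^sub>R (S / 2)\<^sup>2) = (S / 2)\<^sup>2 * (pi * d\<^sup>2)"
      using measure_ball_plane(1)[of d x1] d(1) by (simp add: less_imp_le)
    finally show ?thesis .
  qed
  have upper: "J (pd k p) \<le> (C * S / r)\<^sup>2 * (pi * (N * r)\<^sup>2)"
  proof -
    have "J (pd k p) \<le> (LINT x|lebesgue. indicator (cball x0 (N * r)) x *\<^sub>R (C * S / r)\<^sup>2)"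
      unfolding J_def set_lebesgue_integral_def
    proof (rule integral_mono)
      show "integrable lebesgue (\<lambda>x. indicator U x *\<^sub>R (pd k p (R x))\<^sup>2)"
        using bdd_cont_integrable[OF bdd_cont_poly[OF tensor_poly_derivative(2)[OF p]]] unfolding set_integrable_def .
      have "integrable lebesgue (indicator (cball x0 (N * r)) :: plane \<Rightarrow> real)"
        using lmeasurable_cball[of x0 "N * r"] by (intro integrable_real_indicator) (auto simp: fmeasurable_def)
      then show "integrable lebesgue (\<lambda>x. indicator (cball x0 (N * r)) x *\<^sub>R (C * S / r)\<^sup>2)" by simp
      show "indicator U x *\<^sub>R (pd k p (R x))\<^sup>2 \<le> indicator (cball x0 (N * r)) x *\<^sub>R (C * S / r)\<^sup>2" for x
      proof (cases "x \<in> U")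
        case True
        then have "\<bar>pd k p (R x)\<bar> \<le> \<bar>C * S / r\<bar>" using order.trans[OF bnd[of "R x" k] abs_ge_self] by blast
        then have "(pd k p (R x))\<^sup>2 \<le> (C * S / r)\<^sup>2" by (rule abs_le_square_iff[THEN iffD1])
        moreover have "x \<in> cball x0 (N * r)" using True U_sub by blast
        ultimately show ?thesis using True by simp
      qed simp
    qed
    also have "\<dots> = (C * S / r)\<^sup>2 * (pi * (N * r)\<^sup>2)"
      using measure_ball_plane(2)[of "N * r" x0] N r by simp
    finally show ?thesis .
  qed
  have "(C * S / r)\<^sup>2 * (pi * (N * r)\<^sup>2) = 4 * C\<^sup>2 * N\<^sup>2 * (8 * N * C + 2)\<^sup>2 / r\<^sup>2 * ((S / 2)\<^sup>2 * (pi * d\<^sup>2))"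
  proof -
    have "r = x * (r / x)" if "x > 0" for x using that by simp
    from this[OF K(1)] have "r = (8 * N * C + 2) * d" unfolding d_def .
    then have r2: "r\<^sup>2 = (8 * N * C + 2)\<^sup>2 * d\<^sup>2" by (simp add: power_mult_distrib)
    have "4 * C\<^sup>2 * N\<^sup>2 * (8 * N * C + 2)\<^sup>2 / r\<^sup>2 * ((S / 2)\<^sup>2 * (pi * d\<^sup>2))
       = C\<^sup>2 * N\<^sup>2 * S\<^sup>2 * pi * (((8 * N * C + 2)\<^sup>2 * d\<^sup>2) / r\<^sup>2)"
      by (simp add: power_divide)
    also have "((8 * N * C + 2)\<^sup>2 * d\<^sup>2) / r\<^sup>2 = 1" unfolding r2[symmetric] using r by simp
    finally show ?thesis using r by (simp add: power_divide power_mult_distrib)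
  qed
  also have "\<dots> \<le> 4 * C\<^sup>2 * N\<^sup>2 * (8 * N * C + 2)\<^sup>2 / r\<^sup>2 * J p"
    using lower by (intro mult_left_mono) auto
  finally show ?thesis using upper by linarith
qed

text \<open>From order 0 to 1, an upper bound of the coefficients and one inverse estimate for
  \<open>q\<close> suffice. From 1 to 2 the inverse estimate is applied to the derivatives of
  \<open>q\<close>, and ellipticity leads back from the derivatives of \<open>q\<close> to those of
  \<open>v\<close>, in which the right-hand side is expressed.\<close>

lemma seminorm_estimate:
  assumes C: "0 \<le> C" and inv: "\<And>p k. p \<in> tensor_poly m \<Longrightarrow> J (pd k p) \<le> C / r\<^sup>2 * J p"
    and q: "q \<in> tensor_poly m" and v: "\<And>x. x \<in> U \<Longrightarrow> v x = q (R x)"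
  shows "seminorm 1 U v \<le> sqrt (8 * N\<^sup>2 * C) / r * seminorm 0 U v"
    and "seminorm 2 U v \<le> sqrt (96 * N ^ 5 * (2 * C + 1)) / r * seminorm 1 U v"
proof -
  note dq = tensor_poly_derivative(2)[OF q]
  have e: "seminorm 0 U v = sqrt (J q)" "seminorm 1 U v = sqrt (J (L1 q 2) + J (L1 q 1))"
    "seminorm 2 U v = sqrt (J (L2 q 2 2) + J (L2 q 1 2) + J (L2 q 1 1))"
    using seminorms[OF q] v by auto
  define G where "G = (\<Sum>k\<in>UNIV. J (pd k q))"
  have G0: "0 \<le> G" by (simp add: G_def sum_nonneg J_nonneg)
  have u1: "J (L1 q i) \<le> 2 * N\<^sup>2 * G" for i
    unfolding G_def by (rule J_mono[OF bdd_cont_L1[OF q] _ bdd_cont_poly[OF dq] L1_square_le]) auto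
  have G: "G \<le> 2 * (C / r\<^sup>2 * J q)" using inv[OF q] unfolding G_def sum_2 by (smt (verit))
  have "J (L1 q 2) + J (L1 q 1) \<le> 4 * N\<^sup>2 * G" using u1[of 1] u1[of 2] by linarith
  also have "\<dots> \<le> 4 * N\<^sup>2 * (2 * (C / r\<^sup>2 * J q))" using G by (intro mult_left_mono) auto
  also have "\<dots> = (8 * N\<^sup>2 * C) / r\<^sup>2 * J q" by simp
  finally have "sqrt (J (L1 q 2) + J (L1 q 1)) \<le> sqrt ((8 * N\<^sup>2 * C) / r\<^sup>2 * J q)"
    by (rule real_sqrt_le_mono)
  then show "seminorm 1 U v \<le> sqrt (8 * N\<^sup>2 * C) / r * seminorm 0 U v"
    using r unfolding e by (simp add: real_sqrt_mult real_sqrt_divide)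
  have low: "G \<le> 2 * N * (J (L1 q 2) + J (L1 q 1))"
  proof -
    have "J (pd k q) \<le> N * (\<Sum>i\<in>UNIV. J (L1 q i))" for k
    proof (rule J_mono[OF bdd_cont_poly[OF dq] _ bdd_cont_L1[OF q]])
      fix y assume "y \<in> R ` U"
      have "(pd k q y)\<^sup>2 \<le> (\<Sum>k\<in>UNIV. (pd k q y)\<^sup>2)" by (rule member_le_sum) auto
      then show "(pd k q y)\<^sup>2 \<le> N * (\<Sum>i\<in>UNIV. (L1 q i y)\<^sup>2)"
        using elliptic[OF \<open>y \<in> R ` U\<close>, of "\<lambda>k. pd k q y"] unfolding L1_def by linarith
    qed auto
    from this[of 1] this[of 2] show ?thesis unfolding G_def sum_2 by (simp add: algebra_simps)
  qed
  have G2: "(\<Sum>k\<in>UNIV. \<Sum>l\<in>UNIV. J (pd l (pd k q))) \<le> 2 * C / r\<^sup>2 * G"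
  proof -
    have "(\<Sum>l\<in>UNIV. J (pd l (pd k q))) \<le> 2 * C / r\<^sup>2 * J (pd k q)" for k
      using inv[OF dq[of k], of 1] inv[OF dq[of k], of 2] unfolding sum_2 by simp
    then show ?thesis unfolding G_def sum_distrib_left by (intro sum_mono)
  qed
  \<comment> \<open>The first order terms of \<open>L2\<close> carry no factor \<open>1 / r\<close>;
    since \<open>r \<le> 1\<close> they fit under the bound for the second order terms.\<close>
  have r2: "G \<le> G / r\<^sup>2" using r G0 by (simp add: le_divide_eq mult_left_le power_le_one)
  have u2: "J (L2 q i j) \<le> 16 * N ^ 4 * ((2 * C + 1) / r\<^sup>2 * G)" for i j
  proof -
    \<comment> \<open>\<open>J_mono\<close> takes one finite family, so first and second derivatives
      are indexed together: \<open>None\<close> marks a first derivative, \<open>Some l\<close> a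
      further derivative in direction \<open>l\<close>.\<close>
    let ?g = "\<lambda>n. case n of (None, k) \<Rightarrow> pd k q | (Some l, k) \<Rightarrow> pd l (pd k q)"
    have sum: "(\<Sum>n\<in>UNIV. f n) = (\<Sum>k\<in>UNIV. f (None, k)) + (\<Sum>k\<in>UNIV. \<Sum>l\<in>UNIV. f (Some l, k))"
      for f :: "2 option \<times> 2 \<Rightarrow> real"
    proof -
      have "(\<Sum>n\<in>UNIV. f n) = (\<Sum>a\<in>UNIV. \<Sum>b\<in>UNIV. f (a, b))"
        by (simp add: sum.cartesian_product)
      then show ?thesis by (simp add: UNIV_option_conv sum.reindex sum_2)
    qed
    have "J (L2 q i j) \<le> 16 * N ^ 4 * (\<Sum>n\<in>UNIV. J (?g n))"
    proof (rule J_mono[OF bdd_cont_L2[OF q]])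
      show "bdd_cont (?g n)" for n
        by (auto split: prod.split option.split intro: bdd_cont_poly[OF dq] bdd_cont_poly[OF tensor_poly_derivative(2)[OF dq]])
      fix y assume y: "y \<in> R ` U"
      have "8 * N ^ 4 * ((\<Sum>k\<in>UNIV. \<Sum>l\<in>UNIV. (pd l (pd k q) y)\<^sup>2) + 2 * (\<Sum>k\<in>UNIV. (pd k q y)\<^sup>2))
        \<le> 8 * N ^ 4 * (2 * (\<Sum>n\<in>UNIV. (?g n y)\<^sup>2))"
        unfolding sum using N by (intro mult_left_mono) (auto intro!: sum_nonneg)
      then show "(L2 q i j y)\<^sup>2 \<le> 16 * N ^ 4 * (\<Sum>n\<in>UNIV. (?g n y)\<^sup>2)"
        using L2_square_le[OF y, of q i j] by simp
    qed auto
    also have "\<dots> = 16 * N ^ 4 * ((\<Sum>k\<in>UNIV. \<Sum>l\<in>UNIV. J (pd l (pd k q))) + G)"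
      by (simp add: sum G_def)
    also have "\<dots> \<le> 16 * N ^ 4 * ((2 * C + 1) / r\<^sup>2 * G)"
      using G2 r2 N by (intro mult_left_mono) (auto simp: add_divide_distrib distrib_right)
    finally show ?thesis .
  qed
  have "J (L2 q 2 2) + J (L2 q 1 2) + J (L2 q 1 1) \<le> 3 * (16 * N ^ 4 * ((2 * C + 1) / r\<^sup>2 * G))"
  proof -
    have "a + b + c \<le> 3 * x" if "a \<le> x" "b \<le> x" "c \<le> x" for a b c x :: real using that by linarith
    then show ?thesis using u2 by blast
  qed
  also have "\<dots> = 48 * N ^ 4 * ((2 * C + 1) / r\<^sup>2) * G" by simp
  also have "48 * N ^ 4 * ((2 * C + 1) / r\<^sup>2) * G \<le> 48 * N ^ 4 * ((2 * C + 1) / r\<^sup>2) * (2 * N * (J (L1 q 2) + J (L1 q 1)))"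
    using low C N by (intro mult_left_mono) auto
  also have "\<dots> = (96 * N ^ 5 * (2 * C + 1)) / r\<^sup>2 * (J (L1 q 2) + J (L1 q 1))"
    by (simp add: eval_nat_numeral)
  finally have "sqrt (J (L2 q 2 2) + J (L2 q 1 2) + J (L2 q 1 1))
      \<le> sqrt ((96 * N ^ 5 * (2 * C + 1)) / r\<^sup>2 * (J (L1 q 2) + J (L1 q 1)))"
    by (rule real_sqrt_le_mono)
  then show "seminorm 2 U v \<le> sqrt (96 * N ^ 5 * (2 * C + 1)) / r * seminorm 1 U v"
    using r unfolding e by (simp add: real_sqrt_mult real_sqrt_divide)
qed

end

lemma seminorm_nonneg: "0 \<le> seminorm k U v"
  unfolding seminorm_def set_lebesgue_integral_def
  by (intro real_sqrt_ge_zero sum_nonneg Bochner_Integration.integral_nonneg) auto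

lemma chart_inverse_estimates:
  assumes "1 \<le> N"
  obtains K where "0 < K"
    "\<And>r U R x0 A DA q v l j. chart N r U R x0 A DA \<Longrightarrow> q \<in> tensor_poly m \<Longrightarrow>
       (\<And>x. x \<in> U \<Longrightarrow> v x = q (R x)) \<Longrightarrow>
       v \<in> sobolev 2 U \<and> (l \<le> j \<and> j \<le> 2 \<longrightarrow> seminorm j U v \<le> K / r ^ (j - l) * seminorm l U v)"
proof -
  obtain C where C: "C > 0" "\<And>q y r S z k. q \<in> tensor_poly m \<Longrightarrow> r > 0 \<Longrightarrow>
      (\<And>w. w \<in> cball y (r / N) \<Longrightarrow> \<bar>q w\<bar> \<le> S) \<Longrightarrow> z \<in> cball y (N * r) \<Longrightarrow>
      \<bar>q z\<bar> \<le> C * S \<and> \<bar>pd k q z\<bar> \<le> C * S / r"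
    using tensor_poly_markov[of N m] assms by auto
  define C' where "C' = 4 * C\<^sup>2 * N\<^sup>2 * (8 * N * C + 2)\<^sup>2"
  \<comment> \<open>\<open>B\<close> dominates \<open>1\<close> and both one-step factors;
    \<open>B * B\<close> then covers the trivial case \<open>j = l\<close>, a single step, and the
    product of two steps.\<close>
  define B where "B = 1 + sqrt (8 * N\<^sup>2 * C') + sqrt (96 * N ^ 5 * (2 * C' + 1))"
  have C': "C' \<ge> 0" by (simp add: C'_def)
  have B: "B \<ge> 1" "sqrt (8 * N\<^sup>2 * C') \<le> B" "sqrt (96 * N ^ 5 * (2 * C' + 1)) \<le> B"
    using assms C' by (simp_all add: B_def)
  have BB: "1 \<le> B * B" "B \<le> B * B" using B(1) mult_mono[of 1 B 1 B] mult_left_mono[of 1 B B] by auto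
  show ?thesis
  proof (rule that[of "B * B"])
    show "0 < B * B" using B(1) by simp
    fix r U R x0 A DA q v l j
    assume ch: "chart N r U R x0 A DA" and q: "q \<in> tensor_poly m" and v: "\<And>x. x \<in> U \<Longrightarrow> v x = q (R x)"
    interpret chart N r U R x0 A DA by (rule ch)
    have inv: "J (pd k p) \<le> C' / r\<^sup>2 * J p" if "p \<in> tensor_poly m" for p k
      unfolding C'_def by (rule inverse_estimate[OF C that])
    have mono: "x / r * seminorm k U v \<le> B / r * seminorm k U v" if "x \<le> B" for x k
      using that r seminorm_nonneg[of k U v] by (intro mult_right_mono divide_right_mono) auto
    have s01: "seminorm 1 U v \<le> B / r * seminorm 0 U v"
      by (rule order.trans[OF seminorm_estimate(1)[OF C' inv q v] mono[OF B(2)]])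
    have s12: "seminorm 2 U v \<le> B / r * seminorm 1 U v"
      by (rule order.trans[OF seminorm_estimate(2)[OF C' inv q v] mono[OF B(3)]])
    have "B / r * seminorm 1 U v \<le> B / r * (B / r * seminorm 0 U v)"
      using s01 B r by (intro mult_left_mono) auto
    then have s02: "seminorm 2 U v \<le> B * B / r\<^sup>2 * seminorm 0 U v"
      using s12 by (simp add: power2_eq_square)
    have up: "B / r * seminorm k U v \<le> B * B / r * seminorm k U v" for k
      using BB r seminorm_nonneg[of k U v] by (intro mult_right_mono divide_right_mono) auto
    have "seminorm j U v \<le> B * B / r ^ (j - l) * seminorm l U v" if lj: "l \<le> j" "j \<le> 2"
    proof -
      consider "j = l" | "l = 0" "j = 1" | "l = 1" "j = 2" | "l = 0" "j = 2" using lj by linarith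
      then show ?thesis
      proof cases
        case 1
        then show ?thesis using mult_right_mono[OF BB(1) seminorm_nonneg[of j U v]] by simp
      next
        case 2 then show ?thesis using order.trans[OF s01 up] by simp
      next
        case 3 then show ?thesis using order.trans[OF s12 up] by simp
      next
        case 4 then show ?thesis using s02 by simp
      qed
    qed
    then show "v \<in> sobolev 2 U \<and> (l \<le> j \<and> j \<le> 2 \<longrightarrow> seminorm j U v \<le> B * B / r ^ (j - l) * seminorm l U v)"
      using sobolev[OF q v] by blast
  qed
qed

section \<open>Frenet coordinates\<close>

lemma rot_component: "(Q *v x) $ 1 = x $ 2" "(Q *v x) $ 2 = - (x $ 1)"
  by (simp_all add: Q_def matrix_vector_mult_def sum_2)

lemma vec2_eq_iff: "(x :: real^2) = y \<longleftrightarrow> x $ 1 = y $ 1 \<and> x $ 2 = y $ 2"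
  by (simp add: vec_eq_iff forall_2)

lemma inner_vec2: "(x :: real^2) \<bullet> y = x $ 1 * y $ 1 + x $ 2 * y $ 2"
  by (simp add: inner_vec_def sum_2)

text \<open>
  \<open>u\<close> is the derivative of the parameterization and \<open>k\<close> the curvature, normalised so that
  the derivative of the unit normal is \<open>k *\<^sub>R u\<close>.
\<close>

locale frenet_data =
  fixes c :: curve and \<epsilon> N :: real and u u1 :: "real \<Rightarrow> plane" and k k1 :: "real \<Rightarrow> real"
  assumes eps: "0 < \<epsilon>" and N: "1 \<le> N" and ps_less: "ps c < pe c"
    and par_deriv: "\<And>t. t \<in> pdom c \<Longrightarrow> (par c has_vector_derivative u t) (at t within pdom c)"
    and u_deriv: "\<And>t. t \<in> pdom c \<Longrightarrow> (u has_vector_derivative u1 t) (at t within pdom c)"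
    and normal_deriv: "\<And>t. t \<in> pdom c \<Longrightarrow> (normal c has_vector_derivative k t *\<^sub>R u t) (at t within pdom c)"
    and k_deriv: "\<And>t. t \<in> pdom c \<Longrightarrow> (k has_real_derivative k1 t) (at t within pdom c)"
    and u1_cont: "continuous_on (pdom c) u1" and k1_cont: "continuous_on (pdom c) k1"
    and bounds: "\<And>t. t \<in> pdom c \<Longrightarrow> norm (u t) \<le> N \<and> 1 / N \<le> norm (u t) \<and> norm (u1 t) \<le> N \<and> \<bar>k t\<bar> \<le> N \<and> \<bar>k1 t\<bar> \<le> N"
    and normal_eq: "\<And>t. t \<in> pdom c \<Longrightarrow> normal c t = (1 / norm (u t)) *\<^sub>R (Q *v u t)"
    and jac: "\<And>t s. t \<in> pdom c \<Longrightarrow> s \<in> {-\<epsilon>..\<epsilon>} \<Longrightarrow> 1 / 2 \<le> 1 + s * k t \<and> 1 + s * k t \<le> 2"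

section \<open>Regularity data of a curve\<close>

lemma bounded_on_pdom:
  fixes f :: "real \<Rightarrow> 'a::real_normed_vector"
  assumes less: "ps c < pe c" and cont: "continuous_on (pdom c) f"
    and per: "closed_curve c \<Longrightarrow> (\<And>t. f (t + (pe c - ps c)) = f t)"
  obtains B where "B > 0" "\<And>t. t \<in> pdom c \<Longrightarrow> norm (f t) \<le> B"
proof -
  have sub: "{ps c..pe c} \<subseteq> pdom c" by (auto simp: pdom_def)
  have "bounded (f ` {ps c..pe c})"
    using cont sub by (intro compact_imp_bounded compact_continuous_image continuous_on_subset[OF cont]) auto
  then obtain B where B: "B > 0" "\<And>t. t \<in> {ps c..pe c} \<Longrightarrow> norm (f t) \<le> B"
    by (auto simp: bounded_pos)
  have "norm (f t) \<le> B" if t: "t \<in> pdom c" for t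
  proof (cases "closed_curve c")
    \<comment> \<open>For a closed curve the parameter domain is the whole line, so compactness of
      one period is combined with periodicity; \<open>n\<close> counts the periods to be
      subtracted.\<close>
    case True
    interpret periodic_fun_simple f "pe c - ps c" by standard (rule per[OF True])
    define n where "n = \<lfloor>(t - ps c) / (pe c - ps c)\<rfloor>"
    have T: "0 < pe c - ps c" using less by simp
    have "of_int n \<le> (t - ps c) / (pe c - ps c)" "(t - ps c) / (pe c - ps c) < of_int n + 1"
      unfolding n_def by linarith+
    then have n: "of_int n * (pe c - ps c) \<le> t - ps c" "t - ps c \<le> (of_int n + 1) * (pe c - ps c)"
      using T by (simp_all add: field_simps)
    have "f t = f (t - of_int n * (pe c - ps c))" by (rule minus_of_int[symmetric])
    moreover have "t - of_int n * (pe c - ps c) \<in> {ps c..pe c}" using n by (auto simp: algebra_simps)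
    ultimately show ?thesis using B by metis
  qed (use t B in \<open>auto simp: pdom_def\<close>)
  then show ?thesis using that B by blast
qed

text \<open>Without isolated points, derivatives within the parameter domain are unique; this
  identifies \<open>dpar\<close> and \<open>ddpar\<close> with the derivatives supplied by
  \<open>Ck_on\<close>.\<close>

lemma pdom_islimpt:
  assumes "ps c < pe c" "t \<in> pdom c"
  shows "at t within pdom c \<noteq> bot"
proof -
  have "connected (pdom c)" by (simp add: pdom_def)
  moreover have "pdom c \<noteq> {x}" for x
  proof -
    have "ps c \<in> pdom c" "pe c \<in> pdom c" using assms by (auto simp: pdom_def)
    then show ?thesis using assms(1) by (metis less_irrefl singletonD)
  qed
  ultimately have "t islimpt pdom c" using assms(2) by (intro connected_imp_perfect) auto
  then show ?thesis by (simp add: trivial_limit_within)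
qed

lemma vector_derivative_periodic:
  assumes "\<And>t. (f has_vector_derivative f' t) (at t)" "\<And>t. f (t + T) = f t"
  shows "f' (t + T) = f' t"
proof -
  have "((f \<circ> (\<lambda>t. t + T)) has_vector_derivative 1 *\<^sub>R f' (t + T)) (at t)"
    by (rule vector_diff_chain_at) (auto intro!: derivative_eq_intros assms(1) has_vector_derivative_add_const[THEN iffD2])
  moreover have "f \<circ> (\<lambda>t. t + T) = f" using assms(2) by auto
  ultimately show ?thesis using assms(1)[of t] vector_derivative_unique_at by (metis scaleR_one)
qed

lemma has_real_derivative_inner:
  assumes "(f has_vector_derivative f') (at t within S)" "(g has_vector_derivative g') (at t within S)"
  shows "((\<lambda>t. f t \<bullet> g t) has_real_derivative (f t \<bullet> g' + f' \<bullet> g t)) (at t within S)"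
  using has_derivative_inner[OF assms[unfolded has_vector_derivative_def]]
  unfolding has_field_derivative_def by (rule has_derivative_eq_rhs) (auto simp: algebra_simps)

text \<open>The derivative \<open>k1\<close> of the curvature contains the third derivative of the
  parameterization. Continuity and periodicity bound all data over the whole parameter domain, and
  the bound of the reciprocal speed \<open>w\<close> becomes the lower bound \<open>1 / N\<close> of
  the speed.\<close>

lemma frenet_data_exists:
  assumes reg: "regular_curve 3 c" and tub: "tubular c \<epsilon>" and eps: "0 < \<epsilon>"
  obtains N u u1 k k1 where "frenet_data c \<epsilon> N u u1 k k1"
proof -
  let ?J = "pdom c" and ?T = "pe c - ps c"
  obtain D where D0: "D 0 = par c"
    and D: "\<And>i t. i < 3 \<Longrightarrow> t \<in> ?J \<Longrightarrow> (D i has_vector_derivative D (Suc i) t) (at t within ?J)"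
    and D3: "continuous_on ?J (D 3)" and less: "ps c < pe c"
    and nz: "\<And>t. t \<in> ?J \<Longrightarrow> dpar c t \<noteq> 0"
    and per0: "closed_curve c \<longrightarrow> (\<forall>t. par c (t + ?T) = par c t)"
    using reg unfolding regular_curve_def Ck_on_def by blast
  have dpar: "dpar c t = D 1 t" if "t \<in> ?J" for t
    unfolding dpar_def using vector_derivative_within[OF pdom_islimpt[OF less that] D[of 0, OF _ that]] D0 by simp
  have ddpar: "ddpar c t = D 2 t" if "t \<in> ?J" for t
  proof -
    have "(dpar c has_vector_derivative D 2 t) (at t within ?J)"
      by (rule has_vector_derivative_transform[OF that _ D[of 1, OF _ that, simplified, folded numeral_2_eq_2]])
        (use dpar in auto)
    then show ?thesis unfolding ddpar_def using vector_derivative_within[OF pdom_islimpt[OF less that]] by blast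
  qed
  define u u1 u2 where "u = D 1" and "u1 = D 2" and "u2 = D 3"
  have du0: "(par c has_vector_derivative u t) (at t within ?J)" if "t \<in> ?J" for t
    using D[of 0, OF _ that] D0 by (simp add: u_def)
  have du: "(u has_vector_derivative u1 t) (at t within ?J)" if "t \<in> ?J" for t
    using D[of 1, OF _ that] by (simp add: u_def u1_def numeral_2_eq_2)
  have du1: "(u1 has_vector_derivative u2 t) (at t within ?J)" if "t \<in> ?J" for t
    using D[of 2, OF _ that] by (simp add: u1_def u2_def numeral_3_eq_3 numeral_2_eq_2)
  have unz: "u t \<noteq> 0" if "t \<in> ?J" for t using nz[OF that] dpar[OF that] by (simp add: u_def)
  have cu: "continuous_on ?J u" "continuous_on ?J u1" "continuous_on ?J u2"
    using du du1 D3 has_vector_derivative_continuous unfolding u2_def continuous_on_eq_continuous_within by blast+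
  have per: "u (t + ?T) = u t" "u1 (t + ?T) = u1 t" "u2 (t + ?T) = u2 t" if cl: "closed_curve c" for t
  proof -
    have J: "?J = UNIV" using cl by (simp add: pdom_def)
    show p1: "u (t + ?T) = u t" for t
      by (rule vector_derivative_periodic[where f = "par c"]) (use du0 J per0 cl in auto)
    show p2: "u1 (t + ?T) = u1 t" for t
      by (rule vector_derivative_periodic[where f = u]) (use du J p1 in auto)
    show "u2 (t + ?T) = u2 t"
      by (rule vector_derivative_periodic[where f = u1]) (use du1 J p2 in auto)
  qed
  define w where "w = (\<lambda>t. inverse (norm (u t)))"
  define w1 where "w1 = (\<lambda>t. - (u t \<bullet> u1 t) * w t ^ 3)"
  have dw: "(w has_real_derivative w1 t) (at t within ?J)" if t: "t \<in> ?J" for t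
  proof -
    have "((\<lambda>t. u t \<bullet> u t) has_real_derivative (u t \<bullet> u1 t + u1 t \<bullet> u t)) (at t within ?J)"
      by (rule has_real_derivative_inner[OF du[OF t] du[OF t]])
    moreover have pos: "u t \<bullet> u t > 0" using unz[OF t] by simp
    ultimately have "((\<lambda>t. inverse (sqrt (u t \<bullet> u t))) has_real_derivative w1 t) (at t within ?J)"
      unfolding w1_def w_def norm_eq_sqrt_inner
      by (auto intro!: derivative_eq_intros simp: not_less[THEN iffD2, OF inner_ge_zero] inner_commute field_simps power2_eq_square power3_eq_cube)
    then show ?thesis by (simp add: w_def norm_eq_sqrt_inner)
  qed
  define k where "k = (\<lambda>t. (u t \<bullet> (Q *v u1 t)) * w t ^ 3)"
  define k1 where "k1 = (\<lambda>t. (u t \<bullet> (Q *v u2 t)) * w t ^ 3 + (u t \<bullet> (Q *v u1 t)) * (3 * w t ^ 2 * w1 t))"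
  have dQ: "((\<lambda>t. Q *v f t) has_vector_derivative Q *v f') (at t within ?J)"
    if "(f has_vector_derivative f') (at t within ?J)" for f f' t
    by (rule bounded_linear.has_vector_derivative[OF _ that]) (simp add: matrix_vector_mul_bounded_linear)
  have dk: "(k has_real_derivative k1 t) (at t within ?J)" if t: "t \<in> ?J" for t
  proof -
    have "((\<lambda>t. u t \<bullet> (Q *v u1 t)) has_real_derivative (u t \<bullet> (Q *v u2 t) + u1 t \<bullet> (Q *v u1 t))) (at t within ?J)"
      by (rule has_real_derivative_inner[OF du[OF t] dQ[OF du1[OF t]]])
    \<comment> \<open>\<open>Q\<close> turns vectors by a right angle, so the term quadratic in
      \<open>u1\<close> drops out of the derivative of the numerator of the curvature.\<close>
    moreover have "u1 t \<bullet> (Q *v u1 t) = 0" by (simp add: inner_vec2 rot_component)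
    ultimately show ?thesis unfolding k_def k1_def
      by (auto intro!: derivative_eq_intros dw[OF t] simp: algebra_simps)
  qed
  have normal: "normal c t = w t *\<^sub>R (Q *v u t)" if "t \<in> ?J" for t
    by (simp add: normal_def tangent_def dpar[OF that] u_def w_def matrix_vector_mult_scaleR)
  have dn: "(normal c has_vector_derivative k t *\<^sub>R u t) (at t within ?J)" if t: "t \<in> ?J" for t
  proof -
    have "((\<lambda>t. w t *\<^sub>R (Q *v u t)) has_vector_derivative (w t *\<^sub>R (Q *v u1 t) + w1 t *\<^sub>R (Q *v u t))) (at t within ?J)"
      by (rule has_vector_derivative_scaleR[OF dw[OF t] dQ[OF du[OF t]]])
    \<comment> \<open>This is the Frenet formula \<open>n' = \<kappa> g'\<close>. In components it
      is a polynomial identity once \<open>w\<close> is written as \<open>w ^ 3\<close> times the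
      squared speed.\<close>
    moreover have "w t *\<^sub>R (Q *v u1 t) + w1 t *\<^sub>R (Q *v u t) = k t *\<^sub>R u t"
    proof -
      have "w t * norm (u t) = 1" using unz[OF t] by (simp add: w_def)
      then have "(w t)\<^sup>2 * (norm (u t))\<^sup>2 = 1" by (metis power_mult_distrib power_one)
      then have w2: "(w t)\<^sup>2 * (u t $ 1 * u t $ 1 + u t $ 2 * u t $ 2) = 1"
        by (simp add: power2_norm_eq_inner inner_vec2)
      have "w t = w t ^ 3 * (u t $ 1 * u t $ 1 + u t $ 2 * u t $ 2)"
        using w2 by (simp add: power3_eq_cube power2_eq_square mult.assoc)
      then show ?thesis
        unfolding vec2_eq_iff w1_def k_def inner_vec2 by (simp add: rot_component) algebra
    qed
    ultimately have "((\<lambda>t. w t *\<^sub>R (Q *v u t)) has_vector_derivative k t *\<^sub>R u t) (at t within ?J)" by simp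
    then show ?thesis by (rule has_vector_derivative_transform[OF t _, rotated]) (simp add: normal)
  qed
  have cw: "continuous_on ?J w" unfolding w_def by (intro continuous_intros cu) (use unz in auto)
  have cw1: "continuous_on ?J w1" unfolding w1_def by (intro continuous_intros cu cw)
  have cQ: "continuous_on ?J (\<lambda>t. Q *v f t)" if "continuous_on ?J f" for f
    by (rule bounded_linear.continuous_on[OF _ that]) (simp add: matrix_vector_mul_bounded_linear)
  have ck: "continuous_on ?J k" "continuous_on ?J k1"
    unfolding k_def k1_def by (intro continuous_intros cu cw cw1 cQ)+
  have per': "w (t + ?T) = w t" "k (t + ?T) = k t" "k1 (t + ?T) = k1 t" if "closed_curve c" for t
    using per[OF that] by (simp_all add: w_def k_def k1_def w1_def)
  obtain B1 where B1: "B1 > 0" "\<And>t. t \<in> ?J \<Longrightarrow> norm (u t) \<le> B1" using bounded_on_pdom[OF less cu(1) per(1)] by blast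
  obtain B2 where B2: "B2 > 0" "\<And>t. t \<in> ?J \<Longrightarrow> norm (u1 t) \<le> B2" using bounded_on_pdom[OF less cu(2) per(2)] by blast
  obtain B3 where B3: "B3 > 0" "\<And>t. t \<in> ?J \<Longrightarrow> norm (w t) \<le> B3" using bounded_on_pdom[OF less cw per'(1)] by blast
  obtain B4 where B4: "B4 > 0" "\<And>t. t \<in> ?J \<Longrightarrow> norm (k t) \<le> B4" using bounded_on_pdom[OF less ck(1) per'(2)] by blast
  obtain B5 where B5: "B5 > 0" "\<And>t. t \<in> ?J \<Longrightarrow> norm (k1 t) \<le> B5" using bounded_on_pdom[OF less ck(2) per'(3)] by blast
  define N where "N = 1 + B1 + B2 + B3 + B4 + B5"
  have N: "1 \<le> N" "B1 \<le> N" "B2 \<le> N" "B3 \<le> N" "B4 \<le> N" "B5 \<le> N"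
    using B1 B2 B3 B4 B5 by (simp_all add: N_def)
  have "frenet_data c \<epsilon> N u u1 k k1"
  proof
    fix t assume t: "t \<in> ?J"
    have "inverse (norm (u t)) \<le> N" using B3(2)[OF t] N by (simp add: w_def)
    then have "1 / N \<le> norm (u t)"
      using unz[OF t] N(1) by (simp add: field_simps)
    then show "norm (u t) \<le> N \<and> 1 / N \<le> norm (u t) \<and> norm (u1 t) \<le> N \<and> \<bar>k t\<bar> \<le> N \<and> \<bar>k1 t\<bar> \<le> N"
      using B1(2)[OF t] B2(2)[OF t] B4(2)[OF t] B5(2)[OF t] N by simp
    show "normal c t = (1 / norm (u t)) *\<^sub>R (Q *v u t)" using normal[OF t] by (simp add: w_def inverse_eq_divide)
    fix s assume s: "s \<in> {-\<epsilon>..\<epsilon>}"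
    have "(vector [s, t] :: plane) \<in> strip c \<epsilon>" using s t by (simp add: strip_def)
    from bspec[OF tub[unfolded tubular_def, THEN conjunct2, THEN conjunct1] this]
    have "1 / 2 \<le> 1 + s * curvature c t \<and> 1 + s * curvature c t \<le> 2" by simp
    moreover have "curvature c t = k t"
      by (simp add: curvature_def dpar[OF t] ddpar[OF t] k_def u_def u1_def w_def power_inverse divide_inverse)
    ultimately show "1 / 2 \<le> 1 + s * k t \<and> 1 + s * k t \<le> 2" by simp
  qed (use eps N less du0 du dn dk cu ck in auto)
  then show ?thesis using that by blast
qed

lemma convex_pdom: "convex (pdom c)" and closed_pdom: "closed (pdom c)"
  by (simp_all add: pdom_def)

lemma strip_eq: "strip c \<epsilon> = (\<lambda>p. p $ 1) -` {-\<epsilon>..\<epsilon>} \<inter> (\<lambda>p. p $ 2) -` pdom c"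
  by (auto simp: strip_def)

lemma linear_component: "linear (\<lambda>p :: real^'n. p $ i)"
  by (simp add: linear_iff)

lemma convex_strip: "convex (strip c \<epsilon>)"
  unfolding strip_eq
  by (intro convex_Int convex_linear_vimage linear_component convex_pdom) auto

lemma closed_strip: "closed (strip c \<epsilon>)"
  unfolding strip_eq
  by (intro closed_Int closed_vimage closed_pdom continuous_intros)

lemma vector_derivative_lipschitz:
  assumes "convex S" "\<And>t. t \<in> S \<Longrightarrow> (f has_vector_derivative f' t) (at t within S)"
    and "\<And>t. t \<in> S \<Longrightarrow> norm (f' t) \<le> B" "s \<in> S" "t \<in> S"
  shows "norm (f s - f t) \<le> B * \<bar>s - t\<bar>"
proof -
  have "norm (f s - f t) \<le> B * norm (s - t)"
  proof (rule differentiable_bound[OF assms(1)])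
    show "(f has_derivative (\<lambda>h. h *\<^sub>R f' x)) (at x within S)" if "x \<in> S" for x
      using assms(2)[OF that] unfolding has_vector_derivative_def .
    show "onorm (\<lambda>h. h *\<^sub>R f' x) \<le> B" if "x \<in> S" for x
    proof (rule onorm_le)
      show "norm (h *\<^sub>R f' x) \<le> B * norm h" for h
        using mult_left_mono[OF assms(3)[OF that], of "\<bar>h\<bar>"] by (simp add: mult.commute)
    qed
  qed fact+
  then show ?thesis by simp
qed

section \<open>Derivative and local expansion of the Frenet map\<close>

context frenet_data begin

lemma normal_unit: "t \<in> pdom c \<Longrightarrow> normal c t \<bullet> normal c t = 1"
  and normal_ortho: "t \<in> pdom c \<Longrightarrow> normal c t \<bullet> u t = 0"
proof -
  assume t: "t \<in> pdom c"
  have "0 < 1 / N" using N by simp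
  then have p: "0 < norm (u t)" using bounds[OF t] by linarith
  have q: "(Q *v u t) \<bullet> (Q *v u t) = u t \<bullet> u t" by (simp add: inner_vec2 rot_component)
  show "normal c t \<bullet> normal c t = 1"
    unfolding normal_eq[OF t] inner_scaleR_left inner_scaleR_right q
    using p by (simp add: dot_square_norm power2_eq_square)
  show "normal c t \<bullet> u t = 0"
    unfolding normal_eq[OF t] by (simp add: inner_vec2 rot_component)
qed

text \<open>By \<open>n' = \<kappa> g'\<close>, \<open>W p\<close> is the partial derivative of the
  Frenet map in the tangential coordinate. The one in the normal coordinate is the unit normal, and
  \<open>E p\<close> is the full derivative.\<close>

definition W :: "plane \<Rightarrow> plane" where
  "W p = (1 + p $ 1 * k (p $ 2)) *\<^sub>R u (p $ 2)"

definition E :: "plane \<Rightarrow> plane \<Rightarrow> plane" where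
  "E p h = h $ 1 *\<^sub>R normal c (p $ 2) + h $ 2 *\<^sub>R W p"

lemma stripD:
  assumes "p \<in> strip c \<epsilon>"
  shows "p $ 2 \<in> pdom c" "\<bar>p $ 1\<bar> \<le> \<epsilon>" "1 / 2 \<le> 1 + p $ 1 * k (p $ 2)" "1 + p $ 1 * k (p $ 2) \<le> 2"
  using assms jac[of "p $ 2" "p $ 1"] by (auto simp: strip_def)

lemma norm_W:
  assumes "p \<in> strip c \<epsilon>"
  shows "1 / (2 * N) \<le> norm (W p)" "norm (W p) \<le> 2 * N"
proof -
  note d = stripD[OF assms]
  have n: "norm (W p) = (1 + p $ 1 * k (p $ 2)) * norm (u (p $ 2))" using d by (simp add: W_def)
  have "(1 / 2) * (1 / N) \<le> norm (W p)" unfolding n using d bounds[OF d(1)] N by (intro mult_mono) auto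
  then show "1 / (2 * N) \<le> norm (W p)" by simp
  show "norm (W p) \<le> 2 * N" unfolding n using d bounds[OF d(1)] N by (intro mult_mono) auto
qed

text \<open>The unit normal is orthogonal to \<open>W p\<close>, so
  \<open>(norm (E p h))\<^sup>2\<close> is
  \<open>(h $ 1)\<^sup>2 + (h $ 2)\<^sup>2 * (norm (W p))\<^sup>2\<close>, and
  \<open>norm (W p)\<close> lies between \<open>1 / (2 * N)\<close> and
  \<open>2 * N\<close>.\<close>

lemma norm_E:
  assumes "p \<in> strip c \<epsilon>"
  shows "norm h / (2 * N) \<le> norm (E p h)" "norm (E p h) \<le> 2 * N * norm h"
proof -
  note d = stripD[OF assms]
  have e: "(norm (E p h))\<^sup>2 = (h $ 1)\<^sup>2 + (h $ 2)\<^sup>2 * (norm (W p))\<^sup>2"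
  proof -
    have aw: "normal c (p $ 2) \<bullet> W p = 0" using normal_ortho[OF d(1)] by (simp add: W_def)
    then have "W p \<bullet> normal c (p $ 2) = 0" by (simp add: inner_commute)
    then show ?thesis
      unfolding power2_norm_eq_inner E_def using aw normal_unit[OF d(1)]
      by (simp add: inner_add_left inner_add_right power2_eq_square)
  qed
  have h: "(norm h)\<^sup>2 = (h $ 1)\<^sup>2 + (h $ 2)\<^sup>2" unfolding power2_norm_eq_inner inner_vec2 by (simp add: power2_eq_square)
  have N2: "1 \<le> N\<^sup>2" using N by simp
  have W2: "(1 / (2 * N))\<^sup>2 \<le> (norm (W p))\<^sup>2" "(norm (W p))\<^sup>2 \<le> (2 * N)\<^sup>2"
    using power_mono[OF norm_W(1)[OF assms], of 2] power_mono[OF norm_W(2)[OF assms] norm_ge_zero, of 2] N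
    by auto
  show "norm h / (2 * N) \<le> norm (E p h)"
  proof (rule power2_le_imp_le)
    have "(h $ 1)\<^sup>2 * (1 / (2 * N))\<^sup>2 \<le> (h $ 1)\<^sup>2 * 1"
      using N by (intro mult_left_mono power_le_one) auto
    moreover have "(h $ 2)\<^sup>2 * (1 / (2 * N))\<^sup>2 \<le> (h $ 2)\<^sup>2 * (norm (W p))\<^sup>2"
      using W2 by (intro mult_left_mono) auto
    moreover have "(norm h / (2 * N))\<^sup>2 = (h $ 1)\<^sup>2 * (1 / (2 * N))\<^sup>2 + (h $ 2)\<^sup>2 * (1 / (2 * N))\<^sup>2"
      using h by (simp add: power_divide add_divide_distrib)
    ultimately show "(norm h / (2 * N))\<^sup>2 \<le> (norm (E p h))\<^sup>2" unfolding e by linarith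
  qed simp
  show "norm (E p h) \<le> 2 * N * norm h"
  proof (rule power2_le_imp_le)
    have "(h $ 1)\<^sup>2 * 1 \<le> (h $ 1)\<^sup>2 * (2 * N)\<^sup>2"
      using N2 by (intro mult_left_mono) (auto simp: power_mult_distrib)
    moreover have "(h $ 2)\<^sup>2 * (norm (W p))\<^sup>2 \<le> (h $ 2)\<^sup>2 * (2 * N)\<^sup>2"
      using W2 by (intro mult_left_mono) auto
    moreover have "(2 * N * norm h)\<^sup>2 = (h $ 1)\<^sup>2 * (2 * N)\<^sup>2 + (h $ 2)\<^sup>2 * (2 * N)\<^sup>2"
      using h by (simp add: power_mult_distrib algebra_simps)
    ultimately show "(norm (E p h))\<^sup>2 \<le> (2 * N * norm h)\<^sup>2" unfolding e by linarith
  qed (use N in simp)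
qed

lemma within_strip_compose:
  assumes "(f has_vector_derivative f') (at (p $ 2) within pdom c)" "p \<in> strip c \<epsilon>"
  shows "((\<lambda>p. f (p $ 2)) has_derivative (\<lambda>h. h $ 2 *\<^sub>R f')) (at p within strip c \<epsilon>)"
  by (rule has_derivative_in_compose[where f = "\<lambda>p. p $ 2"])
    (auto simp: strip_def intro!: bounded_linear.has_derivative[OF bounded_linear_vec_nth]
      has_derivative_subset[OF assms(1)[unfolded has_vector_derivative_def]])

lemma frenet_derivative:
  assumes p: "p \<in> strip c \<epsilon>"
  shows "(frenet c has_derivative E p) (at p within strip c \<epsilon>)"
proof -
  note t = stripD(1)[OF p]
  have "((\<lambda>p. par c (p $ 2) + p $ 1 *\<^sub>R normal c (p $ 2)) has_derivative
     (\<lambda>h. h $ 2 *\<^sub>R u (p $ 2) + (p $ 1 *\<^sub>R h $ 2 *\<^sub>R k (p $ 2) *\<^sub>R u (p $ 2) + h $ 1 *\<^sub>R normal c (p $ 2)))) (at p within strip c \<epsilon>)"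
    by (intro has_derivative_add has_derivative_scaleR within_strip_compose par_deriv normal_deriv t p
      bounded_linear.has_derivative[OF bounded_linear_vec_nth] has_derivative_ident)
  then show ?thesis
    unfolding frenet_def[abs_def] by (rule has_derivative_eq_rhs) (auto simp: E_def W_def algebra_simps)
qed

lemma frenet_continuous: "continuous_on (strip c \<epsilon>) (frenet c)"
  using frenet_derivative has_derivative_continuous continuous_on_eq_continuous_within by blast

lemma frenet_lipschitz:
  assumes "p \<in> strip c \<epsilon>" "q \<in> strip c \<epsilon>"
  shows "norm (frenet c p - frenet c q) \<le> 2 * N * norm (p - q)"
  by (rule differentiable_bound[OF convex_strip frenet_derivative])
    (use assms norm_E(2) in \<open>auto intro!: onorm_le\<close>)

text \<open>Lipschitz constant of \<open>E\<close>: \<open>N\<^sup>2\<close> comes from the normal,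
  \<open>N\<close> from \<open>u\<close>, \<open>2 * N\<^sup>2 * \<epsilon>\<close> from the
  variation of \<open>k\<close> times \<open>u\<close> at a normal coordinate of size at most
  \<open>\<epsilon>\<close>, and the last \<open>N\<^sup>2\<close> from the variation of that
  coordinate.\<close>

definition M :: real where "M = N\<^sup>2 + N + 2 * N\<^sup>2 * \<epsilon> + N\<^sup>2"

lemma E_lipschitz:
  assumes p: "p \<in> strip c \<epsilon>" and q: "q \<in> strip c \<epsilon>"
  shows "norm (E p h - E q h) \<le> M * norm (p - q) * norm h"
proof -
  note dp = stripD[OF p] and dq = stripD[OF q]
  have c1: "\<bar>p $ i - q $ i\<bar> \<le> norm (p - q)" for i
    using component_le_norm_cart[of "p - q" i] by simp
  have "norm (normal c (p $ 2) - normal c (q $ 2)) \<le> N\<^sup>2 * \<bar>p $ 2 - q $ 2\<bar>"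
  proof (rule vector_derivative_lipschitz[OF convex_pdom normal_deriv])
    show "norm (k t *\<^sub>R u t) \<le> N\<^sup>2" if "t \<in> pdom c" for t
      using bounds[OF that] N by (auto simp: power2_eq_square intro!: mult_mono)
  qed (use dp dq in auto)
  then have n: "norm (normal c (p $ 2) - normal c (q $ 2)) \<le> N\<^sup>2 * norm (p - q)"
    using mult_left_mono[OF c1[of 2], of "N\<^sup>2"] by simp
  have "norm (u (p $ 2) - u (q $ 2)) \<le> N * \<bar>p $ 2 - q $ 2\<bar>"
    by (rule vector_derivative_lipschitz[OF convex_pdom u_deriv]) (use bounds dp dq in auto)
  then have u: "norm (u (p $ 2) - u (q $ 2)) \<le> N * norm (p - q)"
    using mult_left_mono[OF c1[of 2] order.trans[OF zero_le_one N]] by linarith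
  have "norm (k (p $ 2) *\<^sub>R u (p $ 2) - k (q $ 2) *\<^sub>R u (q $ 2)) \<le> (2 * N\<^sup>2) * \<bar>p $ 2 - q $ 2\<bar>"
  proof (rule vector_derivative_lipschitz[OF convex_pdom has_vector_derivative_scaleR[OF k_deriv u_deriv]])
    fix t assume t: "t \<in> pdom c"
    have "norm (k t *\<^sub>R u1 t) \<le> N * N" "norm (k1 t *\<^sub>R u t) \<le> N * N"
      using bounds[OF t] N by (auto intro!: mult_mono)
    then show "norm (k t *\<^sub>R u1 t + k1 t *\<^sub>R u t) \<le> 2 * N\<^sup>2"
      using norm_triangle_ineq[of "k t *\<^sub>R u1 t" "k1 t *\<^sub>R u t"] by (simp add: power2_eq_square)
  qed (use dp dq in auto)
  then have ku: "norm (k (p $ 2) *\<^sub>R u (p $ 2) - k (q $ 2) *\<^sub>R u (q $ 2)) \<le> 2 * N\<^sup>2 * norm (p - q)"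
    using mult_left_mono[OF c1[of 2], of "2 * N\<^sup>2"] by simp
  have "W p - W q = (u (p $ 2) - u (q $ 2)) + p $ 1 *\<^sub>R (k (p $ 2) *\<^sub>R u (p $ 2) - k (q $ 2) *\<^sub>R u (q $ 2))
      + (p $ 1 - q $ 1) *\<^sub>R (k (q $ 2) *\<^sub>R u (q $ 2))"
    by (simp add: W_def algebra_simps)
  moreover have "norm (p $ 1 *\<^sub>R (k (p $ 2) *\<^sub>R u (p $ 2) - k (q $ 2) *\<^sub>R u (q $ 2))) \<le> \<epsilon> * (2 * N\<^sup>2 * norm (p - q))"
    unfolding norm_scaleR using dp(2) ku eps by (intro mult_mono) auto
  moreover have "norm ((p $ 1 - q $ 1) *\<^sub>R (k (q $ 2) *\<^sub>R u (q $ 2))) \<le> norm (p - q) * (N * N)"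
    unfolding norm_scaleR using bounds[OF dq(1)] N by (intro mult_mono c1) auto
  ultimately have "norm (W p - W q) \<le> N * norm (p - q) + \<epsilon> * (2 * N\<^sup>2 * norm (p - q)) + norm (p - q) * (N * N)"
    using u by (metis (no_types, lifting) add_mono norm_triangle_le)
  then have w: "norm (W p - W q) \<le> (N + 2 * N\<^sup>2 * \<epsilon> + N\<^sup>2) * norm (p - q)"
    by (simp add: algebra_simps power2_eq_square)
  have "E p h - E q h = h $ 1 *\<^sub>R (normal c (p $ 2) - normal c (q $ 2)) + h $ 2 *\<^sub>R (W p - W q)"
    by (simp add: E_def algebra_simps)
  moreover have "norm (h $ 1 *\<^sub>R (normal c (p $ 2) - normal c (q $ 2))) \<le> norm h * (N\<^sup>2 * norm (p - q))"
    unfolding norm_scaleR using n component_le_norm_cart[of h 1] by (intro mult_mono) auto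
  moreover have "norm (h $ 2 *\<^sub>R (W p - W q)) \<le> norm h * ((N + 2 * N\<^sup>2 * \<epsilon> + N\<^sup>2) * norm (p - q))"
    unfolding norm_scaleR using w component_le_norm_cart[of h 2] by (intro mult_mono) auto
  ultimately have "norm (E p h - E q h) \<le> norm h * (N\<^sup>2 * norm (p - q)) + norm h * ((N + 2 * N\<^sup>2 * \<epsilon> + N\<^sup>2) * norm (p - q))"
    by (metis add_mono norm_triangle_le)
  then show ?thesis by (simp add: M_def algebra_simps)
qed

lemma M_pos: "0 < M"
  using N eps by (simp add: M_def add_pos_pos)

text \<open>Linearisation at \<open>q\<close> has an error of at most \<open>M\<close> times the
  squared distance, which below the threshold is at most \<open>norm (p - q) / (4 * N)\<close>. That
  is half of the lower bound for the linear part \<open>E q (p - q)\<close>, so the other half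
  survives.\<close>

lemma frenet_expanding:
  assumes p: "p \<in> strip c \<epsilon>" and q: "q \<in> strip c \<epsilon>" and near: "norm (p - q) \<le> 1 / (4 * N * M)"
  shows "norm (p - q) \<le> 4 * N * norm (frenet c p - frenet c q)"
proof -
  have seg: "closed_segment q p \<subseteq> strip c \<epsilon>" using p q convex_strip by (simp add: closed_segment_subset)
  have "norm (frenet c p - frenet c q - E q (p - q)) \<le> norm (p - q) * (M * norm (p - q))"
  proof (rule differentiable_bound_linearization[where S = "closed_segment q p" and f' = E and ?x0.0 = q])
    show "q + t *\<^sub>R (p - q) \<in> closed_segment q p" if "t \<in> {0..1}" for t
      using that by (auto simp: in_segment algebra_simps intro!: exI[of _ t])
    show "(frenet c has_derivative E x) (at x within closed_segment q p)" if "x \<in> closed_segment q p" for x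
      using frenet_derivative[of x] that seg by (meson has_derivative_subset subsetD)
    show "onorm (E x - E q) \<le> M * norm (p - q)" if x: "x \<in> closed_segment q p" for x
    proof (rule onorm_le)
      fix h
      have "norm ((E x - E q) h) \<le> M * norm (x - q) * norm h"
        using E_lipschitz[of x q h] x seg q by auto
      also have "\<dots> \<le> M * norm (p - q) * norm h"
        using segment_bound(1)[OF x] M_pos by (intro mult_right_mono mult_left_mono) (auto simp: norm_minus_commute)
      finally show "norm ((E x - E q) h) \<le> M * norm (p - q) * norm h" .
    qed
  qed simp
  moreover have "norm (p - q) / (2 * N) \<le> norm (E q (p - q))" by (rule norm_E(1)[OF q])
  moreover have "norm (E q (p - q)) \<le> norm (frenet c p - frenet c q) + norm (frenet c p - frenet c q - E q (p - q))"
    by (metis add.commute diff_add_cancel norm_minus_commute norm_triangle_sub)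
  moreover have "norm (p - q) * (M * norm (p - q)) \<le> norm (p - q) / (4 * N)"
  proof -
    have "M * norm (p - q) \<le> 1 / (4 * N)" using mult_left_mono[OF near, of M] M_pos by simp
    then show ?thesis using mult_left_mono[of "M * norm (p - q)" "1 / (4 * N)" "norm (p - q)"] by simp
  qed
  moreover have "norm (p - q) / (2 * N) = norm (p - q) / (4 * N) + norm (p - q) / (4 * N)" by simp
  ultimately have "norm (p - q) / (4 * N) \<le> norm (frenet c p - frenet c q)" by linarith
  then show ?thesis using N by (simp add: field_simps)
qed

text \<open>
  On a small element the branch cannot leave the neighbourhood on which the Frenet map is
  expanding: by connectedness it would have to cross the boundary of that neighbourhood.
\<close>

lemma branch_lipschitz:
  assumes br: "frenet_branch c \<epsilon> K R" and K: "connected K"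
    and small: "\<And>x y. x \<in> K \<Longrightarrow> y \<in> K \<Longrightarrow> 4 * N * dist x y < 1 / (4 * N * M)"
    and xy: "x \<in> K" "y \<in> K"
  shows "dist (R x) (R y) \<le> 4 * N * dist x y"
proof -
  let ?d = "1 / (4 * N * M)"
  have R: "continuous_on K R" "\<And>x. x \<in> K \<Longrightarrow> R x \<in> strip c \<epsilon>" "\<And>x. x \<in> K \<Longrightarrow> frenet c (R x) = x"
    using br by (auto simp: frenet_branch_def)
  have exp: "dist (R x) (R z) \<le> 4 * N * dist x z" if "z \<in> K" "dist (R x) (R z) \<le> ?d" for z
    using frenet_expanding[of "R x" "R z"] R xy that by (simp add: dist_norm)
  have "dist (R x) (R y) \<le> ?d"
  proof (rule ccontr)
    assume far: "\<not> dist (R x) (R y) \<le> ?d"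
    have "connected ((\<lambda>z. dist (R x) (R z)) ` K)"
      by (intro connected_continuous_image K continuous_intros R)
    moreover have "0 \<in> (\<lambda>z. dist (R x) (R z)) ` K" using xy by (auto intro!: image_eqI[of _ _ x])
    moreover have "dist (R x) (R y) \<in> (\<lambda>z. dist (R x) (R z)) ` K" using xy by auto
    moreover have "0 \<le> ?d" using N M_pos by simp
    ultimately have "?d \<in> (\<lambda>z. dist (R x) (R z)) ` K"
      using far connectedD_interval[of "(\<lambda>z. dist (R x) (R z)) ` K" 0 "dist (R x) (R y)" ?d] by auto
    then obtain z where z: "z \<in> K" "dist (R x) (R z) = ?d" by auto
    then show False using exp[of z] small[OF xy(1) z(1)] by simp
  qed
  then show ?thesis using exp xy by blast
qed

text \<open>\<open>R\<close> is continuous and has the left inverse \<open>frenet c\<close>, so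
  invariance of domain applies. Openness puts the image of an open set into the interior of the
  strip, where derivatives within the strip are derivatives in the full sense.\<close>

lemma branch_open_image:
  assumes br: "frenet_branch c \<epsilon> K R" and U: "open U" "U \<subseteq> K"
  shows "open (R ` U)"
proof (rule invariance_of_domain[OF _ U(1)])
  show "continuous_on U R" using br U continuous_on_subset by (auto simp: frenet_branch_def)
  show "inj_on R U" using br U by (intro inj_on_inverseI[where g = "frenet c"]) (auto simp: frenet_branch_def)
qed

text \<open>
  The image of a ball is open; its boundary points in the smaller ball would be mapped by the
  Frenet map, which is Lipschitz, back into the original ball.
\<close>

lemma branch_covers:
  assumes br: "frenet_branch c \<epsilon> K R" and sub: "ball x0 s \<subseteq> K" and s: "0 < s"
  shows "ball (R x0) (s / (2 * N)) \<subseteq> R ` ball x0 s"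
proof (rule ccontr)
  let ?V = "R ` ball x0 s" and ?B = "ball (R x0) (s / (2 * N))"
  assume not: "\<not> ?B \<subseteq> ?V"
  have R: "continuous_on K R" "\<And>x. x \<in> K \<Longrightarrow> R x \<in> strip c \<epsilon>" "\<And>x. x \<in> K \<Longrightarrow> frenet c (R x) = x"
    using br by (auto simp: frenet_branch_def)
  have x0: "x0 \<in> ball x0 s" using s by simp
  then have x0K: "x0 \<in> K" using sub by blast
  have opV: "open ?V" by (rule branch_open_image[OF br open_ball sub])
  have "R x0 \<in> ?B" using s N by simp
  then have "?B \<inter> ?V \<noteq> {}" using x0 by blast
  then have "?B \<inter> frontier ?V \<noteq> {}"
    using not by (intro connected_Int_frontier) auto
  then obtain y where y: "y \<in> ?B" "y \<in> closure ?V" "y \<notin> ?V"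
    using opV by (auto simp: frontier_def interior_open)
  obtain f where f: "\<And>n. f n \<in> ?V" "f \<longlonglongrightarrow> y"
    using y(2) closure_sequential by blast
  have "\<forall>n. \<exists>x\<in>ball x0 s. f n = R x" using f(1) by blast
  then obtain g where g: "\<And>n. g n \<in> ball x0 s" "\<And>n. f n = R (g n)" by metis
  have gK: "g n \<in> K" for n using g(1) sub by blast
  have fS: "f n \<in> strip c \<epsilon>" for n using g(2) R(2)[OF gK] by simp
  then have yS: "y \<in> strip c \<epsilon>" using closed_sequentially[OF closed_strip] f(2) by blast
  have "(\<lambda>n. frenet c (f n)) \<longlonglongrightarrow> frenet c y"
    by (rule continuous_on_tendsto_compose[OF frenet_continuous f(2) yS]) (use fS in auto)
  moreover have "frenet c (f n) = g n" for n using g(2) R(3)[OF gK] by simp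
  ultimately have lim: "g \<longlonglongrightarrow> frenet c y" by simp
  have "norm (frenet c y - frenet c (R x0)) \<le> 2 * N * norm (y - R x0)"
    by (rule frenet_lipschitz[OF yS R(2)[OF x0K]])
  also have "\<dots> < 2 * N * (s / (2 * N))"
    using y(1) N by (intro mult_strict_left_mono) (auto simp: dist_norm norm_minus_commute)
  also have "\<dots> = s" using N by simp
  finally have b: "frenet c y \<in> ball x0 s" using R(3)[OF x0K] by (auto simp: dist_norm norm_minus_commute)
  \<comment> \<open>\<open>frenet_branch\<close> gives \<open>R (frenet c y) = y\<close> only for
    values of \<open>R\<close>, and \<open>y\<close> is not known to be one. The equation is
    obtained as the limit of \<open>R (g n) = f n\<close>, using continuity of \<open>R\<close> at
    the point \<open>frenet c y\<close> of the ball.\<close>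
  have "continuous_on (ball x0 s) R" using R(1) sub continuous_on_subset by blast
  then have "(\<lambda>n. R (g n)) \<longlonglongrightarrow> R (frenet c y)"
    by (rule continuous_on_tendsto_compose[OF _ lim b]) (use g in auto)
  moreover have "(\<lambda>n. R (g n)) = f" using g(2) by auto
  ultimately have "f \<longlonglongrightarrow> R (frenet c y)" by simp
  then have "y = R (frenet c y)" using f(2) LIMSEQ_unique by blast
  then show False using y(3) b by blast
qed

section \<open>Jacobian of the inverse Frenet map\<close>

definition w :: "plane \<Rightarrow> real" where
  "w y = (1 + y $ 1 * k (y $ 2)) * (u (y $ 2) \<bullet> u (y $ 2))"

text \<open>The derivative in direction \<open>i\<close> of the \<open>j\<close>-th Frenet
  coordinate. As the normal and \<open>u\<close> are orthogonal, the normal coordinate has gradient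
  \<open>normal c\<close> and the tangential one \<open>W / (norm W)\<^sup>2\<close>, which is
  \<open>u / w\<close>.\<close>

definition A :: "2 \<Rightarrow> 2 \<Rightarrow> plane \<Rightarrow> real" where
  "A i j y = (if j = 1 then normal c (y $ 2) $ i else u (y $ 2) $ i / w y)"

definition DA :: "2 \<Rightarrow> 2 \<Rightarrow> 2 \<Rightarrow> plane \<Rightarrow> real" where
  "DA i j l y =
    (if j = 1 then (if l = 1 then 0 else k (y $ 2) * u (y $ 2) $ i)
     else if l = 1 then - (u (y $ 2) $ i * (k (y $ 2) * (u (y $ 2) \<bullet> u (y $ 2)))) / (w y)\<^sup>2
     else (u1 (y $ 2) $ i * w y - u (y $ 2) $ i * (y $ 1 * k1 (y $ 2) * (u (y $ 2) \<bullet> u (y $ 2))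
        + (1 + y $ 1 * k (y $ 2)) * (2 * (u (y $ 2) \<bullet> u1 (y $ 2))))) / (w y)\<^sup>2)"

lemma w_bounds:
  assumes "y \<in> strip c \<epsilon>"
  shows "1 / (2 * N\<^sup>2) \<le> w y" "w y \<le> 2 * N\<^sup>2" "0 < w y" "inverse (w y) \<le> 2 * N\<^sup>2"
proof -
  note d = stripD[OF assms]
  have w: "w y = (1 + y $ 1 * k (y $ 2)) * (norm (u (y $ 2)))\<^sup>2" by (simp add: w_def power2_norm_eq_inner)
  have "(1 / N)\<^sup>2 \<le> (norm (u (y $ 2)))\<^sup>2" "(norm (u (y $ 2)))\<^sup>2 \<le> N\<^sup>2"
    using bounds[OF d(1)] N by (auto intro!: power_mono)
  then have lo': "1 / 2 * (1 / N)\<^sup>2 \<le> w y" and le: "w y \<le> 2 * N\<^sup>2"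
    unfolding w by (intro mult_mono; use d in simp)+
  then show lo: "1 / (2 * N\<^sup>2) \<le> w y" by (simp add: power_divide)
  show "w y \<le> 2 * N\<^sup>2" by (rule le)
  have p: "0 < 1 / (2 * N\<^sup>2)" using N by simp
  then show "0 < w y" using lo by linarith
  show "inverse (w y) \<le> 2 * N\<^sup>2" using le_imp_inverse_le[OF lo p] by simp
qed

lemma component_strip_derivative:
  assumes "(f has_vector_derivative f') (at (p $ 2) within pdom c)" "p \<in> strip c \<epsilon>"
  shows "((\<lambda>p. (f (p $ 2) :: plane) $ i) has_derivative (\<lambda>h. h $ 2 * f' $ i)) (at p within strip c \<epsilon>)"
  using bounded_linear.has_derivative[OF bounded_linear_vec_nth within_strip_compose[OF assms]] by simp

lemma w_derivative:
  assumes p: "p \<in> strip c \<epsilon>"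
  shows "(w has_derivative (\<lambda>h. h $ 1 * (k (p $ 2) * (u (p $ 2) \<bullet> u (p $ 2))) +
    h $ 2 * (p $ 1 * k1 (p $ 2) * (u (p $ 2) \<bullet> u (p $ 2)) + (1 + p $ 1 * k (p $ 2)) * (2 * (u (p $ 2) \<bullet> u1 (p $ 2))))))
    (at p within strip c \<epsilon>)"
proof -
  note t = stripD(1)[OF p]
  have dk: "((\<lambda>p. k (p $ 2)) has_derivative (\<lambda>h. h $ 2 *\<^sub>R k1 (p $ 2))) (at p within strip c \<epsilon>)"
    by (rule within_strip_compose[OF _ p])
      (use k_deriv[OF t] in \<open>simp add: has_real_derivative_iff_has_vector_derivative\<close>)
  have du: "((\<lambda>p. u (p $ 2)) has_derivative (\<lambda>h. h $ 2 *\<^sub>R u1 (p $ 2))) (at p within strip c \<epsilon>)"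
    by (rule within_strip_compose[OF u_deriv[OF t] p])
  have "((\<lambda>p. (1 + p $ 1 * k (p $ 2)) * (u (p $ 2) \<bullet> u (p $ 2))) has_derivative
     (\<lambda>h. (1 + p $ 1 * k (p $ 2)) * (u (p $ 2) \<bullet> (h $ 2 *\<^sub>R u1 (p $ 2)) + (h $ 2 *\<^sub>R u1 (p $ 2)) \<bullet> u (p $ 2)) +
       (0 + (p $ 1 * (h $ 2 *\<^sub>R k1 (p $ 2)) + h $ 1 * k (p $ 2))) * (u (p $ 2) \<bullet> u (p $ 2)))) (at p within strip c \<epsilon>)"
    by (intro has_derivative_mult has_derivative_inner has_derivative_add has_derivative_const dk du
      bounded_linear.has_derivative[OF bounded_linear_vec_nth] has_derivative_ident)
  then show ?thesis
    unfolding w_def[abs_def] by (rule has_derivative_eq_rhs) (auto simp: inner_commute algebra_simps)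
qed

lemma A_derivative:
  assumes p: "p \<in> strip c \<epsilon>"
  shows "(A i j has_derivative (\<lambda>h. \<Sum>l\<in>UNIV. h $ l * DA i j l p)) (at p within strip c \<epsilon>)"
proof (cases "j = 1")
  case True
  have "((\<lambda>p. normal c (p $ 2) $ i) has_derivative (\<lambda>h. h $ 2 * (k (p $ 2) *\<^sub>R u (p $ 2)) $ i)) (at p within strip c \<epsilon>)"
    by (rule component_strip_derivative[OF normal_deriv[OF stripD(1)[OF p]] p])
  then show ?thesis using True unfolding A_def[abs_def] DA_def sum_2 by simp
next
  case False
  have "((\<lambda>p. u (p $ 2) $ i / w p) has_derivative (\<lambda>h. \<Sum>l\<in>UNIV. h $ l * DA i j l p)) (at p within strip c \<epsilon>)"
  proof -
    have nz: "w p \<noteq> 0" using w_bounds(3)[OF p] by simp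
    show ?thesis
      by (rule has_derivative_eq_rhs[OF has_derivative_divide'[OF component_strip_derivative[OF u_deriv[OF stripD(1)[OF p]] p]
          w_derivative[OF p] nz]])
        (use False nz in \<open>auto simp: DA_def sum_2 fun_eq_iff field_simps power2_eq_square\<close>)
  qed
  then show ?thesis using False unfolding A_def[abs_def] by simp
qed

lemma DA_continuous: "continuous_on (strip c \<epsilon>) (DA i j l)"
proof -
  have comp: "continuous_on (strip c \<epsilon>) (\<lambda>p. f (p $ 2))" if "continuous_on (pdom c) f" for f :: "real \<Rightarrow> 'b::topological_space"
    by (rule continuous_on_compose2[OF that]) (auto simp: strip_def intro!: continuous_intros)
  have "continuous_on (pdom c) u" "continuous_on (pdom c) k"
    using u_deriv k_deriv by (meson continuous_on_eq_continuous_within has_vector_derivative_continuous DERIV_continuous)+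
  note c = comp[OF this(1)] comp[OF this(2)] comp[OF u1_cont] comp[OF k1_cont]
  have cw: "continuous_on (strip c \<epsilon>) w"
    unfolding w_def[abs_def] by (intro continuous_intros c)
  show ?thesis
    unfolding DA_def[abs_def]
    by (cases "j = 1"; cases "l = 1") (auto intro!: continuous_intros c cw dest: w_bounds(3))
qed

text \<open>The sum of the separate bounds: \<open>2 * N ^ 3\<close> for the entries
  \<open>u / w\<close>, \<open>4 * N ^ 8\<close> for their normal derivatives, the long summand for
  their tangential derivatives, and \<open>4 * N\<^sup>2\<close> for the squared norm of
  \<open>W\<close> in the ellipticity.\<close>

definition B :: real where
  "B = 2 * N ^ 3 + 4 * N ^ 8 + (2 * N ^ 3 + N * (\<epsilon> * N ^ 3 + 4 * N\<^sup>2)) * (4 * N ^ 4) + 4 * N\<^sup>2"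

lemma B_ge: "1 \<le> B" "2 * N ^ 3 \<le> B" "4 * N ^ 8 \<le> B"
  "(2 * N ^ 3 + N * (\<epsilon> * N ^ 3 + 4 * N\<^sup>2)) * (4 * N ^ 4) \<le> B" "4 * N\<^sup>2 \<le> B" "N\<^sup>2 \<le> B"
proof -
  have n: "0 \<le> 2 * N ^ 3" "0 \<le> 4 * N ^ 8" "0 \<le> (2 * N ^ 3 + N * (\<epsilon> * N ^ 3 + 4 * N\<^sup>2)) * (4 * N ^ 4)" "1 \<le> N\<^sup>2"
    using N eps by auto
  then show "1 \<le> B" "2 * N ^ 3 \<le> B" "4 * N ^ 8 \<le> B"
    "(2 * N ^ 3 + N * (\<epsilon> * N ^ 3 + 4 * N\<^sup>2)) * (4 * N ^ 4) \<le> B" "4 * N\<^sup>2 \<le> B" "N\<^sup>2 \<le> B"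
    unfolding B_def by linarith+
qed

lemma component_bounds:
  assumes "y \<in> strip c \<epsilon>"
  shows "\<bar>u (y $ 2) $ i\<bar> \<le> N" "\<bar>u1 (y $ 2) $ i\<bar> \<le> N" "u (y $ 2) \<bullet> u (y $ 2) \<le> N\<^sup>2" "\<bar>u (y $ 2) \<bullet> u1 (y $ 2)\<bar> \<le> N\<^sup>2"
proof -
  note b = bounds[OF stripD(1)[OF assms]]
  show "\<bar>u (y $ 2) $ i\<bar> \<le> N" "\<bar>u1 (y $ 2) $ i\<bar> \<le> N"
    using b order.trans[OF component_le_norm_cart] by blast+
  show "u (y $ 2) \<bullet> u (y $ 2) \<le> N\<^sup>2" using b by (simp add: dot_square_norm power_mono)
  have "norm (u (y $ 2)) * norm (u1 (y $ 2)) \<le> N\<^sup>2"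
    unfolding power2_eq_square using b N by (intro mult_mono) auto
  then show "\<bar>u (y $ 2) \<bullet> u1 (y $ 2)\<bar> \<le> N\<^sup>2" using Cauchy_Schwarz_ineq2 order.trans by blast
qed

lemma A_bound:
  assumes "y \<in> strip c \<epsilon>"
  shows "\<bar>A i j y\<bar> \<le> B"
proof (cases "j = 1")
  case True
  have "norm (normal c (y $ 2)) = 1"
    using normal_unit[OF stripD(1)[OF assms]] by (simp add: norm_eq_1)
  then show ?thesis using True component_le_norm_cart[of "normal c (y $ 2)" i] B_ge(1) by (simp add: A_def)
next
  case False
  have "\<bar>u (y $ 2) $ i\<bar> * inverse (w y) \<le> N * (2 * N\<^sup>2)"
    using component_bounds(1)[OF assms] w_bounds[OF assms] N by (intro mult_mono) auto
  then have "\<bar>u (y $ 2) $ i / w y\<bar> \<le> 2 * N ^ 3"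
    using w_bounds(3)[OF assms] by (simp add: abs_mult divide_inverse power2_eq_square power3_eq_cube mult_ac)
  then show ?thesis using False B_ge(2) by (simp add: A_def)
qed

lemma DA_bound:
  assumes y: "y \<in> strip c \<epsilon>"
  shows "\<bar>DA i j l y\<bar> \<le> B"
proof -
  note d = stripD[OF y] and b = bounds[OF stripD(1)[OF y]] and cb = component_bounds[OF y] and wb = w_bounds[OF y]
  have w2: "inverse ((w y)\<^sup>2) \<le> 4 * N ^ 4"
    using power_mono[OF wb(4), of 2] wb(3) by (simp add: power_inverse power_mult_distrib flip: power_mult)
  have div: "\<bar>x / (w y)\<^sup>2\<bar> \<le> X * (4 * N ^ 4)" if "\<bar>x\<bar> \<le> X" for x X
    unfolding divide_inverse abs_mult using that w2 by (intro mult_mono) auto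
  consider "j = 1" "l = 1" | "j = 1" "l \<noteq> 1" | "j \<noteq> 1" "l = 1" | "j \<noteq> 1" "l \<noteq> 1" by blast
  then show ?thesis
  proof cases
    case 1 then show ?thesis using B_ge(1) by (simp add: DA_def)
  next
    case 2
    have "\<bar>k (y $ 2) * u (y $ 2) $ i\<bar> \<le> N\<^sup>2"
      unfolding abs_mult power2_eq_square using b cb N by (intro mult_mono) auto
    then show ?thesis using 2 B_ge(6) by (simp add: DA_def)
  next
    case 3
    have "\<bar>u (y $ 2) $ i * (k (y $ 2) * (u (y $ 2) \<bullet> u (y $ 2)))\<bar> \<le> N * (N * N\<^sup>2)"
      unfolding abs_mult using b cb N by (intro mult_mono) auto
    then have "\<bar>- (u (y $ 2) $ i * (k (y $ 2) * (u (y $ 2) \<bullet> u (y $ 2)))) / (w y)\<^sup>2\<bar> \<le> N * (N * N\<^sup>2) * (4 * N ^ 4)"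
      by (intro div) simp
    also have "\<dots> = 4 * N ^ 8" by (simp add: eval_nat_numeral)
    finally show ?thesis using 3 B_ge(3) by (simp add: DA_def)
  next
    case 4
    have 1: "\<bar>u1 (y $ 2) $ i * w y\<bar> \<le> N * (2 * N\<^sup>2)"
      unfolding abs_mult using cb wb N by (intro mult_mono) auto
    have 2: "\<bar>y $ 1 * k1 (y $ 2) * (u (y $ 2) \<bullet> u (y $ 2))\<bar> \<le> \<epsilon> * N * N\<^sup>2"
      unfolding abs_mult using d b cb N eps by (intro mult_mono) auto
    have 3: "\<bar>(1 + y $ 1 * k (y $ 2)) * (2 * (u (y $ 2) \<bullet> u1 (y $ 2)))\<bar> \<le> 2 * (2 * N\<^sup>2)"
      unfolding abs_mult using d cb by (intro mult_mono) auto
    have 5: "\<bar>u (y $ 2) $ i * (y $ 1 * k1 (y $ 2) * (u (y $ 2) \<bullet> u (y $ 2)) + (1 + y $ 1 * k (y $ 2)) * (2 * (u (y $ 2) \<bullet> u1 (y $ 2))))\<bar>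
       \<le> N * (\<epsilon> * N * N\<^sup>2 + 2 * (2 * N\<^sup>2))"
      unfolding abs_mult using cb 2 3 N by (intro mult_mono order.trans[OF abs_triangle_ineq] add_mono) (auto simp flip: abs_mult)
    have "\<bar>(u1 (y $ 2) $ i * w y - u (y $ 2) $ i * (y $ 1 * k1 (y $ 2) * (u (y $ 2) \<bullet> u (y $ 2))
        + (1 + y $ 1 * k (y $ 2)) * (2 * (u (y $ 2) \<bullet> u1 (y $ 2))))) / (w y)\<^sup>2\<bar>
      \<le> (N * (2 * N\<^sup>2) + N * (\<epsilon> * N * N\<^sup>2 + 2 * (2 * N\<^sup>2))) * (4 * N ^ 4)"
      using 1 5 by (intro div order.trans[OF abs_triangle_ineq4] add_mono)
    also have "\<dots> = (2 * N ^ 3 + N * (\<epsilon> * N ^ 3 + 4 * N\<^sup>2)) * (4 * N ^ 4)"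
      by (simp add: power3_eq_cube power2_eq_square)
    finally show ?thesis using 4 B_ge(4) by (simp add: DA_def)
  qed
qed

text \<open>The columns of the Jacobian are orthogonal, so the sum on the right is
  \<open>(z 1)\<^sup>2 + (z 2)\<^sup>2 / (norm (W y))\<^sup>2\<close>; \<open>B\<close> makes up for
  the denominator, which is at most \<open>4 * N\<^sup>2\<close>.\<close>

lemma A_elliptic:
  assumes y: "y \<in> strip c \<epsilon>"
  shows "(\<Sum>j\<in>UNIV. (z j)\<^sup>2) \<le> B * (\<Sum>i\<in>UNIV. (\<Sum>j\<in>UNIV. A i j y * z j)\<^sup>2)"
proof -
  note d = stripD[OF y]
  let ?a = "normal c (y $ 2)" and ?u = "u (y $ 2)"
  have a: "?a $ 1 * ?a $ 1 + ?a $ 2 * ?a $ 2 = 1" and au: "?a $ 1 * ?u $ 1 + ?a $ 2 * ?u $ 2 = 0"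
    using normal_unit[OF d(1)] normal_ortho[OF d(1)] by (simp_all add: inner_vec2)
  have nW: "(norm (W y))\<^sup>2 = (1 + y $ 1 * k (y $ 2))\<^sup>2 * (?u \<bullet> ?u)"
    by (simp add: W_def power_mult_distrib power2_norm_eq_inner)
  have W: "0 < (norm (W y))\<^sup>2" "(norm (W y))\<^sup>2 \<le> (2 * N)\<^sup>2"
  proof -
    have "0 < 1 / (2 * N)" using N by simp
    then have "0 < norm (W y)" using norm_W(1)[OF y] by linarith
    then show "0 < (norm (W y))\<^sup>2" by simp
    show "(norm (W y))\<^sup>2 \<le> (2 * N)\<^sup>2" using norm_W(2)[OF y] by (intro power_mono) auto
  qed
  have uw: "(?u \<bullet> ?u) / (w y)\<^sup>2 = 1 / (norm (W y))\<^sup>2"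
    using W(1) d(3) unfolding nW w_def by (simp add: power_mult_distrib power2_eq_square)
  have "(\<Sum>i\<in>UNIV. (\<Sum>j\<in>UNIV. A i j y * z j)\<^sup>2) = (z 1)\<^sup>2 * (?a $ 1 * ?a $ 1 + ?a $ 2 * ?a $ 2)
      + 2 * z 1 * z 2 / w y * (?a $ 1 * ?u $ 1 + ?a $ 2 * ?u $ 2) + (z 2)\<^sup>2 * ((?u \<bullet> ?u) / (w y)\<^sup>2)"
    by (simp add: sum_2 A_def inner_vec2 power2_eq_square algebra_simps add_divide_distrib)
  also have "\<dots> = (z 1)\<^sup>2 + (z 2)\<^sup>2 / (norm (W y))\<^sup>2" unfolding a au uw by simp
  finally have e: "(\<Sum>i\<in>UNIV. (\<Sum>j\<in>UNIV. A i j y * z j)\<^sup>2) = (z 1)\<^sup>2 + (z 2)\<^sup>2 / (norm (W y))\<^sup>2" .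
  have "(z 1)\<^sup>2 \<le> B * (z 1)\<^sup>2" using B_ge(1) by (simp add: mult_le_cancel_right1)
  moreover have "(z 2)\<^sup>2 \<le> B * ((z 2)\<^sup>2 / (norm (W y))\<^sup>2)"
  proof -
    have "(norm (W y))\<^sup>2 \<le> B" using W(2) B_ge(5) by (simp add: power_mult_distrib)
    then have "(norm (W y))\<^sup>2 * ((z 2)\<^sup>2 / (norm (W y))\<^sup>2) \<le> B * ((z 2)\<^sup>2 / (norm (W y))\<^sup>2)"
      by (intro mult_right_mono) auto
    then show ?thesis using W(1) by simp
  qed
  ultimately show ?thesis unfolding e unfolding sum_2 by (simp add: distrib_left)
qed

text \<open>The rule for inverse maps asks for a left inverse of the derivative of
  \<open>frenet c\<close> at \<open>R x\<close>, an inner point of the strip by openness of the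
  image. The matrix \<open>A\<close> is such an inverse, because inner products with the normal and
  with \<open>u\<close> read off the two components of \<open>h\<close>.\<close>

lemma branch_derivative:
  assumes br: "frenet_branch c \<epsilon> K R" and U: "open U" "U \<subseteq> K" and x: "x \<in> U"
  shows "(R has_derivative (\<lambda>h. \<chi> j. \<Sum>i\<in>UNIV. h $ i * A i j (R x))) (at x)"
proof (rule has_derivative_inverse_basic[where f = "frenet c" and T = U])
  have R: "continuous_on K R" "\<And>x. x \<in> K \<Longrightarrow> R x \<in> strip c \<epsilon>" "\<And>x. x \<in> K \<Longrightarrow> frenet c (R x) = x"
    using br by (auto simp: frenet_branch_def)
  have "R ` U \<subseteq> interior (strip c \<epsilon>)"
    using branch_open_image[OF br U] R U by (intro interior_maximal) auto
  then have int: "R x \<in> interior (strip c \<epsilon>)" using x by auto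
  have y: "R x \<in> strip c \<epsilon>" using R U x by auto
  show "(frenet c has_derivative E (R x)) (at (R x))"
    using frenet_derivative[OF y] at_within_interior[OF int] by simp
  show "bounded_linear (\<lambda>h. \<chi> j. \<Sum>i\<in>UNIV. h $ i * A i j (R x))"
    by (intro linear_conv_bounded_linear[THEN iffD1] linearI) (simp_all add: vec_eq_iff sum_2 algebra_simps)
  show "(\<lambda>h. \<chi> j. \<Sum>i\<in>UNIV. h $ i * A i j (R x)) \<circ> E (R x) = id"
  proof
    fix h
    note d = stripD[OF y]
    let ?a = "normal c (R x $ 2)" and ?u = "u (R x $ 2)"
    have e: "(\<Sum>i\<in>UNIV. E (R x) h $ i * v $ i) = E (R x) h \<bullet> v" for v
      by (simp add: inner_vec_def)
    have 1: "E (R x) h \<bullet> ?a = h $ 1"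
      using normal_unit[OF d(1)] normal_ortho[OF d(1)]
      by (simp add: E_def W_def inner_add_left inner_commute[of ?u ?a])
    have 2: "E (R x) h \<bullet> ?u = h $ 2 * w (R x)"
      using normal_ortho[OF d(1)] by (simp add: E_def W_def w_def inner_add_left)
    have "(\<Sum>i\<in>UNIV. E (R x) h $ i * A i j (R x)) = h $ j" for j
    proof (cases "j = 1")
      case True then show ?thesis using e[of ?a] 1 by (simp add: A_def)
    next
      case False
      then have "j = 2" using exhaust_2 by blast
      then show ?thesis using e[of ?u] 2 w_bounds(3)[OF y]
        by (simp add: A_def flip: sum_divide_distrib)
    qed
    then show "((\<lambda>h. \<chi> j. \<Sum>i\<in>UNIV. h $ i * A i j (R x)) \<circ> E (R x)) h = id h"
      by (simp add: vec_eq_iff)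
  qed
  show "continuous (at x) R"
    using R(1) U x by (meson continuous_on_eq_continuous_at continuous_on_subset)
  show "frenet c (R z) = z" if "z \<in> U" for z using R U that by auto
qed (use U x in auto)

text \<open>Since \<open>h = 2 * \<sigma> * r\<close>, the Lipschitz constant \<open>4 * N\<close>
  puts the image of \<open>R\<close> into a ball of radius \<open>8 * N * \<sigma> * r\<close>,
  while \<open>B\<close> bounds the coefficients; the sum serves every condition.
  \<open>branch_covers\<close> at radius \<open>r / 2\<close> yields an open ball of radius
  \<open>r / (4 * N)\<close>, so the closed one must be strictly smaller.\<close>

lemma branch_chart:
  assumes br: "frenet_branch c \<epsilon> K R" and K: "connected K"
    and diam: "\<And>x y. x \<in> K \<Longrightarrow> y \<in> K \<Longrightarrow> dist x y \<le> h"
    and h: "4 * N * h < 1 / (4 * N * M)" "h \<le> 1" and \<sigma>: "1 \<le> \<sigma>"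
    and r: "r = h / (2 * \<sigma>)" "0 < r" and sub: "ball x0 r \<subseteq> K"
  shows "chart (8 * N * \<sigma> + B) r (interior K) R x0 A DA"
proof
  have R: "continuous_on K R" "\<And>x. x \<in> K \<Longrightarrow> R x \<in> strip c \<epsilon>"
    using br by (auto simp: frenet_branch_def)
  have hr: "h = 2 * \<sigma> * r" using r \<sigma> by simp
  have N\<sigma>: "N \<le> N * \<sigma>" "\<sigma> \<le> N * \<sigma>" using mult_left_mono[OF \<sigma>, of N] mult_right_mono[OF N, of \<sigma>] N \<sigma> by auto
  have x0: "x0 \<in> K" using sub r by auto
  have S: "R ` interior K \<subseteq> strip c \<epsilon>" using R interior_subset by blast
  show "1 \<le> 8 * N * \<sigma> + B" using N\<sigma> N B_ge(1) by linarith
  show "0 < r" by fact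
  show "r \<le> 1"
  proof -
    have "1 * r \<le> 2 * \<sigma> * r" using \<sigma> r by (intro mult_right_mono) auto
    then show ?thesis using hr h by linarith
  qed
  show "open (interior K)" by simp
  show "ball x0 r \<subseteq> interior K" using sub by (intro interior_maximal) auto
  show "interior K \<subseteq> cball x0 ((8 * N * \<sigma> + B) * r)"
  proof
    fix x assume "x \<in> interior K"
    then have "dist x0 x \<le> 2 * \<sigma> * r" using diam x0 interior_subset hr by blast
    also have "\<dots> \<le> (8 * N * \<sigma> + B) * r"
    proof (rule mult_right_mono)
      show "2 * \<sigma> \<le> 8 * N * \<sigma> + B" using N\<sigma> B_ge(1) \<sigma> by linarith
    qed (use r(2) in simp)
    finally show "x \<in> cball x0 ((8 * N * \<sigma> + B) * r)" by simp
  qed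
  have small: "4 * N * dist x y < 1 / (4 * N * M)" if "x \<in> K" "y \<in> K" for x y
    using mult_left_mono[OF diam[OF that], of "4 * N"] N h(1) by linarith
  show "R ` interior K \<subseteq> cball (R x0) ((8 * N * \<sigma> + B) * r)"
  proof
    fix y assume "y \<in> R ` interior K"
    then obtain x where x: "x \<in> K" "y = R x" using interior_subset by blast
    have "dist (R x0) y \<le> 4 * N * dist x0 x"
      unfolding x(2) by (rule branch_lipschitz[OF br K small x0 x(1)])
    also have "\<dots> \<le> 4 * N * h" using diam[OF x0 x(1)] N by (intro mult_left_mono) auto
    also have "\<dots> = (8 * N * \<sigma>) * r" by (simp add: hr)
    also have "\<dots> \<le> (8 * N * \<sigma> + B) * r" using B_ge(1) r by (intro mult_right_mono) auto
    finally show "y \<in> cball (R x0) ((8 * N * \<sigma> + B) * r)" by simp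
  qed
  show "cball (R x0) (r / (8 * N * \<sigma> + B)) \<subseteq> R ` cball x0 (r / 2)"
  proof -
    have "4 * N < 8 * N * \<sigma> + B" using N\<sigma> N B_ge(1) by linarith
    then have "r / (8 * N * \<sigma> + B) < r / (4 * N)" using r N by (intro divide_strict_left_mono) auto
    then have "cball (R x0) (r / (8 * N * \<sigma> + B)) \<subseteq> ball (R x0) ((r / 2) / (2 * N))" by auto
    also have "\<dots> \<subseteq> R ` ball x0 (r / 2)"
      by (rule branch_covers[OF br]) (use sub r in auto)
    also have "\<dots> \<subseteq> R ` cball x0 (r / 2)" by auto
    finally show ?thesis .
  qed
  show "(R has_derivative (\<lambda>h. \<chi> j. \<Sum>i\<in>UNIV. h $ i * A i j (R x))) (at x)" if "x \<in> interior K" for x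
    by (rule branch_derivative[OF br open_interior interior_subset that])
  have le: "B \<le> 8 * N * \<sigma> + B" using N\<sigma> N by simp
  fix y assume y: "y \<in> R ` interior K"
  then have yS: "y \<in> strip c \<epsilon>" using S by blast
  have "R ` interior K \<subseteq> interior (strip c \<epsilon>)"
    using branch_open_image[OF br open_interior interior_subset] S by (rule interior_maximal[rotated])
  then have "at y within strip c \<epsilon> = at y" using y at_within_interior by blast
  then show "(A i j has_derivative (\<lambda>h. \<Sum>l\<in>UNIV. h $ l * DA i j l y)) (at y)" for i j
    using A_derivative[OF yS] by simp
  show "\<bar>A i j y\<bar> \<le> 8 * N * \<sigma> + B" "\<bar>DA i j l y\<bar> \<le> 8 * N * \<sigma> + B" for i j l
    using A_bound[OF yS] DA_bound[OF yS] le order.trans by blast+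
  show "(\<Sum>j\<in>UNIV. (z j)\<^sup>2) \<le> (8 * N * \<sigma> + B) * (\<Sum>i\<in>UNIV. (\<Sum>j\<in>UNIV. A i j y * z j)\<^sup>2)" for z
  proof -
    have "B * (\<Sum>i\<in>UNIV. (\<Sum>j\<in>UNIV. A i j y * z j)\<^sup>2) \<le> (8 * N * \<sigma> + B) * (\<Sum>i\<in>UNIV. (\<Sum>j\<in>UNIV. A i j y * z j)\<^sup>2)"
      by (intro mult_right_mono le sum_nonneg) auto
    then show ?thesis using A_elliptic[OF yS, of z] by linarith
  qed
next
  have "R ` interior K \<subseteq> strip c \<epsilon>" using br interior_subset unfolding frenet_branch_def by blast
  then show "continuous_on (R ` interior K) (DA i j l)" for i j l
    using DA_continuous continuous_on_subset by blast
qed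

end

section \<open>Elements of the mesh\<close>

lemma frenet_branch_chart:
  assumes "regular_curve 3 c" "tubular c \<epsilon>" "0 < \<epsilon>" "1 \<le> \<sigma>"
  obtains h1 N where "0 < h1" "1 \<le> N"
    "\<And>K R h x0. frenet_branch c \<epsilon> K R \<Longrightarrow> connected K \<Longrightarrow>
       (\<And>x y. x \<in> K \<Longrightarrow> y \<in> K \<Longrightarrow> dist x y \<le> h) \<Longrightarrow> 0 < h \<Longrightarrow> h \<le> h1 \<Longrightarrow>
       ball x0 (h / (2 * \<sigma>)) \<subseteq> K \<Longrightarrow> \<exists>A DA. chart N (h / (2 * \<sigma>)) (interior K) R x0 A DA"
proof -
  obtain N u u1 k k1 where "frenet_data c \<epsilon> N u u1 k k1"
    using frenet_data_exists[OF assms(1-3)] by blast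
  then interpret frenet_data c \<epsilon> N u u1 k k1 .
  \<comment> \<open>This makes \<open>4 * N * h\<close> at most \<open>1 / (8 * N * M)\<close>, half
    the threshold of \<open>frenet_expanding\<close>, as the strict inequality requires; the bound
    \<open>1\<close> leads to \<open>r \<le> 1\<close>.\<close>
  let ?h = "min 1 (1 / (32 * N\<^sup>2 * M))"
  show ?thesis
  proof (rule that[of ?h "8 * N * \<sigma> + B"])
    show "0 < ?h" using N M_pos by simp
    have "0 \<le> N * \<sigma>" using N assms(4) by simp
    then show "1 \<le> 8 * N * \<sigma> + B" using B_ge(1) by linarith
    fix K R h x0
    assume *: "frenet_branch c \<epsilon> K R" "connected K" "\<And>x y. x \<in> K \<Longrightarrow> y \<in> K \<Longrightarrow> dist x y \<le> h"
      "0 < h" "h \<le> ?h" "ball x0 (h / (2 * \<sigma>)) \<subseteq> K"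
    have "4 * N * h \<le> 4 * N * (1 / (32 * N\<^sup>2 * M))" using *(5) N by (intro mult_left_mono) auto
    also have "\<dots> = (1 / 2) * (1 / (4 * N * M))" using N by (simp add: power2_eq_square)
    also have "\<dots> < 1 * (1 / (4 * N * M))" using N M_pos by (intro mult_strict_right_mono) auto
    finally have "4 * N * h < 1 / (4 * N * M)" by simp
    then show "\<exists>A DA. chart (8 * N * \<sigma> + B) (h / (2 * \<sigma>)) (interior K) R x0 A DA"
      using branch_chart[OF *(1-3) _ _ assms(4) refl _ *(6)] *(4,5) assms(4) by auto
  qed
qed

lemma identity_chart:
  assumes \<sigma>: "1 \<le> \<sigma>" and h: "0 < h" "h \<le> 1" and U: "open U"
    and sub: "ball x0 (h / (2 * \<sigma>)) \<subseteq> U" "U \<subseteq> cball x0 h"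
  shows "chart (2 * \<sigma>) (h / (2 * \<sigma>)) U (\<lambda>x. x) x0 (\<lambda>i j y. if i = j then 1 else 0) (\<lambda>i j l y. 0)"
proof
  show "0 < h / (2 * \<sigma>)" using h \<sigma> by simp
  show "h / (2 * \<sigma>) \<le> 1" using h \<sigma> by simp
  show "U \<subseteq> cball x0 (2 * \<sigma> * (h / (2 * \<sigma>)))" "(\<lambda>x. x) ` U \<subseteq> cball x0 (2 * \<sigma> * (h / (2 * \<sigma>)))"
    using sub \<sigma> by auto
  have "h / (2 * \<sigma>) / (2 * \<sigma>) \<le> h / (2 * \<sigma>) / 2" using h \<sigma> by (intro divide_left_mono) auto
  then show "cball x0 (h / (2 * \<sigma>) / (2 * \<sigma>)) \<subseteq> (\<lambda>x. x) ` cball x0 (h / (2 * \<sigma>) / 2)" by auto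
  show "((\<lambda>x. x) has_derivative (\<lambda>h. \<chi> j. \<Sum>i\<in>UNIV. h $ i * (if i = j then 1 else 0))) (at x)" for x :: plane
    by (rule has_derivative_eq_rhs[OF has_derivative_ident])
      (simp add: fun_eq_iff vec_eq_iff if_distrib[of "\<lambda>c. _ * c"] cong: if_cong)
  show "(\<Sum>k\<in>UNIV. (z k)\<^sup>2) \<le> 2 * \<sigma> * (\<Sum>i\<in>UNIV. (\<Sum>k\<in>UNIV. (if i = k then 1 else 0) * z k)\<^sup>2)" for z :: "2 \<Rightarrow> real"
  proof -
    have "1 * (\<Sum>k\<in>UNIV. (z k)\<^sup>2) \<le> 2 * \<sigma> * (\<Sum>k\<in>UNIV. (z k)\<^sup>2)"
      using \<sigma> by (intro mult_right_mono sum_nonneg) auto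
    then show ?thesis by (simp add: if_distrib[of "\<lambda>c. c * _"] cong: if_cong)
  qed
qed (use \<sigma> U sub in auto)

text \<open>A curved region consists of a compact connected curve and the bounded set inside it;
  adding the inside of a closed connected set keeps the set connected.\<close>

lemma region_properties:
  assumes "admissible \<G> \<epsilon> K" "\<And>c. c \<in> \<G> \<Longrightarrow> regular_curve 3 c" "card (verts K) = 3"
  shows "bounded (region K)" "connected (region K)" "verts K \<subseteq> region K"
proof -
  have "bounded (region K) \<and> connected (region K) \<and> verts K \<subseteq> region K"
  proof (cases K)
    case (Straight V)
    then have "finite V" using assms(3) by (auto intro: card_ge_0_finite)
    then show ?thesis using Straight
      by (auto simp: finite_imp_bounded bounded_convex_hull convex_convex_hull convex_connected intro: hull_inc)
  next
    case (Curved c s t z)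
    have st: "s < t" "s \<in> pdom c" "t \<in> pdom c" and reg: "regular_curve 3 c"
      using assms Curved by auto
    have sub: "{s..t} \<subseteq> pdom c" using st by (auto simp: pdom_def split: if_splits)
    have "continuous_on (pdom c) (par c)"
    proof -
      obtain D where D: "D 0 = par c"
        "\<forall>i<3. \<forall>t\<in>pdom c. (D i has_vector_derivative D (Suc i) t) (at t within pdom c)"
        using reg unfolding regular_curve_def Ck_on_def by blast
      then have "\<forall>t\<in>pdom c. (par c has_vector_derivative D (Suc 0) t) (at t within pdom c)"
        by (metis zero_less_numeral)
      then show ?thesis
        using has_vector_derivative_continuous unfolding continuous_on_eq_continuous_within by blast
    qed
    then have cont: "continuous_on {s..t} (par c)" using sub by (rule continuous_on_subset)
    define S where "S = par c ` {s..t} \<union> closed_segment (par c t) z \<union> closed_segment z (par c s)"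
    have comp: "compact (par c ` {s..t})" and conn: "connected (par c ` {s..t})"
      using cont by (auto intro: compact_continuous_image connected_continuous_image)
    have "compact S" unfolding S_def using comp by (intro compact_Un) auto
    moreover have "connected S"
      unfolding S_def
    proof (intro connected_Un conn connected_segment)
      have "par c t \<in> par c ` {s..t} \<inter> closed_segment (par c t) z" using st by auto
      then show "par c ` {s..t} \<inter> closed_segment (par c t) z \<noteq> {}" by blast
      have "z \<in> (par c ` {s..t} \<union> closed_segment (par c t) z) \<inter> closed_segment z (par c s)" by auto
      then show "(par c ` {s..t} \<union> closed_segment (par c t) z) \<inter> closed_segment z (par c s) \<noteq> {}" by blast
    qed
    moreover have "region K = S \<union> inside S" using Curved by (simp add: S_def Let_def)
    moreover have "verts K \<subseteq> S" using Curved st by (auto simp: S_def)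
    ultimately show ?thesis
      using connected_with_inside[of S] bounded_inside[of S] by (auto simp: compact_imp_bounded compact_imp_closed)
  qed
  then show "bounded (region K)" "connected (region K)" "verts K \<subseteq> region K" by auto
qed

text \<open>\<open>inradius\<close> is a supremum that no ball in \<open>K\<close> has to attain, so
  half of the guaranteed radius is taken. Passing to a positive \<open>\<sigma>'\<close> makes the
  division safe.\<close>

lemma shape_regular_ball:
  fixes K :: "plane set"
  assumes reg: "shape_regular \<sigma> K" and bdd: "bounded K" and diam: "0 < diameter K"
    and \<sigma>': "\<sigma> \<le> \<sigma>'" "0 < \<sigma>'"
  obtains x where "ball x (diameter K / (2 * \<sigma>')) \<subseteq> K"
proof -
  let ?X = "{r. 0 \<le> r \<and> (\<exists>x. ball x r \<subseteq> K)}"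
  obtain b where b: "K \<subseteq> cball 0 b" using bdd by (auto simp: bounded_pos subset_iff)
  have "r \<le> max b 0" if "r \<in> ?X" for r
  proof -
    obtain x where "ball x r \<subseteq> K" using \<open>r \<in> ?X\<close> by auto
    then have "ball x r \<subseteq> cball 0 b" using b by (rule order.trans)
    then show ?thesis using zero_le_dist[of x 0] unfolding ball_subset_cball_iff by linarith
  qed
  then have "bdd_above ?X" by (rule bdd_aboveI)
  moreover have z: "0 \<in> ?X" by auto
  ultimately have "0 \<le> inradius K" unfolding inradius_def by (rule cSup_upper[rotated])
  then have "\<sigma> * inradius K \<le> \<sigma>' * inradius K" using \<sigma>' by (intro mult_right_mono)
  then have "diameter K \<le> \<sigma>' * inradius K" using reg by (simp add: shape_regular_def)
  then have "diameter K / (2 * \<sigma>') < inradius K" using diam \<sigma>' by (simp add: field_simps)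
  then obtain r where "r \<in> ?X" "diameter K / (2 * \<sigma>') < r"
    unfolding inradius_def using z less_cSupE[of _ ?X] by blast
  then obtain x where x: "ball x r \<subseteq> K" and le: "diameter K / (2 * \<sigma>') \<le> r" by auto
  show ?thesis by (rule that[OF order.trans[OF subset_ball[OF le] x]])
qed

lemma curved_mesh_element:
  assumes mesh: "curved_mesh \<Omega> \<Gamma>b \<Gamma>i \<epsilon> \<sigma> \<T>" and K: "K \<in> \<T>"
    and reg: "regular_curve 3 \<Gamma>b" "regular_curve 3 \<Gamma>i"
  shows "0 < diameter (region K)" "diameter (region K) \<le> mesh_size \<T>"
    "bounded (region K)" "connected (region K)" "shape_regular \<sigma> (region K)" "admissible {\<Gamma>b, \<Gamma>i} \<epsilon> K"
proof -
  have card: "card (verts K) = 3" using mesh K by (auto simp: curved_mesh_def straight_mesh_def)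
  show adm: "admissible {\<Gamma>b, \<Gamma>i} \<epsilon> K" and "shape_regular \<sigma> (region K)"
    using mesh K by (auto simp: curved_mesh_def)
  have "regular_curve 3 c" if "c \<in> {\<Gamma>b, \<Gamma>i}" for c using that reg by auto
  note p = region_properties[OF adm this card]
  show bdd: "bounded (region K)" and "connected (region K)" using p by auto
  obtain x y where xy: "x \<in> verts K" "y \<in> verts K" "x \<noteq> y"
    using card by (auto simp: card_Suc_eq numeral_3_eq_3)
  then have "0 < dist x y" by simp
  also have "\<dots> \<le> diameter (region K)" using diameter_bounded_bound[OF bdd] xy p(3) by blast
  finally show "0 < diameter (region K)" .
  show "diameter (region K) \<le> mesh_size \<T>"
    unfolding mesh_size_def using mesh K by (intro Max_ge) (auto simp: curved_mesh_def)
qed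

text \<open>Passing from the radius \<open>h / (2 * \<sigma>)\<close> back to \<open>h\<close> costs
  \<open>(2 * \<sigma>) ^ (j - l)\<close>, at most the square because \<open>j - l \<le> 2\<close>
  and \<open>1 \<le> 2 * \<sigma>\<close>.\<close>

lemma rescale_estimate:
  fixes K :: real
  assumes "a \<le> K / (h / (2 * \<sigma>)) ^ (j - l) * b" "0 \<le> b" "0 < h" "1 \<le> \<sigma>" "0 \<le> K" "K \<le> K'" "l \<le> j" "j \<le> 2"
  shows "a \<le> K' * (2 * \<sigma>)\<^sup>2 * h powi (int l - int j) * b"
proof -
  have "h powi (int l - int j) = inverse (h ^ (j - l))"
  proof -
    have "int l - int j = - int (j - l)" using assms(7) by simp
    then show ?thesis by (simp only: power_int_minus power_int_of_nat)
  qed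
  moreover have "K / (h / (2 * \<sigma>)) ^ (j - l) * b = K * (2 * \<sigma>) ^ (j - l) * inverse (h ^ (j - l)) * b"
    by (simp add: power_divide inverse_eq_divide)
  moreover have "K * (2 * \<sigma>) ^ (j - l) * inverse (h ^ (j - l)) * b \<le> K' * (2 * \<sigma>)\<^sup>2 * inverse (h ^ (j - l)) * b"
    using assms by (intro mult_right_mono mult_mono power_increasing) auto
  ultimately show ?thesis using assms(1) by simp
qed

text \<open>Membership in \<open>sobolev 2\<close> is established alongside the bound because it
  gives the seminorms their meaning. The constants are chosen before the family of meshes and
  therefore serve all of them.\<close>

theorem theorem3p2:
  fixes \<Omega> \<Omega>m \<Omega>p :: "plane set" and \<Gamma>b \<Gamma>i :: curve
    and \<epsilon>\<^sub>0 \<epsilon> \<sigma> \<mu> :: real and m :: nat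
  assumes "1 \<le> m"
    and "interface_geometry \<Omega> \<Omega>m \<Omega>p \<Gamma>b \<Gamma>i \<epsilon>\<^sub>0"
    and "regular_curve 3 \<Gamma>b" and "regular_curve 3 \<Gamma>i"
    and "0 < \<epsilon>" and "\<epsilon> \<le> \<epsilon>\<^sub>0"
  shows "\<exists>h\<^sub>0>0. \<exists>C>0. \<forall>H \<T>.
    H \<subseteq> {0<..h\<^sub>0} \<longrightarrow> quasi_uniform_family \<Omega> \<Gamma>b \<Gamma>i \<epsilon> \<sigma> \<mu> H \<T> \<longrightarrow>
    (\<forall>h\<in>H. \<forall>K\<in>\<T> h. \<forall>v\<in>local_space m \<epsilon> K.
       v \<in> sobolev 2 (interior (region K)) \<and>
       (\<forall>l j. l \<le> j \<and> j \<le> 2 \<longrightarrow>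
          seminorm j (interior (region K)) v
            \<le> C * diameter (region K) powi (int l - int j) *
                seminorm l (interior (region K)) v))"
proof -
  \<comment> \<open>Raising \<open>\<sigma>\<close> to at least one only weakens shape regularity
    and makes \<open>h / (2 * s)\<close> a positive radius.\<close>
  define s where "s = max 1 \<sigma>"
  have s: "1 \<le> s" "\<sigma> \<le> s" by (auto simp: s_def)
  have tub: "tubular \<Gamma>b \<epsilon>" "tubular \<Gamma>i \<epsilon>"
    using assms unfolding interface_geometry_def by blast+
  have curve: "\<exists>h1>0. \<exists>N\<ge>1. \<forall>K R h x0. frenet_branch c \<epsilon> K R \<longrightarrow> connected K \<longrightarrow>
       (\<forall>x\<in>K. \<forall>y\<in>K. dist x y \<le> h) \<longrightarrow> 0 < h \<longrightarrow> h \<le> h1 \<longrightarrow>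
       ball x0 (h / (2 * s)) \<subseteq> K \<longrightarrow> (\<exists>A DA. chart N (h / (2 * s)) (interior K) R x0 A DA)"
    if "regular_curve 3 c" "tubular c \<epsilon>" for c
    using frenet_branch_chart[OF that assms(5) s(1)] by metis
  obtain hb Nb where b: "0 < hb" "1 \<le> Nb"
    "\<And>K R h x0. frenet_branch \<Gamma>b \<epsilon> K R \<Longrightarrow> connected K \<Longrightarrow>
       (\<forall>x\<in>K. \<forall>y\<in>K. dist x y \<le> h) \<Longrightarrow> 0 < h \<Longrightarrow> h \<le> hb \<Longrightarrow>
       ball x0 (h / (2 * s)) \<subseteq> K \<Longrightarrow> \<exists>A DA. chart Nb (h / (2 * s)) (interior K) R x0 A DA"
    using curve[OF assms(3) tub(1)] by blast
  obtain hi Ni where i: "0 < hi" "1 \<le> Ni"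
    "\<And>K R h x0. frenet_branch \<Gamma>i \<epsilon> K R \<Longrightarrow> connected K \<Longrightarrow>
       (\<forall>x\<in>K. \<forall>y\<in>K. dist x y \<le> h) \<Longrightarrow> 0 < h \<Longrightarrow> h \<le> hi \<Longrightarrow>
       ball x0 (h / (2 * s)) \<subseteq> K \<Longrightarrow> \<exists>A DA. chart Ni (h / (2 * s)) (interior K) R x0 A DA"
    using curve[OF assms(4) tub(2)] by blast
  have s2: "1 \<le> 2 * s" using s by simp
  \<comment> \<open>The constant has to be chosen before the chart but after \<open>N\<close>. Three
    values of \<open>N\<close> occur, for the two curves and for straight elements, and the sum of
    the three resulting constants serves all elements.\<close>
  define good where "good = (\<lambda>N K. 0 < K \<and> (\<forall>r U R x0 A DA q v l j. chart N r U R x0 A DA \<longrightarrow>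
      q \<in> tensor_poly m \<longrightarrow> (\<forall>x\<in>U. v x = q (R x)) \<longrightarrow>
      v \<in> sobolev 2 U \<and> (l \<le> j \<and> j \<le> 2 \<longrightarrow> seminorm j U v \<le> K / r ^ (j - l) * seminorm l U v)))"
  have "\<exists>K. good N K" if "1 \<le> N" for N
    unfolding good_def by (rule chart_inverse_estimates[OF that, of m]) blast
  then obtain Kb Ki Ks where g: "good Nb Kb" "good Ni Ki" "good (2 * s) Ks"
    using b(2) i(2) s2 by meson
  have Kpos: "0 < Kb" "0 < Ki" "0 < Ks" using g by (auto simp: good_def)
  define h0 where "h0 = min 1 (min hb hi)"
  define C where "C = (Kb + Ki + Ks) * (2 * s)\<^sup>2"
  have main: "v \<in> sobolev 2 (interior (region K)) \<and> (l \<le> j \<and> j \<le> 2 \<longrightarrow>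
          seminorm j (interior (region K)) v \<le> C * diameter (region K) powi (int l - int j) * seminorm l (interior (region K)) v)"
    if mesh: "curved_mesh \<Omega> \<Gamma>b \<Gamma>i \<epsilon> \<sigma> \<T>" "mesh_size \<T> \<le> h0" "K \<in> \<T>" "v \<in> local_space m \<epsilon> K" for \<T> K v l j
  proof -
    define h where "h = diameter (region K)"
    note e = curved_mesh_element[OF mesh(1,3) assms(3,4)]
    have h: "0 < h" "h \<le> 1" "h \<le> hb" "h \<le> hi" using e(1,2) mesh(2) by (auto simp: h_def h0_def)
    obtain x0 where x0: "ball x0 (h / (2 * s)) \<subseteq> region K"
      using shape_regular_ball[OF e(5,3,1) s(2)] s(1) unfolding h_def by auto
    have dist: "\<forall>x\<in>region K. \<forall>y\<in>region K. dist x y \<le> h"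
      using diameter_bounded_bound[OF e(3)] by (auto simp: h_def)
    have "\<exists>N Kc R q A DA. good N Kc \<and> Kc \<le> Kb + Ki + Ks \<and> q \<in> tensor_poly m \<and>
        (\<forall>x\<in>region K. v x = q (R x)) \<and> chart N (h / (2 * s)) (interior (region K)) R x0 A DA"
    proof (cases K)
      case (Straight V)
      then obtain q where q: "q \<in> poly2 m" "\<forall>x\<in>region K. v x = q x" using mesh(4) by auto
      have "x0 \<in> region K" using x0 h s by (auto simp: subset_iff)
      then have "interior (region K) \<subseteq> cball x0 h" using dist interior_subset by fastforce
      moreover have "ball x0 (h / (2 * s)) \<subseteq> interior (region K)" using x0 by (intro interior_maximal) auto
      ultimately have "chart (2 * s) (h / (2 * s)) (interior (region K)) (\<lambda>x. x) x0 (\<lambda>i j y. if i = j then 1 else 0) (\<lambda>i j l y. 0)"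
        using h s by (intro identity_chart) auto
      moreover have "Ks \<le> Kb + Ki + Ks" using Kpos by simp
      moreover have "q \<in> tensor_poly m" using q poly2_subset_tensor_poly by blast
      ultimately show ?thesis using g(3) q(2)
        by (intro exI[of _ "2 * s"] exI[of _ Ks] exI[of _ "\<lambda>x. x"] exI[of _ q] exI conjI)
    next
      case (Curved c a t z)
      then obtain q R where q: "q \<in> poly2 m" "frenet_branch c \<epsilon> (region K) R" "\<forall>x\<in>region K. v x = q (R x)"
        using mesh(4) by (auto simp del: region.simps)
      have qt: "q \<in> tensor_poly m" using q poly2_subset_tensor_poly by blast
      have le: "Kb \<le> Kb + Ki + Ks" "Ki \<le> Kb + Ki + Ks" using Kpos by simp_all
      have "c = \<Gamma>b \<or> c = \<Gamma>i" using e(6) Curved by simp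
      then show ?thesis
      proof
        assume c: "c = \<Gamma>b"
        obtain A DA where "chart Nb (h / (2 * s)) (interior (region K)) R x0 A DA"
          using b(3)[OF q(2)[unfolded c] e(4) dist h(1,3) x0] by blast
        then show ?thesis using g(1) qt q(3) le
          by (intro exI[of _ Nb] exI[of _ Kb] exI[of _ R] exI[of _ q] exI conjI)
      next
        assume c: "c = \<Gamma>i"
        obtain A DA where "chart Ni (h / (2 * s)) (interior (region K)) R x0 A DA"
          using i(3)[OF q(2)[unfolded c] e(4) dist h(1,4) x0] by blast
        then show ?thesis using g(2) qt q(3) le
          by (intro exI[of _ Ni] exI[of _ Ki] exI[of _ R] exI[of _ q] exI conjI)
      qed
    qed
    then obtain N Kc R q A DA where ch: "good N Kc" "Kc \<le> Kb + Ki + Ks" "q \<in> tensor_poly m"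
        "\<forall>x\<in>region K. v x = q (R x)" "chart N (h / (2 * s)) (interior (region K)) R x0 A DA"
      by blast
    have vq: "\<forall>x\<in>interior (region K). v x = q (R x)" using ch(4) interior_subset by blast
    have est: "v \<in> sobolev 2 (interior (region K)) \<and> (l \<le> j \<and> j \<le> 2 \<longrightarrow>
        seminorm j (interior (region K)) v \<le> Kc / (h / (2 * s)) ^ (j - l) * seminorm l (interior (region K)) v)"
      using ch(1) ch(3,5) vq unfolding good_def by blast
    have "0 \<le> Kc" using ch(1) by (simp add: good_def)
    then show ?thesis
      using est rescale_estimate[OF _ seminorm_nonneg h(1) s(1) _ ch(2)] unfolding C_def h_def by blast
  qed
  show ?thesis
  proof (intro exI conjI allI impI ballI)
    show "0 < h0" using b(1) i(1) by (simp add: h0_def)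
    show "0 < C" using Kpos s by (simp add: C_def)
    fix H \<T> h K v
    assume H: "H \<subseteq> {0<..h0}" "quasi_uniform_family \<Omega> \<Gamma>b \<Gamma>i \<epsilon> \<sigma> \<mu> H \<T>" "h \<in> H" "K \<in> \<T> h" "v \<in> local_space m \<epsilon> K"
    then have mesh: "curved_mesh \<Omega> \<Gamma>b \<Gamma>i \<epsilon> \<sigma> (\<T> h)" "mesh_size (\<T> h) \<le> h0"
      by (auto simp: quasi_uniform_family_def)
    show "v \<in> sobolev 2 (interior (region K))" using main[OF mesh H(4,5)] by blast
    fix l j :: nat assume "l \<le> j \<and> j \<le> 2"
    then show "seminorm j (interior (region K)) v \<le> C * diameter (region K) powi (int l - int j) * seminorm l (interior (region K)) v"
      using main[OF mesh H(4,5)] by blast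
  qed
qed

end
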